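(* Let $n\ge 1$ and let $g_1,\dots,g_k$ be a generating set of $\mathrm{Sp}(2n,\mathbb{Z})$. Then the probability that a random product $g$ of length $N$ of $g_1,\dots,g_k$ satisfies all of the following conditions tends to $1$ as $N\to\infty$: (1) the characteristic polynomial of $g$ is irreducible (over $\mathbb{Z}$); (2) the characteristic polynomial of $g$ is not cyclotomic; (3) the characteristic polynomial of $g$ is not of the form $h(x^m)$ for a polynomial $h$ and an integer $m>1$.
   Context: $\mathrm{Sp}(2n,\mathbb{Z})$ is the group of $2n\times 2n$ integer matrices $M$ with $M^tJM=J$, $J=\begin{pmatrix}0&I_n\\-I_n&0\end{pmatrix}$. A random product of length $N$ of $g_1,\dots,g_k$ is $g_{i_1}g_{i_2}\cdots g_{i_N}$, where the indices $i_1,\dots,i_N$ are chosen independently and uniformly from $\{1,\dots,k\}$. *)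

theory Defs
  imports
    "HOL-Probability.Probability"
    "HOL-Algebra.Generated_Groups"
    "Jordan_Normal_Form.Char_Poly"
begin

definition J_mat :: "nat \<Rightarrow> int mat" where
  "J_mat n = four_block_mat (0\<^sub>m n n) (1\<^sub>m n) (- 1\<^sub>m n) (0\<^sub>m n n)"

definition Sp :: "nat \<Rightarrow> int mat monoid" where
  "Sp n =
    \<lparr>carrier = {M \<in> carrier_mat (2 * n) (2 * n). transpose_mat M * J_mat n * M = J_mat n},
     mult = (*),
     one = 1\<^sub>m (2 * n)\<rparr>"

lemma J_mat_carrier [simp]: "J_mat n \<in> carrier_mat (2 * n) (2 * n)"
  unfolding J_mat_def mult_2 by (rule four_block_carrier_mat) auto

lemma J_mat_square: "J_mat n * J_mat n = - 1\<^sub>m (2 * n)"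
proof -
  have "J_mat n * J_mat n = four_block_mat (- 1\<^sub>m n) (0\<^sub>m n n) (0\<^sub>m n n) (- 1\<^sub>m n)"
    unfolding J_mat_def
    by (subst mult_four_block_mat[where ?nr1.0 = n and ?n1.0 = n and ?n2.0 = n
          and ?nr2.0 = n and ?nc1.0 = n and ?nc2.0 = n]) auto
  also have "\<dots> = - 1\<^sub>m (2 * n)"
    by (rule eq_matI) auto
  finally show ?thesis .
qed

lemma group_Sp: "group (Sp n)"
proof (rule groupI)
  let ?d = "2 * n" and ?J = "J_mat n"
  note assoc = assoc_mult_mat[of _ ?d ?d _ ?d _ ?d]
  have J: "?J \<in> carrier_mat ?d ?d" by simp
  show "\<one>\<^bsub>Sp n\<^esub> \<in> carrier (Sp n)"
    by (simp add: Sp_def left_mult_one_mat[OF J] right_mult_one_mat[OF J])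
  show "x \<otimes>\<^bsub>Sp n\<^esub> y \<in> carrier (Sp n)" if "x \<in> carrier (Sp n)" "y \<in> carrier (Sp n)" for x y
  proof -
    have x: "x \<in> carrier_mat ?d ?d" "transpose_mat x * ?J * x = ?J"
      and y: "y \<in> carrier_mat ?d ?d" "transpose_mat y * ?J * y = ?J"
      using that by (auto simp: Sp_def)
    have "transpose_mat (x * y) * ?J * (x * y) = transpose_mat y * (transpose_mat x * ?J * x) * y"
      using x(1) y(1) J by (simp add: transpose_mult assoc mult_carrier_mat[of _ ?d ?d _ ?d])
    then show ?thesis using x y by (simp add: Sp_def)
  qed
  show "x \<otimes>\<^bsub>Sp n\<^esub> y \<otimes>\<^bsub>Sp n\<^esub> z = x \<otimes>\<^bsub>Sp n\<^esub> (y \<otimes>\<^bsub>Sp n\<^esub> z)"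
    if "x \<in> carrier (Sp n)" "y \<in> carrier (Sp n)" "z \<in> carrier (Sp n)" for x y z
    using that by (auto simp: Sp_def intro: assoc)
  show "\<one>\<^bsub>Sp n\<^esub> \<otimes>\<^bsub>Sp n\<^esub> x = x" if "x \<in> carrier (Sp n)" for x
    using that by (auto simp: Sp_def)
  show "\<exists>y\<in>carrier (Sp n). y \<otimes>\<^bsub>Sp n\<^esub> x = \<one>\<^bsub>Sp n\<^esub>" if "x \<in> carrier (Sp n)" for x
  proof -
    have x: "x \<in> carrier_mat ?d ?d" and xJ: "transpose_mat x * ?J * x = ?J"
      using that by (auto simp: Sp_def)
    have xt: "transpose_mat x \<in> carrier_mat ?d ?d" using x by simp
    have dJ: "det ?J * det ?J \<noteq> 0"
    proof -
      have "?J * (- ?J) = 1\<^sub>m ?d"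
        using carrier_matD[OF J] by (simp add: J_mat_square uminus_mult_right_mat)
      then have "det ?J * det (- ?J) = 1"
        using det_mult[of ?J ?d "- ?J"] J by simp
      then show ?thesis by auto
    qed
    have "det x * det ?J * det x = det ?J"
      using arg_cong[OF xJ, of det] x xt J
      by (simp add: det_mult[of _ ?d] det_transpose[OF x] mult_carrier_mat[of _ ?d ?d _ ?d])
    with dJ have dx: "det x * det x = 1" by simp
    define y where "y = det x \<cdot>\<^sub>m adj_mat x"
    have y: "y \<in> carrier_mat ?d ?d"
      using adj_mat(1)[OF x] by (simp add: y_def)
    have yx: "y * x = 1\<^sub>m ?d" and xy: "x * y = 1\<^sub>m ?d"
      using adj_mat[OF x] x dx
      by (auto simp: y_def mult_smult_assoc_mat[of _ ?d ?d] mult_smult_distrib[of _ ?d ?d] intro!: eq_matI)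
    have yt: "transpose_mat y \<in> carrier_mat ?d ?d" using y by simp
    have "transpose_mat y * ?J * y = transpose_mat y * (transpose_mat x * ?J * x) * y"
      by (simp add: xJ)
    also have "\<dots> = (transpose_mat y * transpose_mat x) * ?J * (x * y)"
      using x y xt yt J by (simp add: assoc mult_carrier_mat[of _ ?d ?d _ ?d])
    also have "transpose_mat y * transpose_mat x = 1\<^sub>m ?d"
      using transpose_mult[OF x y] xy by simp
    finally have "transpose_mat y * ?J * y = ?J"
      using J by (simp add: xy)
    then show ?thesis
      using y yx by (intro bexI[of _ y]) (auto simp: Sp_def)
  qed
qed

text \<open>The \<open>d\<close>-th cyclotomic polynomial is the product of \<open>x - \<zeta>\<close> over the primitive \<open>d\<close>-th roots
  of unity \<open>\<zeta> = exp (2 \<pi> i j / d)\<close>, \<open>j\<close> coprime to \<open>d\<close>. It has integer coefficients, but is built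
  over the complex numbers.\<close>

definition cyclotomic_poly :: "nat \<Rightarrow> complex poly" where
  "cyclotomic_poly d = (\<Prod>j | j \<in> {1..d} \<and> coprime j d. [:- cis (2 * pi * real j / real d), 1:])"

definition is_cyclotomic :: "int poly \<Rightarrow> bool" where
  "is_cyclotomic p \<longleftrightarrow> (\<exists>d\<ge>1. map_poly of_int p = cyclotomic_poly d)"

definition random_product :: "nat \<Rightarrow> (nat \<Rightarrow> int mat) \<Rightarrow> nat \<Rightarrow> nat \<Rightarrow> int mat pmf" where
  "random_product n g k N =
    map_pmf (\<lambda>is. foldr (\<lambda>i A. g i * A) is (1\<^sub>m (2 * n))) (replicate_pmf N (pmf_of_set {1..k}))"

end

theory Submission
  imports Defs
    "HOL-Algebra.Multiplicative_Group"
    "HOL-Algebra.QuotRing"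
    "HOL-Number_Theory.Number_Theory"
begin

text \<open>The three conditions are detected modulo primes. A reciprocal polynomial of degree \<open>2 n\<close> that is
irreducible modulo one prime \<open>p\<close> is irreducible over the integers, and (2) and (3) hold as soon as
the trace avoids the interval from \<open>- 2 n\<close> to \<open>2 n\<close>: a product of \<open>2 n\<close> linear factors \<open>x - \<zeta>\<close> with
\<open>\<bar>\<zeta>\<bar> = 1\<close> has a second coefficient of absolute value at most \<open>2 n\<close>, and in \<open>h(x\<^sup>m)\<close> with \<open>m > 1\<close> the
coefficient of \<open>x\<close> to the power \<open>2 n - 1\<close> vanishes. So one prime \<open>p\<close> at which the characteristic
polynomial lies in \<open>good_polys p n\<close> is enough (\<open>good_char_imp_nice\<close>).

For every large prime \<open>p\<close> the good residues form at least the fraction \<open>1 / (8 n)\<close> of the image of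
\<open>Sp(2n,\<int>)\<close> modulo \<open>p\<close> (\<open>card_good_residues\<close>). The polynomials are counted by factoring
\<open>x\<^bsup>p^n + 1\<^esup> - 1\<close> modulo \<open>p\<close>: it is squarefree, almost all of its degree sits in prime factors of degree
\<open>2 n\<close>, and these are reciprocal (\<open>card_cyc_primes\<close>, \<open>cyc_primes_palindromic\<close>). Each of them is the
characteristic polynomial of an explicit integral symplectic matrix (\<open>char_poly_companion\<close>,
\<open>companion_Sp\<close>). The centralizer of that matrix modulo \<open>p\<close> consists of elements \<open>u\<close> of a field with
\<open>u\<^bsup>p^n + 1\<^esup> = 1\<close>, so it has at most \<open>p\<^sup>n + 1\<close> elements (\<open>card_centralizer_le\<close>), and its conjugacy class
is correspondingly large. There are about \<open>p\<^sup>n / (2 n)\<close> classes of this kind, which gives a fraction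
that does not depend on \<open>p\<close>.

Different primes are independent. Transvections have integral lifts with any prescribed residue of
their parameter, and they generate the symplectic group modulo \<open>p\<close> (\<open>S_all\<close>); hence the image of
\<open>Sp(2n,\<int>)\<close> modulo a product of distinct primes greater than \<open>3\<close> is the product of its images modulo the
primes (\<open>Sp_crt\<close>), and it is perfect (\<open>perfect_mod_step\<close>). Perfectness excludes periodicity of the walk,
so the walk equidistributes in every such finite quotient (\<open>walk_equidistributes\<close>). For \<open>r\<close> large primes,
the probability to be bad at all of them is therefore asymptotically at most \<open>(1 - 1 / (8 n))\<^sup>r\<close>
(\<open>card_bad_residues\<close>), and \<open>r\<close> is arbitrary.\<close>

hide_const (open) up_ring.coeff up_ring.monom module.smult

section \<open>Polynomials modulo a prime\<close>

text \<open>Divisibility modulo \<open>p\<close>, that is, \<open>g\<close> lies in the ideal of \<open>\<int>[x]\<close> generated by \<open>p\<close> and \<open>f\<close>. Residues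
are kept as integer polynomials because the final argument uses unboundedly many primes at once,
and a type of residues would fix one of them.\<close>

definition dvdm :: "nat \<Rightarrow> int poly \<Rightarrow> int poly \<Rightarrow> bool" where
  "dvdm p f g \<longleftrightarrow> (\<exists>q. [:int p:] dvd g - q * f)"

text \<open>The prime ideals \<open>(p, f)\<close> with monic \<open>f\<close> of positive degree. Primality is taken instead of
irreducibility because it is what makes the residue ring an integral domain.\<close>

definition primem :: "nat \<Rightarrow> int poly \<Rightarrow> bool" where
  "primem p f \<longleftrightarrow> lead_coeff f = 1 \<and> degree f > 0 \<and>
     (\<forall>a b. dvdm p f (a * b) \<longrightarrow> dvdm p f a \<or> dvdm p f b)"

lemma dvdm_0 [simp]: "dvdm p f 0"
  unfolding dvdm_def by (rule exI[of _ 0]) simp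

lemma dvdm_self [simp]: "dvdm p f f"
  unfolding dvdm_def by (rule exI[of _ 1]) simp

lemma dvdm_const: "[:int p:] dvd g \<Longrightarrow> dvdm p f g"
  unfolding dvdm_def by (rule exI[of _ 0]) simp

lemma dvdm_add: assumes "dvdm p f a" "dvdm p f b" shows "dvdm p f (a + b)"
proof -
  from assms obtain q r where "[:int p:] dvd a - q * f" "[:int p:] dvd b - r * f"
    unfolding dvdm_def by blast
  then have "[:int p:] dvd (a - q * f) + (b - r * f)" by (rule dvd_add)
  then have "[:int p:] dvd (a + b) - (q + r) * f" by (simp add: algebra_simps)
  then show ?thesis unfolding dvdm_def by blast
qed

lemma dvdm_mult: assumes "dvdm p f a" shows "dvdm p f (c * a)"
proof -
  from assms obtain q where "[:int p:] dvd a - q * f" unfolding dvdm_def by blast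
  then have "[:int p:] dvd c * (a - q * f)" by (rule dvd_mult)
  then have "[:int p:] dvd c * a - (c * q) * f" by (simp add: algebra_simps)
  then show ?thesis unfolding dvdm_def by blast
qed

lemma dvdm_mult2: "dvdm p f a \<Longrightarrow> dvdm p f (a * c)"
  using dvdm_mult[of p f a c] by (simp add: mult.commute)

lemma dvdm_uminus: "dvdm p f a \<Longrightarrow> dvdm p f (- a)"
  using dvdm_mult[of p f a "-1"] by simp

lemma dvdm_uminus_iff [simp]: "dvdm p f (- a) \<longleftrightarrow> dvdm p f a"
  using dvdm_uminus[of p f a] dvdm_uminus[of p f "-a"] by auto

lemma dvdm_diff: "dvdm p f a \<Longrightarrow> dvdm p f b \<Longrightarrow> dvdm p f (a - b)"
  using dvdm_add[of p f a "- b"] by simp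

lemma dvdm_trans: assumes "dvdm p f g" "dvdm p g h" shows "dvdm p f h"
proof -
  from assms(2) obtain q where "[:int p:] dvd h - q * g" unfolding dvdm_def by blast
  then have "dvdm p f (h - q * g)" by (rule dvdm_const)
  moreover have "dvdm p f (q * g)" using assms(1) by (rule dvdm_mult)
  ultimately show ?thesis using dvdm_add by fastforce
qed

lemma dvd_imp_dvdm: "f dvd g \<Longrightarrow> dvdm p f g"
  by (metis dvdm_mult2 dvdm_self dvd_def)

definition congm :: "nat \<Rightarrow> int poly \<Rightarrow> int poly \<Rightarrow> int poly \<Rightarrow> bool" where
  "congm p f a b \<longleftrightarrow> dvdm p f (a - b)"

lemma congm_refl [simp]: "congm p f a a"
  by (simp add: congm_def)

lemma congm_sym: "congm p f a b \<Longrightarrow> congm p f b a"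
  unfolding congm_def using dvdm_uminus[of p f "a - b"] by simp

lemma congm_trans [trans]: "congm p f a b \<Longrightarrow> congm p f b c \<Longrightarrow> congm p f a c"
  unfolding congm_def using dvdm_add[of p f "a - b" "b - c"] by simp

lemma congm_add: "congm p f a b \<Longrightarrow> congm p f c d \<Longrightarrow> congm p f (a + c) (b + d)"
  unfolding congm_def using dvdm_add[of p f "a - b" "c - d"] by (simp add: algebra_simps)

lemma congm_mult: assumes "congm p f a b" "congm p f c d" shows "congm p f (a * c) (b * d)"
proof -
  have "dvdm p f (c * (a - b) + b * (c - d))"
    using assms unfolding congm_def by (intro dvdm_add dvdm_mult)
  then show ?thesis unfolding congm_def by (simp add: algebra_simps)
qed

lemma congm_pow: "congm p f a b \<Longrightarrow> congm p f (a ^ k) (b ^ k)"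
  by (induction k) (auto intro: congm_mult)

lemma congm_dvdm: "congm p f a b \<Longrightarrow> dvdm p f b \<Longrightarrow> dvdm p f a"
  unfolding congm_def using dvdm_add[of p f "a - b" b] by simp

lemma congm_const: "[:int p:] dvd a - b \<Longrightarrow> congm p f a b"
  unfolding congm_def by (rule dvdm_const)

lemma dvdm_cong_left: assumes "[:int p:] dvd f - f'" "dvdm p f g" shows "dvdm p f' g"
proof -
  have "dvdm p f' f" unfolding dvdm_def by (rule exI[of _ 1]) (use assms in simp)
  then show ?thesis using assms(2) dvdm_trans by blast
qed

lemma monic_division:
  fixes f g :: "int poly"
  assumes "lead_coeff f = 1"
  obtains q r where "g = q * f + r" "r = 0 \<or> degree r < degree f"
proof -
  have f0: "f \<noteq> 0" using assms by auto
  obtain q r where qr: "pseudo_divmod g f = (q, r)" by (meson surj_pair)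
  from pseudo_divmod[OF f0 qr] show thesis
    using assms that[of q r] by (simp add: mult.commute)
qed

lemma const_dvd_coeff: "[:c:] dvd (f::int poly) \<longleftrightarrow> (\<forall>i. c dvd coeff f i)"
  by (simp add: const_poly_dvd_iff)

definition reduced_polys :: "nat \<Rightarrow> nat \<Rightarrow> int poly set" where
  "reduced_polys p d = {u. (\<forall>i. coeff u i \<in> {0..<int p}) \<and> (\<forall>i\<ge>d. coeff u i = 0)}"

lemma reduced_polys_0: "p > 0 \<Longrightarrow> reduced_polys p 0 = {0}"
  by (auto simp: reduced_polys_def poly_eq_iff)

lemma reduced_polys_Suc: assumes "p > 0"
  shows "reduced_polys p (Suc d) = (\<lambda>(a, u). pCons a u) ` ({0..<int p} \<times> reduced_polys p d)"
proof (intro Set.set_eqI iffI)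
  fix u assume u: "u \<in> reduced_polys p (Suc d)"
  obtain a v where uv: "u = pCons a v" by (cases u)
  have "a = coeff u 0" "\<And>i. coeff v i = coeff u (Suc i)" by (auto simp: uv)
  with u have "a \<in> {0..<int p}" "v \<in> reduced_polys p d" by (auto simp: reduced_polys_def)
  then show "u \<in> (\<lambda>(a, u). pCons a u) ` ({0..<int p} \<times> reduced_polys p d)" using uv by force
next
  fix u assume "u \<in> (\<lambda>(a, u). pCons a u) ` ({0..<int p} \<times> reduced_polys p d)"
  then obtain a v where "u = pCons a v" "a \<in> {0..<int p}" "v \<in> reduced_polys p d" by auto
  then show "u \<in> reduced_polys p (Suc d)" using assms by (auto simp: reduced_polys_def coeff_pCons split: nat.splits)
qed

lemma card_reduced_polys: assumes "p > 0" shows "finite (reduced_polys p d) \<and> card (reduced_polys p d) = p ^ d"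
proof (induction d)
  case 0 then show ?case using assms by (simp add: reduced_polys_0)
next
  case (Suc d)
  have "inj_on (\<lambda>(a, u). pCons a u) ({0..<int p} \<times> reduced_polys p d)" by (auto simp: inj_on_def)
  then show ?case using Suc by (simp add: reduced_polys_Suc[OF assms] card_image card_cartesian_product)
qed

definition reduce_poly :: "nat \<Rightarrow> int poly \<Rightarrow> int poly" where
  "reduce_poly p f = map_poly (\<lambda>c. c mod int p) f"

lemma coeff_reduce_poly [simp]: "coeff (reduce_poly p f) i = coeff f i mod int p"
  by (simp add: reduce_poly_def coeff_map_poly)

lemma reduce_poly_cong: "[:int p:] dvd f - reduce_poly p f" "[:int p:] dvd reduce_poly p f - f"
  by (auto simp: const_dvd_coeff mod_eq_dvd_iff[symmetric])

lemma reduce_poly_eq_iff: "reduce_poly p f = reduce_poly p g \<longleftrightarrow> [:int p:] dvd f - g"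
  by (auto simp: const_dvd_coeff poly_eq_iff mod_eq_dvd_iff)

lemma reduce_poly_eq_0_iff: "reduce_poly p f = 0 \<longleftrightarrow> [:int p:] dvd f"
  by (auto simp: const_dvd_coeff poly_eq_iff mod_0_imp_dvd)

lemma degree_reduce_poly_le: "degree (reduce_poly p f) \<le> degree f"
  by (rule degree_le) (simp add: coeff_eq_0)

text \<open>In \<open>q * f\<close> with \<open>q\<close> reduced and nonzero, the leading coefficient of \<open>q\<close> survives at a degree that is at
least \<open>degree f\<close>, since \<open>f\<close> is monic. This is the uniqueness of remainders modulo \<open>p\<close>.\<close>

lemma dvdm_low_degree:
  assumes p: "p > 0" and f: "lead_coeff f = 1" and r: "dvdm p f r" "\<And>i. i \<ge> degree f \<Longrightarrow> int p dvd coeff r i"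
  shows "[:int p:] dvd r"
proof -
  from r(1) obtain q where q: "[:int p:] dvd r - q * f" unfolding dvdm_def by blast
  let ?q = "reduce_poly p q"
  have "[:int p:] dvd (r - q * f) + (q - ?q) * f"
    using q reduce_poly_cong(1)[of p q] by (intro dvd_add dvd_mult2)
  then have *: "[:int p:] dvd r - ?q * f" by (simp add: algebra_simps)
  have "?q = 0"
  proof (rule ccontr)
    assume q0: "?q \<noteq> 0"
    have "coeff (?q * f) (degree ?q + degree f) = lead_coeff ?q"
      using f by (simp add: coeff_mult_degree_sum)
    moreover have "int p dvd coeff (r - ?q * f) (degree ?q + degree f)"
      using * by (simp add: const_dvd_coeff)
    moreover have "int p dvd coeff r (degree ?q + degree f)" by (rule r(2)) simp
    ultimately have "int p dvd lead_coeff ?q"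
      by (simp only: coeff_diff dvd_diff_right_iff)
    moreover have "lead_coeff ?q \<ge> 0" "lead_coeff ?q < int p" using p by simp_all
    ultimately have "lead_coeff ?q = 0" using zdvd_not_zless[of "lead_coeff ?q" "int p"] by linarith
    then show False using q0 leading_coeff_0_iff by blast
  qed
  with * show ?thesis by simp
qed

lemma dvdm_low_degree':
  assumes "p > 0" "lead_coeff f = 1" "dvdm p f r" "degree r < degree f"
  shows "[:int p:] dvd r"
  by (rule dvdm_low_degree[OF assms(1-3)]) (use assms(4) in \<open>simp add: coeff_eq_0\<close>)

lemma monic_associate_mod:
  assumes p: "prime p" and r: "\<not> [:int p:] dvd r"
  obtains c g where "lead_coeff g = 1" "degree g \<le> degree r" "[:int p:] dvd g - smult c r"
proof -
  let ?r = "reduce_poly p r"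
  have r0: "?r \<noteq> 0" using r by (simp add: reduce_poly_eq_0_iff)
  let ?l = "lead_coeff ?r" and ?d = "degree ?r"
  have "?l \<noteq> 0" using r0 by (simp only: leading_coeff_0_iff not_False_eq_True)
  moreover have "?l \<ge> 0" "?l < int p" using prime_gt_0_nat[OF p] by simp_all
  ultimately have "\<not> int p dvd ?l" using zdvd_not_zless[of ?l "int p"] by linarith
  then have "coprime ?l (int p)"
    using prime_imp_coprime[of "int p" ?l] p by (simp add: coprime_commute del: coeff_reduce_poly)
  then obtain c where c: "[?l * c = 1] (mod (int p))" using cong_solve_coprime_int by blast
  \<comment> \<open>The leading coefficient \<open>?l * c\<close> of \<open>smult c ?r\<close> is only congruent to \<open>1\<close>; it is replaced by \<open>1\<close> itself.\<close>
  define h where "h = smult c ?r - monom (?l * c - 1) ?d"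
  have ch: "coeff h i = c * coeff ?r i - (if i = ?d then ?l * c - 1 else 0)" for i
    by (simp add: h_def)
  have "coeff h ?d = 1" by (simp only: ch) simp
  moreover have "coeff h i = 0" if "i > ?d" for i using that by (simp add: ch coeff_eq_0 del: coeff_reduce_poly)
  ultimately have dh: "degree h = ?d" by (metis le_degree degree_le leD linorder_neqE_nat zero_neq_one)
  have lh: "lead_coeff h = 1" using \<open>coeff h ?d = 1\<close> dh by simp
  have "[:int p:] dvd h - smult c ?r"
    using c by (auto simp: const_dvd_coeff ch cong_iff_dvd_diff dvd_diff_commute simp del: coeff_reduce_poly)
  moreover have "[:int p:] dvd [:c:] * (?r - r)" using reduce_poly_cong by (intro dvd_mult)
  ultimately have "[:int p:] dvd (h - smult c ?r) + smult c (?r - r)" by (intro dvd_add) auto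
  then have "[:int p:] dvd h - smult c r" by (simp add: smult_diff_right)
  then show thesis using that[of h c] lh dh degree_reduce_poly_le[of p r] by simp
qed


lemma monic_not_cong_0: assumes "prime p" "lead_coeff (g::int poly) = 1" shows "\<not> [:int p:] dvd g"
proof
  assume "[:int p:] dvd g"
  then have "int p dvd lead_coeff g" by (simp only: const_dvd_coeff)
  then show False using assms by auto
qed

lemma const_cong_sym: "[:c:] dvd a - b \<Longrightarrow> [:c:] dvd b - (a::int poly)"
  using dvd_minus_iff[of "[:c:]" "a - b"] by simp

lemma dvdm_1_iff: assumes "prime p" "lead_coeff f = 1" "degree f > 0" shows "\<not> dvdm p f 1"
proof
  assume "dvdm p f 1"
  then have "[:int p:] dvd 1" using assms prime_gt_0_nat[of p] by (intro dvdm_low_degree'[of p f]) auto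
  then show False using monic_not_cong_0[OF assms(1), of 1] by simp
qed

text \<open>Modulo \<open>p\<close> every ideal is principal: a monic \<open>g\<close> of least degree in the ideal \<open>(p, f, u)\<close> divides all of
its elements, because a remainder that is nonzero modulo \<open>p\<close> would have a monic multiple of smaller
degree. If \<open>f\<close> divides \<open>u * v\<close> but neither factor, then this \<open>g\<close> is a proper divisor of \<open>f\<close>.\<close>

lemma nonprime_splits:
  assumes p: "prime p" and f: "lead_coeff f = 1" "degree f > 0" and np: "\<not> primem p f"
  obtains g h where "lead_coeff g = 1" "lead_coeff h = 1" "0 < degree g" "degree g < degree f"
    "0 < degree h" "degree h < degree f" "[:int p:] dvd f - g * h"
proof -
  note p0 = prime_gt_0_nat[OF p]
  from np f obtain u v where uv: "dvdm p f (u * v)" "\<not> dvdm p f u" "\<not> dvdm p f v"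
    unfolding primem_def by blast
  define I where "I = {g. \<exists>a b. [:int p:] dvd g - (a * f + b * u)}"
  have II: "dvdm p f (g * v)" if "g \<in> I" for g
  proof -
    from that obtain a b where "[:int p:] dvd g - (a * f + b * u)" by (auto simp: I_def)
    then have "[:int p:] dvd (g - (a * f + b * u)) * v" by (rule dvd_mult2)
    then have "dvdm p f ((g - (a * f + b * u)) * v)" by (rule dvdm_const)
    moreover have "dvdm p f ((a * v) * f + b * (u * v))" 
      by (rule dvdm_add[OF dvdm_mult[OF dvdm_self] dvdm_mult[OF uv(1)]])
    ultimately have "dvdm p f ((g - (a * f + b * u)) * v + ((a * v) * f + b * (u * v)))" by (rule dvdm_add)
    also have "(g - (a * f + b * u)) * v + ((a * v) * f + b * (u * v)) = g * v" by (simp add: algebra_simps)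
    finally show ?thesis .
  qed
  have fI: "f \<in> I" unfolding I_def by (rule CollectI, rule exI[of _ 1], rule exI[of _ 0]) simp
  have uI: "u \<in> I" unfolding I_def by (rule CollectI, rule exI[of _ 0], rule exI[of _ 1]) simp
  have comb: "h - q * g \<in> I" if "h \<in> I" "g \<in> I" for g h q
  proof -
    from that obtain a b c d where
      "[:int p:] dvd h - (a * f + b * u)" "[:int p:] dvd g - (c * f + d * u)" by (auto simp: I_def)
    then have "[:int p:] dvd (h - (a * f + b * u)) - q * (g - (c * f + d * u))"
      by (rule dvd_diff[OF _ dvd_mult])
    also have "\<dots> = (h - q * g) - ((a - q * c) * f + (b - q * d) * u)" by (simp add: algebra_simps)
    finally show ?thesis unfolding I_def by blast
  qed
  define P where "P = (\<lambda>g. g \<in> I \<and> lead_coeff g = 1)"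
  define g where "g = arg_min degree P"
  have Pf: "P f" using fI f by (simp add: P_def)
  have Pg: "P g" unfolding g_def by (rule arg_min_natI[of P, OF Pf])
  have gmin: "degree g \<le> degree h" if "P h" for h unfolding g_def by (rule arg_min_nat_le[of P, OF that])
  have g1: "lead_coeff g = 1" and gI: "g \<in> I" using Pg by (auto simp: P_def)
  have gdiv: "\<exists>q. [:int p:] dvd h - q * g" if h: "h \<in> I" for h
  proof -
    obtain q r where qr: "h = q * g + r" "r = 0 \<or> degree r < degree g" using monic_division[OF g1] .
    have rI: "r \<in> I" using comb[OF h gI, of q] qr(1) by simp
    have "[:int p:] dvd r"
    proof (rule ccontr)
      assume r: "\<not> [:int p:] dvd r"
      from monic_associate_mod[OF p r] obtain c k where
        k: "lead_coeff k = 1" "degree k \<le> degree r" "[:int p:] dvd k - smult c r" .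
      from rI obtain a b where "[:int p:] dvd r - (a * f + b * u)" by (auto simp: I_def)
      then have "[:int p:] dvd [:c:] * (r - (a * f + b * u))" by (rule dvd_mult)
      with k(3) have "[:int p:] dvd (k - smult c r) + [:c:] * (r - (a * f + b * u))" by (rule dvd_add)
      also have "\<dots> = k - (([:c:] * a) * f + ([:c:] * b) * u)"
        by (simp add: algebra_simps smult_add_right)
      finally have "k \<in> I" unfolding I_def by blast
      then have "P k" using k by (simp add: P_def)
      then have "degree g \<le> degree k" by (rule gmin)
      moreover have "r \<noteq> 0" using r by auto
      ultimately show False using k(2) qr(2) by auto
    qed
    then show ?thesis using qr(1) by (intro exI[of _ q]) simp
  qed
  have gf: "degree g \<le> degree f" by (rule gmin[OF Pf])
  have g0: "degree g > 0"
  proof (rule ccontr)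
    assume "\<not> degree g > 0"
    then have "g = 1" using g1 by (metis degree_eq_zeroE gr0I lead_coeff_pCons(2) one_pCons)
    then show False using II[OF gI] uv(3) by simp
  qed
  obtain q r where qr: "f = q * g + r" "r = 0 \<or> degree r < degree g" using monic_division[OF g1] .
  have dgf: "dvdm p g f" using gdiv[OF fI] by (auto simp: dvdm_def)
  have "dvdm p g r" using dgf dvdm_diff[of p g f "q * g"] dvdm_mult[OF dvdm_self] qr(1) by simp
  then have pr: "[:int p:] dvd r" using dvdm_low_degree'[OF p0 g1, of r] qr(2) by auto
  have gn0: "g \<noteq> 0" using g1 by auto
  have q0: "q \<noteq> 0" using qr gf f g0 by auto
  have "degree (q * g) = degree q + degree g" using q0 gn0 by (rule degree_mult_eq)
  then have df: "degree f = degree q + degree g" and lq: "lead_coeff q = 1"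
  proof -
    have *: "degree r < degree (q * g) \<or> r = 0" using qr(2) \<open>degree (q * g) = _\<close> by linarith
    have "degree f = degree (q * g)" using * qr(1) by (auto simp: degree_add_eq_left)
    then show df: "degree f = degree q + degree g" using \<open>degree (q * g) = _\<close> by simp
    have "lead_coeff f = lead_coeff (q * g)" using * qr(1) by (auto simp: lead_coeff_add_le degree_add_eq_left coeff_eq_0)
    then show "lead_coeff q = 1" using f g1 by (simp add: lead_coeff_mult)
  qed
  have "degree g \<noteq> degree f"
  proof
    assume eq: "degree g = degree f"
    then have "degree q = 0" using df by simp
    then have "q = 1" using lq by (metis degree_eq_zeroE lead_coeff_pCons(2) one_pCons)
    then have "[:int p:] dvd f - g" using pr qr(1) by simp
    then have "[:int p:] dvd g - f" by (rule const_cong_sym)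
    moreover have "dvdm p g u" using gdiv[OF uI] by (auto simp: dvdm_def)
    ultimately have "dvdm p f u" by (rule dvdm_cong_left)
    then show False using uv(2) by simp
  qed
  then have "degree g < degree f" "degree q > 0" using gf df by auto
  moreover have "[:int p:] dvd f - g * q" using pr qr(1) by (simp add: mult.commute)
  ultimately show thesis using that[of g q] g1 lq g0 df by simp
qed

lemma reduce_poly_monic: assumes "prime p" "lead_coeff f = 1"
  shows "lead_coeff (reduce_poly p f) = 1" "degree (reduce_poly p f) = degree f"
proof -
  have 1: "coeff (reduce_poly p f) (degree f) = 1" using assms prime_gt_1_nat[OF assms(1)] by simp
  then have "degree f \<le> degree (reduce_poly p f)" by (metis le_degree zero_neq_one)
  then show "degree (reduce_poly p f) = degree f" using degree_reduce_poly_le[of p f] by simp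
  then show "lead_coeff (reduce_poly p f) = 1" using 1 by simp
qed

lemma dvdm_left_reduce_poly [simp]: "dvdm p (reduce_poly p f) g \<longleftrightarrow> dvdm p f g"
  using dvdm_cong_left reduce_poly_cong by blast

lemma primem_reduce_poly [simp]: assumes "prime p" "primem p f" shows "primem p (reduce_poly p f)"
  using assms reduce_poly_monic[OF assms(1)] unfolding primem_def by auto

lemma reduce_poly_reduce_poly [simp]: "reduce_poly p (reduce_poly p f) = reduce_poly p f"
  by (simp add: poly_eq_iff)

lemma const_cong_mult: "[:c:] dvd a - b \<Longrightarrow> [:c:] dvd d - e \<Longrightarrow> [:c:] dvd a * d - b * (e::int poly)"
proof -
  assume "[:c:] dvd a - b" "[:c:] dvd d - e"
  then have "[:c:] dvd d * (a - b) + b * (d - e)" by (intro dvd_add dvd_mult)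
  then show ?thesis by (simp add: algebra_simps)
qed

lemma const_cong_trans: "[:c:] dvd a - b \<Longrightarrow> [:c:] dvd b - e \<Longrightarrow> [:c:] dvd a - (e::int poly)"
  using dvd_add[of "[:c:]" "a - b" "b - e"] by simp

lemma prime_factorization_mod:
  assumes p: "prime p"
  shows "lead_coeff f = 1 \<Longrightarrow> \<exists>fs. (\<forall>g\<in>set fs. primem p g \<and> reduce_poly p g = g) \<and> [:int p:] dvd f - prod_list fs"
proof (induction "degree f" arbitrary: f rule: less_induct)
  case less
  show ?case
  proof (cases "degree f = 0")
    case True
    then have "f = 1" using less.prems by (metis degree_eq_zeroE lead_coeff_pCons(2) one_pCons)
    then show ?thesis by (intro exI[of _ "[]"]) simp
  next
    case False
    show ?thesis
    proof (cases "primem p f")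
      case True
      then show ?thesis using p reduce_poly_cong[of p f] by (intro exI[of _ "[reduce_poly p f]"]) simp
    next
      case np: False
      obtain g h where gh: "lead_coeff g = 1" "lead_coeff h = 1" "0 < degree g" "degree g < degree f"
        "0 < degree h" "degree h < degree f" "[:int p:] dvd f - g * h"
        using nonprime_splits[OF p less.prems _ np] False by blast
      obtain gs where gs: "\<forall>g\<in>set gs. primem p g \<and> reduce_poly p g = g" "[:int p:] dvd g - prod_list gs"
        using less.hyps[of g] gh by blast
      obtain hs where hs: "\<forall>g\<in>set hs. primem p g \<and> reduce_poly p g = g" "[:int p:] dvd h - prod_list hs"
        using less.hyps[of h] gh by blast
      have "[:int p:] dvd f - prod_list (gs @ hs)"
        using const_cong_trans[OF gh(7) const_cong_mult[OF gs(2) hs(2)]] by simp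
      then show ?thesis using gs(1) hs(1) by (intro exI[of _ "gs @ hs"]) auto
    qed
  qed
qed

lemma primem_monic: "primem p f \<Longrightarrow> lead_coeff f = 1" "primem p f \<Longrightarrow> degree f > 0"
  by (auto simp: primem_def)

lemma primem_prodD: "primem p f \<Longrightarrow> dvdm p f (a * b) \<Longrightarrow> dvdm p f a \<or> dvdm p f b"
  by (auto simp: primem_def)

lemma primem_powD: "prime p \<Longrightarrow> primem p f \<Longrightarrow> dvdm p f (a ^ k) \<Longrightarrow> dvdm p f a"
  by (induction k) (use dvdm_1_iff[of p f] primem_monic in \<open>auto dest: primem_prodD\<close>)

lemma dvdm_monic_same_degree:
  assumes p: "prime p" and f: "lead_coeff f = 1" and g: "lead_coeff g = 1" "degree g = degree f" and d: "dvdm p f g"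
  shows "[:int p:] dvd g - f"
proof -
  have "dvdm p f (g - f)" using d by (intro dvdm_diff) auto
  moreover have "int p dvd coeff (g - f) i" if "i \<ge> degree f" for i
  proof (cases "i = degree f")
    case True then show ?thesis using f g by simp
  next
    case False then show ?thesis using that g by (simp add: coeff_eq_0)
  qed
  ultimately show ?thesis using dvdm_low_degree[OF prime_gt_0_nat[OF p] f] by blast
qed

text \<open>If \<open>g = q * f\<close> modulo \<open>p\<close>, then the prime \<open>g\<close> divides \<open>q\<close> or \<open>f\<close>; the first is impossible by degree, and
in the second case the two divide each other.\<close>

lemma dvdm_primes_eq:
  assumes p: "prime p" and f: "primem p f" and g: "primem p g" and d: "dvdm p f g"
  shows "reduce_poly p f = reduce_poly p g"
proof -
  note fm = primem_monic[OF f] and gm = primem_monic[OF g]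
  obtain q r where qr: "g = q * f + r" "r = 0 \<or> degree r < degree f" using monic_division[OF fm(1)] .
  have "dvdm p f r" using d dvdm_diff[of p f g "q * f"] dvdm_mult[OF dvdm_self] qr(1) by simp
  then have pr: "[:int p:] dvd r" using dvdm_low_degree'[OF prime_gt_0_nat[OF p] fm(1), of r] qr(2) by auto
  have "dvdm p g (q * f)" using dvdm_diff[OF dvdm_self dvdm_const[OF pr], of g] qr(1) by simp
  then consider "dvdm p g q" | "dvdm p g f" using primem_prodD[OF g] by blast
  then show ?thesis
  proof cases
    case 1
    have g0: "\<not> [:int p:] dvd g" using gm(1) p by (rule monic_not_cong_0[rotated])
    have q0: "q \<noteq> 0" using g0 pr qr(1) by auto
    have f0: "f \<noteq> 0" using fm by auto
    have "degree g = degree q + degree f"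
      using qr q0 f0 by (auto simp: degree_mult_eq degree_add_eq_left)
    then have "[:int p:] dvd q" using dvdm_low_degree'[OF prime_gt_0_nat[OF p] gm(1) 1] fm by simp
    then have "[:int p:] dvd g" using pr qr(1) by simp
    then show ?thesis using g0 by simp
  next
    case 2
    have deg: "degree b \<ge> degree a" if "primem p a" "primem p b" "dvdm p a b" for a b
    proof (rule ccontr)
      assume "\<not> degree b \<ge> degree a"
      then have "[:int p:] dvd b" using dvdm_low_degree'[OF prime_gt_0_nat[OF p] primem_monic(1)[OF that(1)] that(3)] by simp
      then show False using monic_not_cong_0[OF p primem_monic(1)[OF that(2)]] by simp
    qed
    have "degree f = degree g" using deg[OF f g d] deg[OF g f 2] by simp
    then have "[:int p:] dvd g - f" using dvdm_monic_same_degree[OF p fm(1) gm(1) _ d] by simp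
    then show ?thesis using const_cong_sym by (auto simp: reduce_poly_eq_iff)
  qed
qed

lemma prod_distinct_primes_dvdm:
  assumes p: "prime p" and fin: "finite S" and S: "\<And>f. f \<in> S \<Longrightarrow> primem p f \<and> reduce_poly p f = f"
    and d: "\<And>f. f \<in> S \<Longrightarrow> dvdm p f Z"
  shows "dvdm p (\<Prod>S) Z"
  using fin S d
proof (induction S arbitrary: Z rule: finite_induct)
  case empty then show ?case unfolding dvdm_def by (intro exI[of _ Z]) simp
next
  case (insert f S)
  then have "dvdm p f Z" by blast
  then obtain q where q: "[:int p:] dvd Z - q * f" unfolding dvdm_def by blast
  have "dvdm p g q" if g: "g \<in> S" for g
  proof -
    have "dvdm p g Z" using insert.prems g by blast
    then have "dvdm p g (Z - (Z - q * f))" using dvdm_const[OF q] by (rule dvdm_diff)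
    then have "dvdm p g (q * f)" by simp
    moreover have "\<not> dvdm p g f"
      using dvdm_primes_eq[OF p, of g f] insert.prems(1)[of f] insert.prems(1)[of g] g insert.hyps(2) by auto
    ultimately show ?thesis using insert.prems(1)[of g] g primem_prodD by blast
  qed
  then have "dvdm p (\<Prod>S) q" using insert by blast
  then obtain r where r: "[:int p:] dvd q - r * \<Prod>S" unfolding dvdm_def by blast
  have "[:int p:] dvd (Z - q * f) + (q - r * \<Prod>S) * f" using q r by (intro dvd_add dvd_mult2)
  then have "[:int p:] dvd Z - r * (f * \<Prod>S)" by (simp add: algebra_simps)
  then show ?case using insert.hyps unfolding dvdm_def by auto
qed

lemma prod_monic:
  assumes "finite A" "\<And>i. i \<in> A \<Longrightarrow> lead_coeff (h i :: int poly) = 1"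
  shows "lead_coeff (\<Prod>i\<in>A. h i) = 1 \<and> degree (\<Prod>i\<in>A. h i) = (\<Sum>i\<in>A. degree (h i))"
  using assms
proof (induction A rule: finite_induct)
  case (insert a A)
  then have S: "lead_coeff (prod h A) = 1" "degree (prod h A) = (\<Sum>i\<in>A. degree (h i))" and f: "lead_coeff (h a) = 1" by auto
  have n0: "h a \<noteq> 0" "prod h A \<noteq> 0" using f S(1) by (metis coeff_0 zero_neq_one)+
  have "lead_coeff (h a * prod h A) = 1" using S(1) f by (simp only: lead_coeff_mult)
  moreover have "degree (h a * prod h A) = degree (h a) + degree (prod h A)" using n0 by (rule degree_mult_eq)
  moreover have "prod h (insert a A) = h a * prod h A" using insert.hyps by simp
  ultimately show ?case using insert.hyps S(2) by simp
qed auto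

lemma sum_degree_primes_le:
  assumes p: "prime p" and fin: "finite S" and S: "\<And>f. f \<in> S \<Longrightarrow> primem p f \<and> reduce_poly p f = f"
    and d: "\<And>f. f \<in> S \<Longrightarrow> dvdm p f Z" and Z: "lead_coeff Z = 1"
  shows "(\<Sum>f\<in>S. degree f) \<le> degree Z"
proof (rule ccontr)
  assume lt: "\<not> ?thesis"
  have *: "lead_coeff (\<Prod>S) = 1 \<and> degree (\<Prod>S) = (\<Sum>f\<in>S. degree f)"
    using prod_monic[of S "\<lambda>f. f"] fin S primem_monic by auto
  have "dvdm p (\<Prod>S) Z" using S d by (intro prod_distinct_primes_dvdm[OF p fin]) auto
  then have "[:int p:] dvd Z"
    using dvdm_low_degree'[OF prime_gt_0_nat[OF p] conjunct1[OF *]] conjunct2[OF *] lt by (simp only: not_le)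
  then show False using monic_not_cong_0[OF p Z] by simp
qed


definition Zx :: "int poly ring" where
  "Zx = \<lparr>carrier = UNIV, mult = (*), one = 1, zero = 0, add = (+)\<rparr>"

lemma Zx_simps [simp]: "carrier Zx = UNIV" "mult Zx = (*)" "one Zx = 1" "zero Zx = 0" "add Zx = (+)"
  by (simp_all add: Zx_def)

lemma cring_Zx: "cring Zx"
proof (rule cringI)
  show "abelian_group Zx"
  proof (rule abelian_groupI)
    fix x show "\<exists>y\<in>carrier Zx. y \<oplus>\<^bsub>Zx\<^esub> x = \<zero>\<^bsub>Zx\<^esub>" by (intro bexI[of _ "- x"]) auto
  qed auto
  show "Group.comm_monoid Zx" by (rule comm_monoidI) auto
qed (auto simp: algebra_simps)

definition ideal_pf :: "nat \<Rightarrow> int poly \<Rightarrow> int poly set" where "ideal_pf p f = {g. dvdm p f g}"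

lemma Zx_a_inv: "a_inv Zx x = - x"
  by (rule abelian_group.minus_equality[OF ring.is_abelian_group[OF cring.axioms(1)[OF cring_Zx]]]) auto

lemma ideal_ideal_pf: "ideal (ideal_pf p f) Zx"
proof (rule idealI)
  show "ring Zx" using cring_Zx by (rule cring.axioms)
  show "subgroup (ideal_pf p f) (add_monoid Zx)"
  proof (rule subgroup.intro)
    show "inv\<^bsub>add_monoid Zx\<^esub> x \<in> ideal_pf p f" if "x \<in> ideal_pf p f" for x
      unfolding a_inv_def[symmetric] Zx_a_inv using that by (simp add: ideal_pf_def)
  qed (auto simp: ideal_pf_def intro: dvdm_add)
qed (auto simp: ideal_pf_def dvdm_mult dvdm_mult2)

lemma primeideal_ideal_pf: assumes "prime p" "primem p f" shows "primeideal (ideal_pf p f) Zx"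
proof (rule primeidealI[OF ideal_ideal_pf cring_Zx])
  show "carrier Zx \<noteq> ideal_pf p f" using dvdm_1_iff[of p f] assms primem_monic[OF assms(2)] by (auto simp: ideal_pf_def)
  show "a \<otimes>\<^bsub>Zx\<^esub> b \<in> ideal_pf p f \<Longrightarrow> a \<in> ideal_pf p f \<or> b \<in> ideal_pf p f" for a b
    using primem_prodD[OF assms(2)] by (auto simp: ideal_pf_def)
qed

text \<open>The ring \<open>\<int>[x]/(p, f)\<close>, which is a field with \<open>p\<close> to the power \<open>degree f\<close> elements when \<open>f\<close> is prime
modulo \<open>p\<close>.\<close>

definition residue_ring_pf :: "nat \<Rightarrow> int poly \<Rightarrow> int poly set ring" where "residue_ring_pf p f = Zx Quot (ideal_pf p f)"

definition residue :: "nat \<Rightarrow> int poly \<Rightarrow> int poly \<Rightarrow> int poly set" where "residue p f u = ideal_pf p f +>\<^bsub>Zx\<^esub> u"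

lemma residue_eq_iff: "residue p f u = residue p f v \<longleftrightarrow> congm p f u v"
proof -
  have *: "residue p f u = {w. congm p f w u}" for u

  proof (intro Set.set_eqI iffI)
    fix w assume "w \<in> residue p f u"
    then show "w \<in> {w. congm p f w u}" by (auto simp: residue_def a_r_coset_def r_coset_def ideal_pf_def congm_def)
  next
    fix w assume "w \<in> {w. congm p f w u}"
    then have "w - u \<in> ideal_pf p f" "w = (w - u) + u" by (auto simp: ideal_pf_def congm_def)
    then show "w \<in> residue p f u" unfolding residue_def a_r_coset_def r_coset_def by (auto intro!: bexI[of _ "w - u"])
  qed
  show ?thesis
  proof
    assume "residue p f u = residue p f v"
    then have "u \<in> {w. congm p f w v}" using *[of u] *[of v] congm_refl by auto
    then show "congm p f u v" by simp
  next
    assume "congm p f u v"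
    then show "residue p f u = residue p f v" unfolding * by (blast intro: congm_trans congm_sym)
  qed
qed

lemma residue_carrier [simp]: "residue p f u \<in> carrier (residue_ring_pf p f)"
  by (auto simp: residue_def residue_ring_pf_def FactRing_def A_RCOSETS_def')

lemma carrier_residue_ring_pf: "carrier (residue_ring_pf p f) = range (residue p f)"
  by (auto simp: residue_def residue_ring_pf_def FactRing_def A_RCOSETS_def')

lemma residue_hom: "residue p f (u * v) = residue p f u \<otimes>\<^bsub>residue_ring_pf p f\<^esub> residue p f v" "residue p f 1 = \<one>\<^bsub>residue_ring_pf p f\<^esub>"
   "residue p f 0 = \<zero>\<^bsub>residue_ring_pf p f\<^esub>"
proof -
  have h: "ring_hom_ring Zx (Zx Quot (ideal_pf p f)) ((+>\<^bsub>Zx\<^esub>) (ideal_pf p f))"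
    using ideal.rcos_ring_hom_ring[OF ideal_ideal_pf] .
  interpret h: ring_hom_ring Zx "Zx Quot (ideal_pf p f)" "(+>\<^bsub>Zx\<^esub>) (ideal_pf p f)" by (rule h)
  show "residue p f (u * v) = residue p f u \<otimes>\<^bsub>residue_ring_pf p f\<^esub> residue p f v" using h.hom_mult[of u v] by (simp add: residue_def residue_ring_pf_def)
  show "residue p f 1 = \<one>\<^bsub>residue_ring_pf p f\<^esub>" using h.hom_one by (simp add: residue_def residue_ring_pf_def)
  show "residue p f 0 = \<zero>\<^bsub>residue_ring_pf p f\<^esub>" using h.hom_zero by (simp add: residue_def residue_ring_pf_def)
qed

lemma residue_pow: "residue p f (u ^ k) = residue p f u [^]\<^bsub>residue_ring_pf p f\<^esub> (k::nat)"
  by (induction k) (simp_all add: residue_hom power_Suc2 nat_pow_def del: power_Suc)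

lemma domain_residue_ring_pf: "prime p \<Longrightarrow> primem p f \<Longrightarrow> domain (residue_ring_pf p f)"
  unfolding residue_ring_pf_def by (rule primeideal.quotient_is_domain[OF primeideal_ideal_pf])

lemma reduced_polys_congm_eq:
  assumes "prime p" "lead_coeff f = 1" "u \<in> reduced_polys p (degree f)" "v \<in> reduced_polys p (degree f)" "congm p f u v"
  shows "u = v"
proof -
  have "[:int p:] dvd u - v"
    using assms prime_gt_0_nat[OF assms(1)] unfolding congm_def
    by (intro dvdm_low_degree[of p f]) (auto simp: reduced_polys_def)
  then have "reduce_poly p u = reduce_poly p v" by (simp add: reduce_poly_eq_iff)
  then show ?thesis using assms(3,4) by (auto simp: poly_eq_iff reduced_polys_def)
qed

lemma reduced_polys_congm_ex:
  assumes "prime p" "lead_coeff f = 1" shows "\<exists>v\<in>reduced_polys p (degree f). congm p f u v"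
proof -
  obtain q r where qr: "u = q * f + r" "r = 0 \<or> degree r < degree f" using monic_division[OF assms(2)] .
  have "congm p f u r" using qr(1) by (simp add: congm_def dvdm_mult)
  also have "congm p f r (reduce_poly p r)" by (rule congm_const) (rule reduce_poly_cong)
  finally have "congm p f u (reduce_poly p r)" .
  moreover have "reduce_poly p r \<in> reduced_polys p (degree f)"
    using qr(2) prime_gt_0_nat[OF assms(1)] by (auto simp: reduced_polys_def coeff_eq_0)
  ultimately show ?thesis by blast
qed

lemma card_residue_ring_pf: assumes "prime p" "primem p f"
  shows "finite (carrier (residue_ring_pf p f))" "card (carrier (residue_ring_pf p f)) = p ^ degree f"
proof -
  note fm = primem_monic[OF assms(2)]
  have "bij_betw (residue p f) (reduced_polys p (degree f)) (carrier (residue_ring_pf p f))"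
    unfolding bij_betw_def carrier_residue_ring_pf
  proof
    show "inj_on (residue p f) (reduced_polys p (degree f))"
      using reduced_polys_congm_eq[OF assms(1) fm(1)] by (auto simp: inj_on_def residue_eq_iff)
    show "residue p f ` reduced_polys p (degree f) = range (residue p f)"
    proof
      show "range (residue p f) \<subseteq> residue p f ` reduced_polys p (degree f)"
      proof (rule image_subsetI)
        fix u
        obtain v where "v \<in> reduced_polys p (degree f)" "congm p f u v" using reduced_polys_congm_ex[OF assms(1) fm(1)] by blast
        then show "residue p f u \<in> residue p f ` reduced_polys p (degree f)" using residue_eq_iff by (intro image_eqI[of _ _ v]) auto
      qed
    qed auto
  qed
  note b = this and c = card_reduced_polys[OF prime_gt_0_nat[OF assms(1)], of "degree f"]
  show "finite (carrier (residue_ring_pf p f))" using bij_betw_finite[OF b] c by simp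
  show "card (carrier (residue_ring_pf p f)) = p ^ degree f" using bij_betw_same_card[OF b] c by simp
qed

text \<open>The residue ring is a finite field, and the order of its unit group is \<open>p\<close> to the power \<open>degree f\<close>,
minus one.\<close>

lemma congm_fermat: assumes "prime p" "primem p f" shows "congm p f (u ^ (p ^ degree f)) u"
proof -
  interpret K: domain "residue_ring_pf p f" using domain_residue_ring_pf[OF assms] .
  note cK = card_residue_ring_pf[OF assms]
  have "\<exists>y\<in>carrier (residue_ring_pf p f). x \<otimes>\<^bsub>residue_ring_pf p f\<^esub> y = \<one>\<^bsub>residue_ring_pf p f\<^esub>"
    if x: "x \<in> carrier (residue_ring_pf p f)" "x \<noteq> \<zero>\<^bsub>residue_ring_pf p f\<^esub>" for x
  proof -
    have "inj_on (\<lambda>y. x \<otimes>\<^bsub>residue_ring_pf p f\<^esub> y) (carrier (residue_ring_pf p f))"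
      using x K.m_lcancel by (auto simp: inj_on_def)
    then have "(\<lambda>y. x \<otimes>\<^bsub>residue_ring_pf p f\<^esub> y) ` carrier (residue_ring_pf p f) = carrier (residue_ring_pf p f)"
      using endo_inj_surj[OF cK(1)] x by blast
    then show ?thesis using K.one_closed by (metis imageE)
  qed
  then interpret F: field "residue_ring_pf p f" by (intro K.cring_fieldI2) (use K.zero_not_one in auto)
  let ?q = "p ^ degree f"
  have q: "?q > 0" using prime_gt_0_nat[OF assms(1)] by simp
  show ?thesis
  proof (cases "residue p f u = \<zero>\<^bsub>residue_ring_pf p f\<^esub>")
    case True
    then have "congm p f u 0" by (simp add: residue_hom(3)[symmetric] residue_eq_iff)
    then have "congm p f (u ^ ?q) (0 ^ ?q)" by (rule congm_pow)
    then show ?thesis using \<open>congm p f u 0\<close> q 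
      by (metis congm_sym congm_trans power_0_left less_numeral_extra(3))
  next
    case False
    have "residue p f u \<in> carrier (mult_of (residue_ring_pf p f))" using False by simp
    moreover have "Coset.order (mult_of (residue_ring_pf p f)) = ?q - 1"
      using F.order_mult_of[OF cK(1)] cK(2) by (simp add: Coset.order_def)
    ultimately have "residue p f u [^]\<^bsub>mult_of (residue_ring_pf p f)\<^esub> (?q - 1) = \<one>\<^bsub>mult_of (residue_ring_pf p f)\<^esub>"
      using group.pow_order_eq_1[OF F.field_mult_group, of "residue p f u"] by simp
    then have "residue p f u [^]\<^bsub>residue_ring_pf p f\<^esub> (?q - 1) = \<one>\<^bsub>residue_ring_pf p f\<^esub>"
      by (simp add: nat_pow_mult_of)
    then have "congm p f (u ^ (?q - 1)) 1" by (simp add: residue_pow[symmetric] residue_hom(2)[symmetric] residue_eq_iff)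
    then have "congm p f (u ^ (?q - 1) * u) (1 * u)" by (intro congm_mult congm_refl)
    moreover have "u ^ (?q - 1) * u = u ^ ?q" using q by (rule power_minus_mult)
    ultimately show ?thesis by (simp only: mult_1)
  qed
qed

text \<open>In the integral domain \<open>\<int>[x]/(p, f)\<close> the equation \<open>u\<^sup>m = 1\<close> has at most \<open>m\<close> solutions. The map \<open>U\<close> sends an
arbitrary index set to solutions with pairwise distinct residues.\<close>

lemma card_roots_of_unity:
  assumes "prime p" "primem p f" "m > 0"
    and U: "\<And>x. x \<in> S \<Longrightarrow> congm p f (U x ^ m) 1"
    and inj: "\<And>x y. x \<in> S \<Longrightarrow> y \<in> S \<Longrightarrow> congm p f (U x) (U y) \<Longrightarrow> x = y"
  shows "finite S" "card S \<le> m"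
proof -
  interpret K: domain "residue_ring_pf p f" using domain_residue_ring_pf[OF assms(1,2)] .
  note cK = card_residue_ring_pf[OF assms(1,2)]
  let ?c = "\<lambda>x. residue p f (U x)"
  let ?R = "{x \<in> carrier (residue_ring_pf p f). x [^]\<^bsub>residue_ring_pf p f\<^esub> m = \<one>\<^bsub>residue_ring_pf p f\<^esub>}"
  have sub: "?c ` S \<subseteq> ?R"
  proof (rule image_subsetI)
    fix x assume "x \<in> S"
    then have "residue p f (U x ^ m) = residue p f 1" using U by (simp only: residue_eq_iff)
    then show "?c x \<in> ?R" by (simp add: residue_pow[symmetric] residue_hom(2)[symmetric])
  qed
  have i: "inj_on ?c S"
  proof (rule inj_onI)
    fix x y assume "x \<in> S" "y \<in> S" "?c x = ?c y"
    then show "x = y" by (intro inj) (simp_all only: residue_eq_iff)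
  qed
  have fR: "finite ?R" using cK(1) by simp
  show "finite S" using finite_imageD[OF finite_subset[OF sub fR] i] .
  have "card ?R \<le> m" using K.num_roots_le_deg[OF cK(1), of m] assms(3) by simp
  then show "card S \<le> m" using card_image[OF i] card_mono[OF fR sub] by linarith
qed

section \<open>Frobenius and the degrees of prime factors\<close>

lemma dvdm_zero_iff [simp]: "dvdm p 0 g \<longleftrightarrow> [:int p:] dvd g"
  by (auto simp: dvdm_def)

lemma congm_zero_imp: "congm p 0 a b \<Longrightarrow> congm p f a b"
  by (auto simp: congm_def intro: dvdm_const)

lemma congm_sum: "(\<And>i. i \<in> A \<Longrightarrow> congm p f (g i) (h i)) \<Longrightarrow> congm p f (sum g A) (sum h A)"
  by (induction A rule: infinite_finite_induct) (auto intro: congm_add)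

lemma congm_pcompose: "congm p f a b \<Longrightarrow> congm p f (pcompose u a) (pcompose u b)"
proof (induction u)
  case (pCons c u)
  then show ?case by (auto simp: pcompose_pCons intro!: congm_add congm_mult)
qed simp

lemma frobenius_add: assumes "prime p" shows "congm p 0 ((a + b) ^ p) (a ^ p + b ^ p)"
proof -
  have p: "p > 0" using assms by (rule prime_gt_0_nat)
  let ?t = "\<lambda>k. of_nat (p choose k) * a ^ k * b ^ (p - k)"
  have "(a + b) ^ p = (\<Sum>k\<le>p. ?t k)" by (rule binomial_ring)
  also have "{..p} = insert 0 (insert p {0<..<p})" using p by auto
  also have "(\<Sum>k\<in>insert 0 (insert p {0<..<p}). ?t k) = b ^ p + (a ^ p + (\<Sum>k\<in>{0<..<p}. ?t k))"
    using p by simp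
  also have "\<dots> = (a ^ p + b ^ p) + (\<Sum>k\<in>{0<..<p}. ?t k)" by simp
  also have "congm p 0 \<dots> ((a ^ p + b ^ p) + (\<Sum>k\<in>{0<..<p}. 0))"
  proof (intro congm_add congm_refl congm_sum)
    fix k assume "k \<in> {0<..<p}"
    then have "p dvd (p choose k)" using assms by (intro dvd_choose_prime) auto
    then obtain c where c: "p choose k = p * c" by (auto elim: dvdE)
    have "?t k = [:int p:] * (of_nat c * a ^ k * b ^ (p - k))"
      by (simp add: c of_nat_poly mult.assoc mult.commute)
    then show "congm p 0 (?t k) 0" unfolding congm_def dvdm_zero_iff diff_0_right by (metis dvd_triv_left)
  qed
  finally show ?thesis by simp
qed

lemma power_power_Suc: "(x::'a::monoid_mult) ^ (p ^ Suc j) = (x ^ (p ^ j)) ^ p"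
  by (simp only: power_Suc2 power_mult)

lemma frobenius_add_pow: assumes "prime p" shows "congm p 0 ((a + b) ^ (p ^ j)) (a ^ (p ^ j) + b ^ (p ^ j))"
proof (induction j)
  case (Suc j)
  have "(a + b) ^ (p ^ Suc j) = ((a + b) ^ (p ^ j)) ^ p" by (simp only: power_power_Suc)
  also have "congm p 0 \<dots> ((a ^ (p ^ j) + b ^ (p ^ j)) ^ p)" using Suc by (rule congm_pow)
  also have "congm p 0 \<dots> ((a ^ (p ^ j)) ^ p + (b ^ (p ^ j)) ^ p)" by (rule frobenius_add[OF assms])
  also have "\<dots> = a ^ (p ^ Suc j) + b ^ (p ^ Suc j)" by (simp only: power_power_Suc)
  finally show ?case .
qed simp

lemma fermat_int: assumes "prime p" shows "[(a::int) ^ (p ^ j) = a] (mod (int p))"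
proof (induction j)
  case (Suc j)
  have 1: "[a ^ p = a] (mod (int p))"
  proof (cases "int p dvd a")
    case True
    then have "int p dvd a ^ p" using prime_gt_0_nat[OF assms] by (metis dvd_power dvd_trans)
    then show ?thesis using True by (metis cong_0_iff cong_sym cong_trans)
  next
    case False
    obtain a' :: nat where a': "[a = int a'] (mod (int p))"
      by (metis cong_mod_right cong_refl Euclidean_Rings.pos_mod_sign assms nat_0_le of_nat_0_less_iff prime_gt_0_nat)
    then have "\<not> p dvd a'" using False by (metis cong_dvd_iff int_dvd_int_iff)
    then have "[a' ^ (p - 1) = 1] (mod p)" using assms by (rule fermat_theorem[rotated])
    then have "[a' ^ (p - 1) * a' = 1 * a'] (mod p)" by (intro cong_mult cong_refl)
    then have "[a' ^ p = a'] (mod p)" 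
      by (simp only: power_minus_mult[OF prime_gt_0_nat[OF assms]] mult_1)
    then have "[int a' ^ p = int a'] (mod (int p))" by (metis cong_int_iff of_nat_power)
    then show ?thesis using a' by (metis cong_pow cong_sym cong_trans)
  qed
  have "a ^ (p ^ Suc j) = (a ^ (p ^ j)) ^ p" by (simp only: power_power_Suc)
  then show ?case using Suc 1 by (metis cong_pow cong_trans)
qed simp

text \<open>Taking \<open>p\<close>-th powers is additive modulo \<open>p\<close> and fixes the coefficients by Fermat's little theorem.\<close>

lemma frobenius_pcompose: assumes "prime p"
  shows "congm p 0 (u ^ (p ^ j)) (pcompose u ([:0, 1:] ^ (p ^ j)))"
proof (induction u)
  case 0 then show ?case using prime_gt_0_nat[OF assms] by (simp add: zero_power)
next
  case (pCons a u)
  let ?X = "[:0, 1:] :: int poly"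
  have e: "pCons a u = [:a:] + ?X * u" by simp
  have "congm p 0 ([:a:] ^ (p ^ j)) [:a:]"
  proof -
    have "int p dvd a ^ (p ^ j) - a" using fermat_int[OF assms] by (simp add: cong_iff_dvd_diff)
    then show ?thesis by (simp add: congm_def poly_const_pow)
  qed
  moreover have "congm p 0 ((?X * u) ^ (p ^ j)) (?X ^ (p ^ j) * pcompose u (?X ^ (p ^ j)))"
    unfolding power_mult_distrib by (intro congm_mult congm_refl pCons.IH)
  ultimately have "congm p 0 ([:a:] ^ (p ^ j) + (?X * u) ^ (p ^ j)) ([:a:] + ?X ^ (p ^ j) * pcompose u (?X ^ (p ^ j)))"
    by (rule congm_add)
  with frobenius_add_pow[OF assms, of "[:a:]" "?X * u" j]
  show ?case unfolding e[symmetric] pcompose_pCons using congm_trans by blast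
qed

abbreviation XX :: "int poly" where "XX \<equiv> [:0, 1:]"

lemma XX_pow: "XX ^ k = monom 1 k"
  by (simp add: monom_altdef)

lemma congm_fermat_iter: assumes "prime p" "primem p f" shows "congm p f (u ^ (p ^ (degree f * k))) u"
proof (induction k)
  case (Suc k)
  have "u ^ (p ^ (degree f * Suc k)) = (u ^ (p ^ degree f)) ^ (p ^ (degree f * k))"
    by (simp add: power_mult[symmetric] power_add)
  also have "congm p f \<dots> (u ^ (p ^ (degree f * k)))" by (rule congm_pow[OF congm_fermat[OF assms]])
  also have "congm p f \<dots> u" by (rule Suc)
  finally show ?case .
qed simp

text \<open>If the \<open>m\<close>-th iterate of Frobenius fixes \<open>x\<close>, then it fixes the whole residue field, and so does the
iterate number \<open>m mod degree f\<close>, because the iterate number \<open>degree f\<close> is the identity. But an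
equation \<open>u\<^bsup>p^e\<^esup> = u\<close> with \<open>0 < e < degree f\<close> has too few solutions.\<close>

lemma degree_dvd_of_frobenius:
  assumes p: "prime p" and f: "primem p f" and X: "congm p f (XX ^ (p ^ m)) XX"
  shows "degree f dvd m"
proof -
  note fm = primem_monic[OF f]
  have all: "congm p f (u ^ (p ^ m)) u" for u
  proof -
    have "congm p f (u ^ (p ^ m)) (pcompose u (XX ^ (p ^ m)))"
      using frobenius_pcompose[OF p] by (rule congm_zero_imp)
    also have "congm p f (pcompose u (XX ^ (p ^ m))) (pcompose u XX)" using X by (rule congm_pcompose)
    finally show ?thesis by simp
  qed
  let ?d = "degree f" and ?e = "m mod degree f"
  have e: "congm p f (u ^ (p ^ ?e)) u" for u
  proof -
    have "m = ?d * (m div ?d) + ?e" by simp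
    then have "u ^ (p ^ m) = (u ^ (p ^ (?d * (m div ?d)))) ^ (p ^ ?e)"
      by (metis power_add power_mult)
    also have "congm p f \<dots> (u ^ (p ^ ?e))" by (rule congm_pow[OF congm_fermat_iter[OF p f]])
    finally have "congm p f (u ^ (p ^ m)) (u ^ (p ^ ?e))" .
    then show ?thesis using all[of u] congm_sym congm_trans by blast
  qed
  have "?e = 0"
  proof (rule ccontr)
    assume e0: "?e \<noteq> 0"
    let ?m = "p ^ ?e - 1" and ?U = "reduced_polys p ?d - {0}"
    note p0 = prime_gt_0_nat[OF p] and p1 = prime_gt_1_nat[OF p]
    have z: "0 \<in> reduced_polys p ?d" using p0 by (simp add: reduced_polys_def)
    have pe: "p ^ ?e > 1" using p1 e0 by (intro one_less_power) auto
    have "card ?U \<le> ?m"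
    proof (rule card_roots_of_unity(2)[OF p f, where U = "\<lambda>u. u"])
      show "?m > 0" using pe by simp
      fix u assume u: "u \<in> ?U"
      have "\<not> dvdm p f u"
        using reduced_polys_congm_eq[OF p fm(1), of u 0] u z by (auto simp: congm_def)
      moreover have "dvdm p f (u * (u ^ ?m - 1))"
      proof -
        have "u ^ ?m * u = u ^ (p ^ ?e)" using pe by (intro power_minus_mult) linarith
        then have "u * (u ^ ?m - 1) = u ^ (p ^ ?e) - u" by (simp only: right_diff_distrib mult.commute mult_1)
        then show ?thesis using e[of u] by (simp only: congm_def)
      qed
      ultimately show "congm p f (u ^ ?m) 1" using primem_prodD[OF f] by (auto simp: congm_def)
    next
      fix u v assume "u \<in> ?U" "v \<in> ?U" "congm p f u v"
      then show "u = v" using reduced_polys_congm_eq[OF p fm(1)] by blast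
    qed
    moreover have "card ?U = p ^ ?d - 1" using card_reduced_polys[OF p0, of ?d] z by simp
    moreover have "p ^ ?e < p ^ ?d" using p1 fm(2) by (intro power_strict_increasing) auto
    ultimately show False using pe by linarith
  qed
  then show ?thesis by (simp add: dvd_eq_mod_eq_0)
qed

text \<open>From \<open>x\<^bsup>p^n + 1\<^esup> = 1\<close> it follows that \<open>x\<close> is fixed by the iterate number \<open>2 n\<close> of Frobenius, so the
degree divides \<open>2 n\<close>. If it is \<open>n\<close>, then \<open>x\<^bsup>p^n\<^esup>\<close> equals both \<open>x\<close> and the inverse of \<open>x\<close>.\<close>

lemma degree_cases:
  assumes p: "prime p" and f: "primem p f" and n: "n \<ge> 1" and P: "dvdm p f (XX ^ (p ^ n + 1) - 1)"
  shows "degree f = 2 * n \<or> dvdm p f (XX ^ 2 - 1) \<or> (\<exists>d\<in>{1..<n}. dvdm p f (XX ^ (p ^ d) - XX))"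
proof -
  let ?q = "p ^ n" and ?d = "degree f"
  have q0: "?q > 0" using prime_gt_0_nat[OF p] by simp
  have 1: "congm p f (XX ^ (?q + 1)) 1" using P by (simp only: congm_def)
  have "?q * ?q = (?q + 1) * (?q - 1) + 1" using q0 by (simp add: algebra_simps)
  moreover have "p ^ (2 * n) = ?q * ?q" by (simp add: mult_2 power_add)
  ultimately have "XX ^ (p ^ (2 * n)) = (XX ^ (?q + 1)) ^ (?q - 1) * XX"
    by (simp only: power_add power_mult power_one_right)
  also have "congm p f \<dots> (1 ^ (?q - 1) * XX)" by (intro congm_mult congm_pow 1 congm_refl)
  finally have "congm p f (XX ^ (p ^ (2 * n))) XX" by (simp only: power_one mult_1)
  then have dv: "?d dvd 2 * n" by (rule degree_dvd_of_frobenius[OF p f])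
  then obtain c where c: "2 * n = ?d * c" by (elim dvdE)
  have c0: "c \<noteq> 0" using c n by (metis mult_0_right mult_eq_0_iff not_one_le_zero zero_neq_numeral)
  have F: "dvdm p f (XX ^ (p ^ ?d) - XX)" using congm_fermat[OF p f] by (simp add: congm_def)
  \<comment> \<open>The degree is \<open>2 n\<close>, or \<open>n\<close>, or less than \<open>n\<close>.\<close>
  consider "c = 1" | "c = 2" | "c \<ge> 3" using c0 by linarith
  then show ?thesis
  proof cases
    case 1 then show ?thesis using c by simp
  next
    case 2
    then have "?d = n" using c by simp
    then have "congm p f (XX ^ ?q) XX" using F by (simp add: congm_def)
    then have "congm p f (XX ^ ?q * XX) (XX * XX)" by (intro congm_mult congm_refl)
    moreover have "XX ^ ?q * XX = XX ^ (?q + 1)" by (simp only: power_add power_one_right)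
    ultimately have "congm p f (XX ^ 2) 1" using 1 congm_sym congm_trans unfolding power2_eq_square by metis
    then show ?thesis unfolding congm_def by blast
  next
    case 3
    have "?d * 3 \<le> 2 * n" unfolding c using 3 by (rule mult_le_mono2)
    then have "?d < n" using n by linarith
    then show ?thesis using F primem_monic(2)[OF f] by (intro disjI2 bexI[of _ ?d]) auto
  qed
qed

section \<open>Counting the irreducible reciprocal polynomials\<close>

lemma XXpow_minus_monic:
  assumes "degree (b :: int poly) < k"
  shows "lead_coeff (XX ^ k - b) = 1" "degree (XX ^ k - b) = k"
proof -
  have c: "coeff (XX ^ k - b) k = 1" using assms by (simp add: XX_pow coeff_eq_0)
  have "coeff (XX ^ k - b) i = 0" if "i > k" for i using that assms by (simp add: XX_pow coeff_eq_0)
  then have "degree (XX ^ k - b) \<le> k" by (intro degree_le) auto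
  moreover have "k \<le> degree (XX ^ k - b)" using c by (intro le_degree) auto
  ultimately show "degree (XX ^ k - b) = k" by simp
  then show "lead_coeff (XX ^ k - b) = 1" using c by simp
qed

lemma dvdm_prod: "finite A \<Longrightarrow> i \<in> A \<Longrightarrow> dvdm p f (h i) \<Longrightarrow> dvdm p f (prod h A)"
  by (metis dvd_imp_dvdm dvd_prodI dvdm_trans)

lemma not_both_X_and_cyclic:
  assumes p: "prime p" and f: "primem p f" and P: "dvdm p f (XX ^ Suc m - 1)"
  shows "\<not> dvdm p f (XX ^ k)"
proof
  assume "dvdm p f (XX ^ k)"
  then have "dvdm p f XX" by (rule primem_powD[OF p f])
  then have "dvdm p f (XX ^ m * XX)" by (rule dvdm_mult)
  then have "dvdm p f (XX ^ m * XX - (XX ^ Suc m - 1))" using P by (rule dvdm_diff)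
  moreover have "XX ^ m * XX - (XX ^ Suc m - 1) = 1" by (simp only: power_Suc2 diff_diff_eq2)
  ultimately have "dvdm p f 1" by (simp only:)
  then show False using dvdm_1_iff[OF p] primem_monic[OF f] by blast
qed

text \<open>A square factor \<open>f\<close> would also divide the derivative, which is \<open>x\<^bsup>p^n\<^esup>\<close> modulo \<open>p\<close>; but \<open>x\<close> is invertible
modulo \<open>x\<^bsup>p^n + 1\<^esup> - 1\<close>.\<close>

lemma cyclic_squarefree:
  assumes p: "prime p" and f: "primem p f" and n: "n \<ge> 1"
    and w: "[:int p:] dvd (XX ^ (p ^ n + 1) - 1) - f * (f * w)"
  shows False
proof -
  let ?P = "XX ^ (p ^ n + 1) - 1"
  obtain k where k: "?P - f * (f * w) = [:int p:] * k" using w by (elim dvdE)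
  have "pderiv ?P = pderiv (f * (f * w) + [:int p:] * k)" using k by (simp add: algebra_simps)
  also have "\<dots> = f * (w * pderiv f + pderiv (f * w)) + [:int p:] * pderiv k"
    by (simp add: pderiv_add pderiv_mult pderiv_smult algebra_simps)
  finally have "dvdm p f (pderiv ?P)"
    by (metis dvdm_add dvdm_const dvdm_mult2 dvdm_self dvd_triv_left)
  moreover have "pderiv ?P = of_nat (p ^ n + 1) * XX ^ (p ^ n)"
    unfolding XX_pow pderiv_diff pderiv_monom by (simp add: of_nat_poly smult_monom)
  moreover have "congm p f (of_nat (p ^ n + 1) * XX ^ (p ^ n)) (1 * XX ^ (p ^ n))"
  proof (intro congm_mult congm_refl congm_const)
    have "p dvd p ^ n" using n by (simp add: dvd_power)
    then have "int p dvd int (p ^ n)" using int_dvd_int_iff by blast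
    moreover have "of_nat (p ^ n + 1) - 1 = [:int (p ^ n):]"
    proof -
      have "of_nat (p ^ n + 1) - 1 = (of_nat (p ^ n) :: int poly)" by (simp only: of_nat_add of_nat_1 add_diff_cancel_right')
      then show ?thesis by (simp only: of_nat_poly)
    qed
    ultimately show "[:int p:] dvd of_nat (p ^ n + 1) - 1" by (simp only: const_poly_dvd_const_poly_iff)
  qed
  ultimately have "dvdm p f (XX ^ (p ^ n))" using congm_dvdm congm_sym by (metis mult_1)
  moreover have "dvdm p f (XX ^ Suc (p ^ n) - 1)"
  proof -
    have "?P = f * (f * w) + [:int p:] * k" using k by (simp add: algebra_simps)
    moreover have "dvdm p f (f * (f * w) + [:int p:] * k)"
      by (intro dvdm_add dvdm_mult2 dvdm_self dvdm_const dvd_triv_left)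
    ultimately show ?thesis by (simp only: Suc_eq_plus1)
  qed
  ultimately show False using not_both_X_and_cyclic[OF p f] by blast
qed

text \<open>These are the minimal polynomials of the generators of the field with \<open>p\<^bsup>2n\<^esup>\<close> elements that have
norm one over the subfield with \<open>p\<^sup>n\<close> elements. Coefficients are normalized to \<open>0, \<dots>, p - 1\<close>, so that
congruent polynomials are equal.\<close>

definition cyc_primes :: "nat \<Rightarrow> nat \<Rightarrow> int poly set" where
  "cyc_primes p n = {f. primem p f \<and> reduce_poly p f = f \<and> degree f = 2 * n \<and> dvdm p f (XX ^ (p ^ n + 1) - 1)}"

lemma finite_cyc_primes: assumes "p > 0" shows "finite (cyc_primes p n)"
proof (rule finite_subset)
  show "cyc_primes p n \<subseteq> reduced_polys p (2 * n + 1)"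
  proof
    fix f assume "f \<in> cyc_primes p n"
    then have f: "reduce_poly p f = f" "degree f = 2 * n" by (auto simp: cyc_primes_def)
    have "coeff f i \<in> {0..<int p}" for i
      using assms coeff_reduce_poly[of p f i] unfolding f(1)
      by (metis atLeastLessThan_iff of_nat_0_less_iff pos_mod_bound pos_mod_sign)
    then show "f \<in> reduced_polys p (2 * n + 1)" using f(2) by (auto simp: reduced_polys_def coeff_eq_0)
  qed
  show "finite (reduced_polys p (2 * n + 1))" using card_reduced_polys[OF assms] by blast
qed

text \<open>The polynomial \<open>x\<^bsup>p^n + 1\<^esup> - 1\<close> is a product of distinct primes modulo \<open>p\<close>. By \<open>degree_cases\<close>, those whose
degree is not \<open>2 n\<close> all divide the product of \<open>x\<^sup>2 - 1\<close> and the polynomials \<open>x\<^bsup>p^d\<^esup> - x\<close> for \<open>0 < d < n\<close>. Hence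
they use up a degree of at most \<open>2 + (n - 1) p\<^bsup>n - 1\<^esup>\<close>, and the rest is left for degree \<open>2 n\<close>.\<close>

lemma card_cyc_primes:
  assumes p: "prime p" and n: "n \<ge> 1"
  shows "p ^ n + 1 \<le> 2 * n * card (cyc_primes p n) + 2 + (n - 1) * p ^ (n - 1)"
proof -
  let ?P = "XX ^ (p ^ n + 1) - 1"
  have Pm: "lead_coeff ?P = 1" "degree ?P = p ^ n + 1"
    by (rule XXpow_minus_monic, simp)+
  obtain fs where fs: "\<forall>g\<in>set fs. primem p g \<and> reduce_poly p g = g" "[:int p:] dvd ?P - prod_list fs"
    using prime_factorization_mod[OF p Pm(1)] by blast
  have "distinct fs"
  proof (rule ccontr)
    assume "\<not> distinct fs"
    then obtain xs ys zs f where d: "fs = xs @ [f] @ ys @ [f] @ zs" using not_distinct_decomp by blast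
    then have "primem p f" using fs(1) by simp
    moreover have "prod_list fs = f * (f * (prod_list xs * prod_list ys * prod_list zs))"
      by (simp add: d mult_ac)
    ultimately show False using cyclic_squarefree[OF p _ n] fs(2) by metis
  qed
  define S where "S = set fs"
  have finS: "finite S" by (simp add: S_def)
  have S: "primem p f \<and> reduce_poly p f = f" if "f \<in> S" for f using that fs(1) by (simp add: S_def)
  have PS: "[:int p:] dvd ?P - \<Prod>S"
    using fs(2) prod.distinct_set_conv_list[OF \<open>distinct fs\<close>, of "\<lambda>x. x"] by (simp add: S_def)
  have SP: "dvdm p f ?P" if "f \<in> S" for f
  proof -
    have "dvdm p f (\<Prod>S)" using finS that by (intro dvdm_prod) auto
    then show ?thesis using congm_dvdm[OF congm_const[OF PS]] by blast
  qed
  have mS: "lead_coeff (\<Prod>S) = 1 \<and> degree (\<Prod>S) = (\<Sum>f\<in>S. degree f)"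
    using prod_monic[of S "\<lambda>f. f"] finS S primem_monic by auto
  have "p ^ n + 1 \<le> (\<Sum>f\<in>S. degree f)"
  proof (rule ccontr)
    assume "\<not> ?thesis"
    then have lt: "degree (\<Prod>S) < degree ?P" using mS Pm by linarith
    have "coeff (?P - \<Prod>S) (degree ?P) = 1" using lt Pm(1) by (simp add: coeff_eq_0)
    moreover have "int p dvd coeff (?P - \<Prod>S) (degree ?P)" using PS const_dvd_coeff by blast
    ultimately show False using p by simp
  qed
  also have "S = {f\<in>S. degree f = 2 * n} \<union> {f\<in>S. degree f \<noteq> 2 * n}" by blast
  also have "(\<Sum>f\<in>\<dots>. degree f) = (\<Sum>f\<in>{f\<in>S. degree f = 2 * n}. degree f) + (\<Sum>f\<in>{f\<in>S. degree f \<noteq> 2 * n}. degree f)"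
    using finS by (intro sum.union_disjoint) auto
  also have "(\<Sum>f\<in>{f\<in>S. degree f = 2 * n}. degree f) = 2 * n * card {f\<in>S. degree f = 2 * n}" by simp
  also have "2 * n * card {f\<in>S. degree f = 2 * n} \<le> 2 * n * card (cyc_primes p n)"
    using finite_cyc_primes[OF prime_gt_0_nat[OF p]] S SP
    by (intro mult_le_mono2 card_mono) (auto simp: cyc_primes_def)
  also have "(\<Sum>f\<in>{f\<in>S. degree f \<noteq> 2 * n}. degree f) \<le> 2 + (n - 1) * p ^ (n - 1)"
  proof -
    let ?h = "\<lambda>d. XX ^ (p ^ d) - XX"
    let ?Z = "(XX ^ 2 - 1) * (\<Prod>d\<in>{1..<n}. ?h d)"
    have h: "lead_coeff (?h d) = 1" "degree (?h d) = p ^ d" if "d \<in> {1..<n}" for d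
    proof -
      have "1 < p ^ d" using that prime_gt_1_nat[OF p] by (intro one_less_power) auto
      then have "degree XX < p ^ d" by simp
      then show "lead_coeff (?h d) = 1" "degree (?h d) = p ^ d" by (rule XXpow_minus_monic)+
    qed
    have a: "lead_coeff (XX ^ 2 - 1) = 1" "degree (XX ^ 2 - 1) = 2"
      by (rule XXpow_minus_monic, simp)+
    have b: "lead_coeff (prod ?h {1..<n}) = 1 \<and> degree (prod ?h {1..<n}) = (\<Sum>d\<in>{1..<n}. degree (?h d))"
      using h(1) by (intro prod_monic) auto
    have lZ: "lead_coeff ?Z = 1" unfolding lead_coeff_mult using a(1) conjunct1[OF b] by (simp only: mult_1)
    have n0: "XX ^ 2 - 1 \<noteq> 0" "prod ?h {1..<n} \<noteq> 0" using a b by (metis coeff_0 zero_neq_one)+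
    have "degree ?Z = 2 + (\<Sum>d\<in>{1..<n}. degree (?h d))"
      using degree_mult_eq[OF n0] a(2) b by simp
    also have "(\<Sum>d\<in>{1..<n}. degree (?h d)) \<le> (\<Sum>d\<in>{1..<n}. p ^ (n - 1))"
    proof (rule sum_mono)
      fix d assume d: "d \<in> {1..<n}"
      show "degree (?h d) \<le> p ^ (n - 1)" unfolding h(2)[OF d]
        using d prime_gt_0_nat[OF p] by (intro power_increasing) auto
    qed
    also have "(\<Sum>d\<in>{1..<n}. p ^ (n - 1)) = (n - 1) * p ^ (n - 1)" by simp
    finally have dZ: "degree ?Z \<le> 2 + (n - 1) * p ^ (n - 1)" by simp
    have "(\<Sum>f\<in>{f\<in>S. degree f \<noteq> 2 * n}. degree f) \<le> degree ?Z"
    proof (rule sum_degree_primes_le[OF p _ _ _ lZ])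
      show "finite {f \<in> S. degree f \<noteq> 2 * n}" using finS by simp
      show "primem p f \<and> reduce_poly p f = f" if "f \<in> {f \<in> S. degree f \<noteq> 2 * n}" for f using that S by blast
      fix f assume f: "f \<in> {f \<in> S. degree f \<noteq> 2 * n}"
      then have "dvdm p f (XX ^ 2 - 1) \<or> (\<exists>d\<in>{1..<n}. dvdm p f (?h d))"
        using degree_cases[OF p _ n] S SP by blast
      then show "dvdm p f ?Z"
      proof
        assume "\<exists>d\<in>{1..<n}. dvdm p f (?h d)"
        then have "dvdm p f (prod ?h {1..<n})" using dvdm_prod by (metis finite_atLeastLessThan)
        then show ?thesis by (rule dvdm_mult)
      qed (rule dvdm_mult2)
    qed
    with dZ show ?thesis by linarith
  qed
  finally show ?thesis by linarith
qed

text \<open>In the residue field of \<open>f\<close> the element \<open>x\<^bsup>p^n\<^esup>\<close> is a root of \<open>f\<close> by Frobenius, and it is the inverse of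
\<open>x\<close>. So \<open>f\<close> divides its reversed polynomial \<open>r\<close>, and comparing degrees gives \<open>r = a\<^sub>0 f\<close> modulo \<open>p\<close>, where
\<open>a\<^sub>0\<close> is the constant coefficient and satisfies \<open>a\<^sub>0\<^sup>2 = 1\<close>. The sign \<open>a\<^sub>0 = -1\<close> would make \<open>1\<close> a root of \<open>f\<close>.\<close>

lemma cyc_primes_palindromic:
  assumes p: "prime p" and f: "f \<in> cyc_primes p n" and n: "n \<ge> 1" and j: "j \<le> 2 * n"
  shows "coeff f (2 * n - j) = coeff f j" "coeff f 0 = 1"
proof -
  let ?q = "p ^ n" and ?a = "coeff f"
  have fp: "primem p f" and fr: "reduce_poly p f = f" and df: "degree f = 2 * n" and P: "dvdm p f (XX ^ (?q + 1) - 1)"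
    using f by (auto simp: cyc_primes_def)
  note fm = primem_monic[OF fp] and p0 = prime_gt_0_nat[OF p]
  have rng: "0 \<le> ?a i \<and> ?a i < int p" for i
    using p0 coeff_reduce_poly[of p f i] unfolding fr by (metis of_nat_0_less_iff pos_mod_bound pos_mod_sign)
  have 1: "congm p f (XX ^ (?q + 1)) 1" using P by (simp only: congm_def)
  have fsum: "f = (\<Sum>i\<le>2 * n. smult (?a i) (XX ^ i))"
    using poly_as_sum_of_monoms[of f] by (simp add: XX_pow smult_monom df)
  define r where "r = (\<Sum>i\<le>2 * n. smult (?a i) (XX ^ (2 * n - i)))"
  have cr: "coeff r i = (if i \<le> 2 * n then ?a (2 * n - i) else 0)" for i
  proof -
    have "coeff r i = (\<Sum>k\<le>2 * n. if k = 2 * n - i \<and> i \<le> 2 * n then ?a k else 0)"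
      unfolding r_def coeff_sum XX_pow smult_monom coeff_monom by (intro sum.cong) auto
    also have "\<dots> = (if i \<le> 2 * n then ?a (2 * n - i) else 0)" by (auto simp: sum.delta)
    finally show ?thesis .
  qed
  have "dvdm p f (pcompose f (XX ^ ?q))"
  proof -
    have "dvdm p f (f ^ ?q)" using p0 by (metis dvd_imp_dvdm dvd_power zero_less_power)
    then show ?thesis using congm_dvdm[OF congm_sym[OF congm_zero_imp[OF frobenius_pcompose[OF p]]]] by blast
  qed
  then have "dvdm p f (XX ^ (2 * n) * pcompose f (XX ^ ?q))" by (rule dvdm_mult)
  moreover have "congm p f r (XX ^ (2 * n) * pcompose f (XX ^ ?q))"
  proof -
    have Xk: "pcompose (XX ^ k) Y = Y ^ k" for k Y
      by (induction k) (simp_all add: pcompose_mult pcompose_1 pcompose_pCons)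
    have "pcompose f (XX ^ ?q) = (\<Sum>i\<le>2 * n. smult (?a i) ((XX ^ ?q) ^ i))"
      by (subst fsum) (simp only: pcompose_sum pcompose_smult Xk)
    then have "XX ^ (2 * n) * pcompose f (XX ^ ?q) = (\<Sum>i\<le>2 * n. [:?a i:] * (XX ^ (2 * n) * (XX ^ ?q) ^ i))"
      by (simp add: sum_distrib_left)
    also have "\<dots> = (\<Sum>i\<le>2 * n. [:?a i:] * (XX ^ (2 * n - i) * (XX ^ (?q + 1)) ^ i))"
    proof (rule sum.cong[OF refl])
      fix i assume "i \<in> {..2 * n}"
      then have "XX ^ (2 * n) = XX ^ (2 * n - i) * XX ^ i" by (simp add: power_add[symmetric])
      then show "[:?a i:] * (XX ^ (2 * n) * (XX ^ ?q) ^ i) = [:?a i:] * (XX ^ (2 * n - i) * (XX ^ (?q + 1)) ^ i)"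
        by (simp only: power_add power_one_right power_mult_distrib mult_ac)
    qed
    also have "congm p f \<dots> (\<Sum>i\<le>2 * n. [:?a i:] * (XX ^ (2 * n - i) * 1 ^ i))"
      by (intro congm_sum congm_mult congm_refl congm_pow 1)
    also have "(\<Sum>i\<le>2 * n. [:?a i:] * (XX ^ (2 * n - i) * 1 ^ i)) = r" by (simp add: r_def)
    finally show ?thesis by (rule congm_sym)
  qed
  ultimately have "dvdm p f r" using congm_dvdm by blast
  then have "dvdm p f (r - [:?a 0:] * f)" by (intro dvdm_diff dvdm_mult dvdm_self)
  moreover have "int p dvd coeff (r - [:?a 0:] * f) i" if "i \<ge> degree f" for i
    using that fm(1) by (cases "i = 2 * n") (auto simp: cr df coeff_eq_0)
  ultimately have "[:int p:] dvd r - [:?a 0:] * f" using dvdm_low_degree[OF p0 fm(1)] by blast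
  then have all: "int p dvd coeff r i - ?a 0 * ?a i" for i by (simp add: const_dvd_coeff)
  then have pal: "int p dvd ?a (2 * n - i) - ?a 0 * ?a i" if "i \<le> 2 * n" for i
    using that cr[of i] by metis
  have "int p dvd (?a 0 - 1) * (?a 0 + 1)"
    using pal[of 0] fm(1) by (simp add: df algebra_simps dvd_diff_commute)
  then consider "int p dvd ?a 0 - 1" | "int p dvd ?a 0 + 1"
    using p by (metis prime_dvd_mult_iff prime_nat_int_transfer)
  then have a1: "[?a 0 = 1] (mod (int p))"
  proof cases
    case 1 then show ?thesis by (simp add: cong_iff_dvd_diff)
  next
    case 2
    have neg: "int p dvd ?a (2 * n - i) + ?a i" if "i \<le> 2 * n" for i
    proof -
      have "int p dvd (?a (2 * n - i) - ?a 0 * ?a i) + (?a 0 + 1) * ?a i"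
        by (rule dvd_add[OF pal[OF that] dvd_mult2[OF 2]])
      also have "(?a (2 * n - i) - ?a 0 * ?a i) + (?a 0 + 1) * ?a i = ?a (2 * n - i) + ?a i"
        by (simp add: algebra_simps)
      finally show ?thesis .
    qed
    have "poly f 1 = (\<Sum>i\<le>2 * n. ?a i)" by (simp add: poly_altdef df)
    moreover have "(\<Sum>i\<le>2 * n. ?a i) = (\<Sum>i\<le>2 * n. ?a (2 * n - i))"
      by (rule sum.reindex_bij_witness[of _ "\<lambda>i. 2 * n - i" "\<lambda>i. 2 * n - i"]) auto
    ultimately have "2 * poly f 1 = (\<Sum>i\<le>2 * n. ?a (2 * n - i) + ?a i)" by (simp add: sum.distrib)
    then have d2: "int p dvd 2 * poly f 1" by (auto intro!: dvd_sum neg)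
    show ?thesis
    proof (cases "p = 2")
      case True
      have "int p dvd (?a 0 + 1) - 2" using 2 True by (intro dvd_diff) auto
      then show ?thesis by (simp add: cong_iff_dvd_diff)
    next
      case False
      then have "\<not> int p dvd 2" using p
        by (metis int_dvd_int_iff of_nat_numeral primes_dvd_imp_eq two_is_prime_nat)
      then have pf: "int p dvd poly f 1" using d2 p by (metis prime_dvd_mult_iff prime_nat_int_transfer)
      obtain u where u: "f - [:poly f 1:] = [:-1, 1:] * u"
        using poly_eq_0_iff_dvd[of "f - [:poly f 1:]" 1] by (auto elim!: dvdE)
      have "[:int p:] dvd [:poly f 1:]" using pf by simp
      then have "dvdm p f (f - [:poly f 1:])" by (intro dvdm_diff dvdm_self dvdm_const)
      then have "dvdm p f [:-1, 1:] \<or> dvdm p f u" unfolding u by (rule primem_prodD[OF fp])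
      moreover have "\<not> dvdm p f [:-1, 1:]"
      proof
        assume "dvdm p f [:-1, 1:]"
        then have "[:int p:] dvd [:-1, 1:]" using dvdm_low_degree'[OF p0 fm(1)] df n by simp
        then show False using monic_not_cong_0[OF p, of "[:-1, 1:]"] by simp
      qed
      moreover have "\<not> dvdm p f u"
      proof
        assume du: "dvdm p f u"
        have lf: "lead_coeff (f - [:poly f 1:]) = 1 \<and> degree (f - [:poly f 1:]) = 2 * n"
        proof -
          have "degree (- [:poly f 1:]) < degree f" using df n by simp
          then have dd: "degree (f - [:poly f 1:]) = 2 * n" using degree_add_eq_left[of "- [:poly f 1:]" f] df
            by (simp only: diff_conv_add_uminus)
          then show ?thesis using fm df n by (auto simp: coeff_eq_0)
        qed
        have u0: "u \<noteq> 0" using lf u n by auto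
        have "degree ([:-1, 1:] * u) = 1 + degree u" using degree_mult_eq[of "[:-1, 1:]" u] u0 by simp
        then have "degree u < degree f" using lf u df by simp
        then have "[:int p:] dvd u" using dvdm_low_degree'[OF p0 fm(1) du] by simp
        moreover have "lead_coeff u = 1"
          using lf unfolding u lead_coeff_mult by (simp del: mult_pCons_left)
        ultimately show False using monic_not_cong_0[OF p] by blast
      qed
      ultimately show ?thesis by blast
    qed
  qed
  then show a01: "?a 0 = 1" using rng[of 0] prime_gt_1_nat[OF p] by (simp add: cong_def)
  have "[?a (2 * n - j) = ?a j] (mod (int p))" using pal[OF j] a01 by (simp add: cong_iff_dvd_diff)
  then show "?a (2 * n - j) = ?a j" using rng[of j] rng[of "2 * n - j"] by (simp add: cong_def)
qed

section \<open>The symplectic form and congruences of matrices\<close>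

text \<open>Vectors are functions on the natural numbers of which only the entries below the dimension matter.
In this way the dimension does not have to be checked for every vector.\<close>

definition act :: "nat \<Rightarrow> int mat \<Rightarrow> (nat \<Rightarrow> int) \<Rightarrow> nat \<Rightarrow> int" where
  "act d A x = (\<lambda>i. if i < d then (\<Sum>j<d. A $$ (i, j) * x j) else 0)"

text \<open>The symplectic form with Gram matrix \<open>J_mat n\<close>.\<close>

definition omega :: "nat \<Rightarrow> (nat \<Rightarrow> int) \<Rightarrow> (nat \<Rightarrow> int) \<Rightarrow> int" where
  "omega n x y = (\<Sum>i<n. x i * y (n + i) - x (n + i) * y i)"

definition bvec :: "nat \<Rightarrow> nat \<Rightarrow> int" where "bvec j = (\<lambda>i. if i = j then 1 else 0)"

definition vcong :: "nat \<Rightarrow> nat \<Rightarrow> (nat \<Rightarrow> int) \<Rightarrow> (nat \<Rightarrow> int) \<Rightarrow> bool" where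
  "vcong d m x y \<longleftrightarrow> (\<forall>i<d. [x i = y i] (mod (int m)))"

definition mcong :: "nat \<Rightarrow> nat \<Rightarrow> int mat \<Rightarrow> int mat \<Rightarrow> bool" where
  "mcong d m A B \<longleftrightarrow> (\<forall>i<d. \<forall>j<d. [A $$ (i, j) = B $$ (i, j)] (mod (int m)))"

lemma mat_mult_index:
  "A \<in> carrier_mat d d \<Longrightarrow> B \<in> carrier_mat d d \<Longrightarrow> i < d \<Longrightarrow> j < d \<Longrightarrow>
    (A * B) $$ (i, j) = (\<Sum>k<d. A $$ (i, k) * B $$ (k, j))"
  by (simp add: scalar_prod_def atLeast0LessThan)

lemma act_bvec: "j < d \<Longrightarrow> i < d \<Longrightarrow> act d A (bvec j) i = A $$ (i, j)"
  by (simp add: act_def bvec_def if_distrib cong: if_cong)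

lemma act_mult: assumes "A \<in> carrier_mat d d" "B \<in> carrier_mat d d"
  shows "act d (A * B) x = act d A (act d B x)"
proof
  fix i
  show "act d (A * B) x i = act d A (act d B x) i"
  proof (cases "i < d")
    case True
    have "(A * B) $$ (i, j) = (\<Sum>k<d. A $$ (i, k) * B $$ (k, j))" if "j < d" for j
      using assms True that by (intro mat_mult_index)
    then have "act d (A * B) x i = (\<Sum>j<d. (\<Sum>k<d. A $$ (i, k) * B $$ (k, j)) * x j)"
      using True by (simp add: act_def)
    also have "\<dots> = (\<Sum>k<d. \<Sum>j<d. A $$ (i, k) * B $$ (k, j) * x j)"
      by (subst sum.swap) (simp add: sum_distrib_right)
    also have "\<dots> = act d A (act d B x) i"
      using True by (simp add: act_def sum_distrib_left mult.assoc)
    finally show ?thesis .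
  qed (simp add: act_def)
qed

lemma act_one: "i < d \<Longrightarrow> act d (1\<^sub>m d) x i = x i"
proof -
  assume i: "i < d"
  have "act d (1\<^sub>m d) x i = (\<Sum>j<d. if j = i then x j else 0)"
    unfolding act_def if_P[OF i] by (rule sum.cong) (use i in auto)
  then show ?thesis using i by simp
qed

lemma act_add: "act d A (\<lambda>i. x i + y i) = (\<lambda>i. act d A x i + act d A y i)"
  by (auto simp: act_def algebra_simps sum.distrib)

lemma act_smult: "act d A (\<lambda>i. c * x i) = (\<lambda>i. c * act d A x i)"
  by (auto simp: act_def sum_distrib_left algebra_simps)

lemma omega_add_right: "omega n x (\<lambda>i. y i + z i) = omega n x y + omega n x z"
  by (simp add: omega_def sum.distrib[symmetric] algebra_simps)
lemma omega_add_left: "omega n (\<lambda>i. y i + z i) x = omega n y x + omega n z x"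
  by (simp add: omega_def sum.distrib[symmetric] algebra_simps)
lemma omega_smult_right: "omega n x (\<lambda>i. c * y i) = c * omega n x y"
  by (simp add: omega_def sum_distrib_left algebra_simps)
lemma omega_smult_left: "omega n (\<lambda>i. c * y i) x = c * omega n y x"
  by (simp add: omega_def sum_distrib_left algebra_simps)
lemma omega_skew: "omega n x y = - omega n y x"
  by (simp add: omega_def sum_negf[symmetric] algebra_simps)
lemma omega_self [simp]: "omega n x x = 0"
  by (simp add: omega_def algebra_simps)
lemma omega_sum_left: "finite S \<Longrightarrow> omega n (\<lambda>i. \<Sum>k\<in>S. f k i) x = (\<Sum>k\<in>S. omega n (f k) x)"
  by (induction S rule: finite_induct) (simp_all add: omega_add_left, simp add: omega_def)
lemma omega_sum_right: "finite S \<Longrightarrow> omega n x (\<lambda>i. \<Sum>k\<in>S. f k i) = (\<Sum>k\<in>S. omega n x (f k))"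
  by (induction S rule: finite_induct) (simp_all add: omega_add_right, simp add: omega_def)
lemma omega_ext: "(\<And>i. i < 2 * n \<Longrightarrow> x i = x' i) \<Longrightarrow> (\<And>i. i < 2 * n \<Longrightarrow> y i = y' i) \<Longrightarrow> omega n x y = omega n x' y'"
  by (simp add: omega_def)

lemma omega_bvec_right: "omega n x (bvec j) = (if j < n then - x (n + j) else if j < 2 * n then x (j - n) else 0)"
proof -
  have "omega n x (bvec j) = (\<Sum>i<n. x i * bvec j (n + i)) - (\<Sum>i<n. x (n + i) * bvec j i)"
    by (simp add: omega_def sum_subtractf)
  moreover have "(\<Sum>i<n. x (n + i) * bvec j i) = (if j < n then x (n + j) else 0)"
    by (simp add: bvec_def if_distrib cong: if_cong)
  moreover have "(\<Sum>i<n. x i * bvec j (n + i)) = (if n \<le> j \<and> j < 2 * n then x (j - n) else 0)"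
  proof (cases "n \<le> j \<and> j < 2 * n")
    case True
    then have "(\<Sum>i<n. x i * bvec j (n + i)) = (\<Sum>i<n. if i = j - n then x i else 0)"
      by (intro sum.cong) (auto simp: bvec_def)
    also have "\<dots> = x (j - n)" using True by auto
    finally show ?thesis using True by simp
  next
    case False
    then have "(\<Sum>i<n. x i * bvec j (n + i)) = 0" by (intro sum.neutral) (auto simp: bvec_def)
    then show ?thesis using False by auto
  qed
  ultimately show ?thesis by auto
qed

lemma J_mat_mult_index:
  assumes "A \<in> carrier_mat (2 * n) (2 * n)" "i < 2 * n" "j < 2 * n"
  shows "(J_mat n * A) $$ (i, j) = (if i < n then A $$ (n + i, j) else - A $$ (i - n, j))"
proof -
  have "(J_mat n * A) $$ (i, j) = (\<Sum>k<2 * n. J_mat n $$ (i, k) * A $$ (k, j))"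
    using assms by (intro mat_mult_index) auto
  also have "\<dots> = (\<Sum>k<2 * n. if i < n then (if k = n + i then A $$ (k, j) else 0)
                                    else (if k = i - n then - A $$ (k, j) else 0))"
    using assms by (intro sum.cong) (auto simp: J_mat_def)
  also have "\<dots> = (if i < n then A $$ (n + i, j) else - A $$ (i - n, j))"
  proof (cases "i < n")
    case True
    then show ?thesis by (simp only: if_True sum.delta finite_lessThan) simp
  next
    case False
    then show ?thesis using assms by (simp only: if_False sum.delta finite_lessThan) auto
  qed
  finally show ?thesis .
qed

lemma sum_double: "(\<Sum>k<2 * (n::nat). f k) = (\<Sum>k<n. f k + (f (n + k) :: 'a :: comm_monoid_add))"
proof -
  have "(\<Sum>k<2 * n. f k) = (\<Sum>k<n. f k) + (\<Sum>k\<in>{n..<2*n}. f k)"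

  proof -
    have "{..<2 * n} = {..<n} \<union> {n..<2*n}" by auto
    then show ?thesis by (simp add: sum.union_disjoint ivl_disj_int)
  qed
  also have "(\<Sum>k\<in>{n..<2*n}. f k) = (\<Sum>k<n. f (n + k))"
    by (rule sum.reindex_bij_witness[of _ "\<lambda>k. n + k" "\<lambda>k. k - n"]) auto
  finally show ?thesis by (simp add: sum.distrib)
qed

lemma gram_index:
  assumes "A \<in> carrier_mat (2 * n) (2 * n)" "i < 2 * n" "j < 2 * n"
  shows "(transpose_mat A * J_mat n * A) $$ (i, j) = omega n (\<lambda>k. A $$ (k, i)) (\<lambda>k. A $$ (k, j))"
proof -
  have JA: "J_mat n * A \<in> carrier_mat (2 * n) (2 * n)" using assms(1) J_mat_carrier by (rule mult_carrier_mat[rotated])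
  have "transpose_mat A * J_mat n * A = transpose_mat A * (J_mat n * A)"
    using assms(1) by (intro assoc_mult_mat[of _ "2*n" "2*n" _ "2*n" _ "2*n"]) auto
  then have "(transpose_mat A * J_mat n * A) $$ (i, j) = (\<Sum>k<2*n. A $$ (k, i) * (J_mat n * A) $$ (k, j))"
    using assms JA by (simp add: mat_mult_index[of _ "2*n"] del: index_mult_mat(1))
  also have "\<dots> = (\<Sum>k<2*n. A $$ (k, i) * (if k < n then A $$ (n + k, j) else - A $$ (k - n, j)))"
    using assms by (intro sum.cong refl arg_cong2[of _ _ _ _ "(*)"] J_mat_mult_index) auto
  also have "\<dots> = omega n (\<lambda>k. A $$ (k, i)) (\<lambda>k. A $$ (k, j))"
    unfolding sum_double omega_def by (intro sum.cong) auto
  finally show ?thesis .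
qed

lemma J_mat_index: "i < 2 * n \<Longrightarrow> j < 2 * n \<Longrightarrow> J_mat n $$ (i, j) = omega n (bvec i) (bvec j)"
  unfolding omega_bvec_right by (auto simp: bvec_def J_mat_def)

lemma omega_act:
  "omega n (act (2 * n) A x) (act (2 * n) A y) =
     (\<Sum>i<2*n. \<Sum>j<2*n. x i * y j * omega n (\<lambda>k. A $$ (k, i)) (\<lambda>k. A $$ (k, j)))"
proof -
  have "omega n (act (2 * n) A x) (act (2 * n) A y) =
    omega n (\<lambda>k. \<Sum>i<2*n. x i * A $$ (k, i)) (\<lambda>k. \<Sum>j<2*n. y j * A $$ (k, j))"
    by (rule omega_ext) (simp_all add: act_def mult.commute)
  also have "\<dots> = (\<Sum>i<2*n. \<Sum>j<2*n. x i * (y j * omega n (\<lambda>k. A $$ (k, i)) (\<lambda>k. A $$ (k, j))))"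
    by (simp add: omega_sum_left omega_sum_right omega_smult_left omega_smult_right sum_distrib_left)
  finally show ?thesis by (simp add: mult.assoc)
qed

text \<open>The entries of \<open>A\<^sup>T J A\<close> are the values of the form on pairs of columns of \<open>A\<close>.\<close>

lemma Sp_iff:
  "A \<in> carrier (Sp n) \<longleftrightarrow> A \<in> carrier_mat (2 * n) (2 * n) \<and>
     (\<forall>x y. omega n (act (2 * n) A x) (act (2 * n) A y) = omega n x y)" (is "?L \<longleftrightarrow> ?R")
proof
  assume L: ?L
  then have A: "A \<in> carrier_mat (2 * n) (2 * n)" and G: "transpose_mat A * J_mat n * A = J_mat n"
    by (auto simp: Sp_def)
  have "omega n (\<lambda>k. A $$ (k, i)) (\<lambda>k. A $$ (k, j)) = omega n (\<lambda>k. 1\<^sub>m (2 * n) $$ (k, i)) (\<lambda>k. 1\<^sub>m (2 * n) $$ (k, j))"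
    if "i < 2 * n" "j < 2 * n" for i j
  proof -
    have "omega n (\<lambda>k. A $$ (k, i)) (\<lambda>k. A $$ (k, j)) = omega n (bvec i) (bvec j)"
      using gram_index[OF A that] G J_mat_index[OF that] by simp
    also have "\<dots> = omega n (\<lambda>k. 1\<^sub>m (2 * n) $$ (k, i)) (\<lambda>k. 1\<^sub>m (2 * n) $$ (k, j))"
      using that by (intro omega_ext) (auto simp: bvec_def)
    finally show ?thesis .
  qed
  then have "omega n (act (2 * n) A x) (act (2 * n) A y) = omega n (act (2 * n) (1\<^sub>m (2 * n)) x) (act (2 * n) (1\<^sub>m (2 * n)) y)" for x y
    unfolding omega_act by (intro sum.cong refl) auto
  also have "omega n (act (2 * n) (1\<^sub>m (2 * n)) x) (act (2 * n) (1\<^sub>m (2 * n)) y) = omega n x y" for x y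
    by (intro omega_ext act_one)
  finally show ?R using A by simp
next
  assume R: ?R
  then have A: "A \<in> carrier_mat (2 * n) (2 * n)" by simp
  have "transpose_mat A * J_mat n * A = J_mat n"
  proof (rule eq_matI)
    fix i j assume "i < dim_row (J_mat n)" "j < dim_col (J_mat n)"
    then have ij: "i < 2 * n" "j < 2 * n" by (auto simp: carrier_matD[OF J_mat_carrier])
    have "(transpose_mat A * J_mat n * A) $$ (i, j) = omega n (\<lambda>k. A $$ (k, i)) (\<lambda>k. A $$ (k, j))"
      by (rule gram_index[OF A ij])
    also have "\<dots> = omega n (act (2 * n) A (bvec i)) (act (2 * n) A (bvec j))"
      using ij by (intro omega_ext) (simp_all add: act_bvec)
    also have "\<dots> = omega n (bvec i) (bvec j)" using R by blast
    also have "\<dots> = J_mat n $$ (i, j)" using J_mat_index[OF ij] by simp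
    finally show "(transpose_mat A * J_mat n * A) $$ (i, j) = J_mat n $$ (i, j)" .
  qed (use A in \<open>auto simp: carrier_matD[OF J_mat_carrier]\<close>)
  then show ?L using A by (simp add: Sp_def)
qed

lemma SpD: assumes "A \<in> carrier (Sp n)"
  shows "A \<in> carrier_mat (2 * n) (2 * n)" "omega n (act (2 * n) A x) (act (2 * n) A y) = omega n x y"
  using assms unfolding Sp_iff by auto

lemma Sp_simps [simp]: "mult (Sp n) = (*)" "one (Sp n) = 1\<^sub>m (2 * n)"
  by (simp_all add: Sp_def)

lemma vcong_refl [simp]: "vcong d m x x" by (simp add: vcong_def)
lemma vcong_sym: "vcong d m x y \<Longrightarrow> vcong d m y x" by (simp add: vcong_def cong_sym)
lemma vcong_trans [trans]: "vcong d m x y \<Longrightarrow> vcong d m y z \<Longrightarrow> vcong d m x z"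
  unfolding vcong_def using cong_trans by blast
lemma mcong_refl [simp]: "mcong d m x x" by (simp add: mcong_def)
lemma mcong_sym: "mcong d m x y \<Longrightarrow> mcong d m y x" by (simp add: mcong_def cong_sym)
lemma mcong_trans [trans]: "mcong d m x y \<Longrightarrow> mcong d m y z \<Longrightarrow> mcong d m x z"
  unfolding mcong_def using cong_trans by blast

lemma vcong_act: "mcong d m A B \<Longrightarrow> vcong d m x y \<Longrightarrow> vcong d m (act d A x) (act d B y)"
  by (auto simp: vcong_def mcong_def act_def intro!: cong_sum cong_mult)

lemma mcongI: assumes "\<And>j. j < d \<Longrightarrow> vcong d m (act d A (bvec j)) (act d B (bvec j))"
  shows "mcong d m A B"
  using assms unfolding mcong_def vcong_def by (metis act_bvec)

lemma mcong_mult: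
  assumes "A \<in> carrier_mat d d" "B \<in> carrier_mat d d" "A' \<in> carrier_mat d d" "B' \<in> carrier_mat d d"
    and "mcong d m A A'" "mcong d m B B'"
  shows "mcong d m (A * B) (A' * B')"
  by (rule mcongI) (simp add: act_mult assms vcong_act)

lemma omega_cong: "vcong (2 * n) m x x' \<Longrightarrow> vcong (2 * n) m y y' \<Longrightarrow> [omega n x y = omega n x' y'] (mod (int m))"
  by (auto simp: omega_def vcong_def intro!: cong_sum cong_diff cong_mult)

lemma omega_nondegenerate_cong:
  assumes "\<And>x. [omega n x y = omega n x z] (mod (int m))" shows "vcong (2 * n) m y z"
  unfolding vcong_def
proof (intro allI impI)
  fix i assume i: "i < 2 * n"
  have s: "omega n (bvec j) w = - omega n w (bvec j)" for j w by (rule omega_skew)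
  define j where "j = (if i < n then n + i else i - n)"
  have "omega n (bvec j) w = (if i < n then - w i else w i)" for w
    using i by (auto simp: s omega_bvec_right j_def)
  then have "[(if i < n then - y i else y i) = (if i < n then - z i else z i)] (mod (int m))"
    using assms[of "bvec j"] by simp
  then show "[y i = z i] (mod (int m))" by (auto split: if_splits simp: cong_minus_minus_iff)
qed

lemma Sp_mult_closed: "A \<in> carrier (Sp n) \<Longrightarrow> B \<in> carrier (Sp n) \<Longrightarrow> A * B \<in> carrier (Sp n)"
  using monoid.m_closed[OF group.is_monoid[OF group_Sp], of A n B] by simp

lemma Sp_inv:
  assumes "A \<in> carrier (Sp n)"
  shows "inv\<^bsub>Sp n\<^esub> A \<in> carrier (Sp n)" "inv\<^bsub>Sp n\<^esub> A * A = 1\<^sub>m (2 * n)" "A * inv\<^bsub>Sp n\<^esub> A = 1\<^sub>m (2 * n)"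
  using group.inv_closed[OF group_Sp assms] group.l_inv[OF group_Sp assms] group.r_inv[OF group_Sp assms] by simp_all

lemma Sp_act_inv:
  assumes "A \<in> carrier (Sp n)" "i < 2 * n"
  shows "act (2*n) (inv\<^bsub>Sp n\<^esub> A) (act (2*n) A x) i = x i" "act (2*n) A (act (2*n) (inv\<^bsub>Sp n\<^esub> A) x) i = x i"
  using Sp_inv[OF assms(1)] SpD(1) assms
  by (metis act_mult act_one)+

lemma omega_inv: assumes "A \<in> carrier (Sp n)"
  shows "omega n (act (2*n) A x) y = omega n x (act (2*n) (inv\<^bsub>Sp n\<^esub> A) y)"
proof -
  have "omega n (act (2*n) A x) y = omega n (act (2*n) A x) (act (2*n) A (act (2*n) (inv\<^bsub>Sp n\<^esub> A) y))"
    using Sp_act_inv[OF assms] by (intro omega_ext) auto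
  then show ?thesis using SpD(2)[OF assms] by simp
qed

section \<open>Symplectic companion matrices\<close>

definition companion_col :: "nat \<Rightarrow> (nat \<Rightarrow> int) \<Rightarrow> nat \<Rightarrow> nat \<Rightarrow> int" where
  "companion_col n b j i = (if Suc j = n then (if i < n then b i else 0) else if n \<le> j \<and> i = 0 then b (Suc j - n) else 0)"

text \<open>For \<open>b n = -1\<close> and the basis \<open>e\<^sub>0, \<dots>, e\<^bsub>n-1\<^esub>, f\<^sub>0, \<dots>, f\<^bsub>n-1\<^esub>\<close>, this is the signed cyclic shift
\<open>e\<^sub>0 \<rightarrow> \<dots> \<rightarrow> e\<^bsub>n-1\<^esub> \<rightarrow> f\<^sub>0 \<rightarrow> \<dots> \<rightarrow> f\<^bsub>n-1\<^esub> \<rightarrow> -e\<^sub>0\<close> followed by an upper unipotent block matrix, whose symmetric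
block has \<open>b 0, \<dots>, b (n - 1)\<close> as first row and column and zeros elsewhere. It is symplectic, and in this
basis it is upper Hessenberg.\<close>

definition companion :: "nat \<Rightarrow> (nat \<Rightarrow> int) \<Rightarrow> int mat" where
  "companion n b = mat (2 * n) (2 * n) (\<lambda>(i, j). if i = Suc j then 1 else companion_col n b j i)"

text \<open>The matrix \<open>companion n b\<close> is upper Hessenberg with ones on the subdiagonal, so its basis vector number
\<open>j\<close> is a monic polynomial of degree \<open>j\<close> in the matrix, applied to the first basis vector. This is the
recursion for those polynomials; at \<open>j = 2 n\<close> it yields the characteristic polynomial.\<close>

fun hpoly :: "nat \<Rightarrow> (nat \<Rightarrow> int) \<Rightarrow> nat \<Rightarrow> int poly" where
  "hpoly n b 0 = 1"
| "hpoly n b (Suc j) = XX * hpoly n b j - (if Suc j = n then (\<Sum>i<n. smult (b i) (XX ^ i)) else if n \<le> j then [:b (Suc j - n):] else 0)"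

lemma companion_carrier [simp]: "companion n b \<in> carrier_mat (2 * n) (2 * n)"
  by (simp add: companion_def)

lemma hpoly_low: "j < n \<Longrightarrow> hpoly n b j = XX ^ j"
  by (induction j) auto

lemma hpoly_monic: "degree (hpoly n b j) = j \<and> lead_coeff (hpoly n b j) = 1"
proof (induction j)
  case (Suc j)
  let ?s = "if Suc j = n then (\<Sum>i<n. smult (b i) (XX ^ i)) else if n \<le> j then [:b (Suc j - n):] else 0"
  have "degree (\<Sum>i<n. smult (b i) (XX ^ i)) \<le> n - 1"
    by (intro degree_sum_le) (auto simp: degree_power_eq intro: order.trans[OF degree_smult_le])
  then have s: "degree ?s < Suc j" by auto
  have r0: "hpoly n b j \<noteq> 0" using Suc by auto
  have "degree (XX * hpoly n b j) = Suc j" using Suc r0 by (simp add: degree_mult_eq del: mult_pCons_left)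
  moreover have "lead_coeff (XX * hpoly n b j) = 1"
    unfolding lead_coeff_mult using Suc by (auto simp del: mult_pCons_left)
  ultimately have "degree (XX * hpoly n b j + (- ?s)) = Suc j" "lead_coeff (XX * hpoly n b j + (- ?s)) = 1"
    using s by (simp_all only: degree_add_eq_left degree_minus coeff_add coeff_minus coeff_eq_0)
  then show ?case by (simp only: hpoly.simps(2) diff_conv_add_uminus)
qed simp

lemma hpoly_relation:
  assumes n: "n \<ge> 1" and j: "j < 2 * n"
  shows "(\<Sum>i<2*n. smult (companion n b $$ (i, j)) (hpoly n b i)) = XX * hpoly n b j - (if Suc j = 2 * n then hpoly n b (2 * n) else 0)"
proof -
  have "(\<Sum>i<2*n. smult (companion n b $$ (i, j)) (hpoly n b i)) =
    (\<Sum>i<2*n. (if i = Suc j then hpoly n b i else 0) + smult (companion_col n b j i) (hpoly n b i))"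
    using j by (intro sum.cong) (auto simp: companion_def companion_col_def)
  also have "\<dots> = (if Suc j < 2 * n then hpoly n b (Suc j) else 0) + (\<Sum>i<2*n. smult (companion_col n b j i) (hpoly n b i))"
    by (simp add: sum.distrib)
  also have "(\<Sum>i<2*n. smult (companion_col n b j i) (hpoly n b i)) =
     (if Suc j = n then (\<Sum>i<n. smult (b i) (XX ^ i)) else if n \<le> j then [:b (Suc j - n):] else 0)" (is "_ = ?s")
  proof (cases "Suc j = n")
    case True
    have "(\<Sum>i<2*n. smult (companion_col n b j i) (hpoly n b i)) = (\<Sum>i<n. smult (companion_col n b j i) (hpoly n b i))"
      using True by (intro sum.mono_neutral_right) (auto simp: companion_col_def)
    then show ?thesis using True by (simp add: companion_col_def hpoly_low)
  next
    case False
    have "(\<Sum>i<2*n. smult (companion_col n b j i) (hpoly n b i)) = (\<Sum>i<2*n. if i = 0 then (if n \<le> j then [:b (Suc j - n):] else 0) else 0)"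
      using False by (intro sum.cong) (auto simp: companion_col_def)
    then show ?thesis using False n by simp
  qed
  also have "(if Suc j < 2 * n then hpoly n b (Suc j) else 0) + ?s = XX * hpoly n b j - (if Suc j = 2 * n then hpoly n b (2 * n) else 0)"
  proof -
    have "hpoly n b (Suc j) = XX * hpoly n b j - ?s" by (simp only: hpoly.simps(2))
    then show ?thesis using j by (cases "Suc j = 2 * n") (simp_all only: if_True if_False less_irrefl, simp_all)
  qed
  finally show ?thesis .
qed

text \<open>By \<open>hpoly_relation\<close> the row of the polynomials \<open>hpoly n b j\<close>, multiplied by the characteristic matrix, is
\<open>(0, \<dots>, 0, hpoly n b (2 n))\<close>. Multiplication by the adjugate exhibits the characteristic polynomial as a
multiple of \<open>hpoly n b (2 n)\<close>, and both are monic of degree \<open>2 n\<close>.\<close>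

lemma char_poly_companion: assumes n: "n \<ge> 1" shows "char_poly (companion n b) = hpoly n b (2 * n)"
proof -
  let ?d = "2 * n" and ?f = "hpoly n b (2 * n)" and ?C = "companion n b"
  let ?M = "char_poly_matrix ?C"
  have M: "?M \<in> carrier_mat ?d ?d" by simp
  have row: "(\<Sum>i<?d. hpoly n b i * ?M $$ (i, j)) = (if Suc j = ?d then ?f else 0)" if j: "j < ?d" for j
  proof -
    have "(\<Sum>i<?d. hpoly n b i * ?M $$ (i, j)) =
      (\<Sum>i<?d. (if i = j then XX * hpoly n b i else 0) - smult (?C $$ (i, j)) (hpoly n b i))"
      using j carrier_matD[OF companion_carrier[of n b]]
      by (intro sum.cong) (auto simp: char_poly_matrix_def algebra_simps)
    also have "\<dots> = XX * hpoly n b j - (\<Sum>i<?d. smult (?C $$ (i, j)) (hpoly n b i))"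
      using j by (simp add: sum_subtractf)
    finally show ?thesis unfolding hpoly_relation[OF n j] by simp
  qed
  let ?A = "adj_mat ?M"
  note adj = adj_mat[OF M]
  have d0: "0 < ?d" using n by simp
  have "(\<Sum>j<?d. (\<Sum>i<?d. hpoly n b i * ?M $$ (i, j)) * ?A $$ (j, 0)) = (\<Sum>i<?d. hpoly n b i * (\<Sum>j<?d. ?M $$ (i, j) * ?A $$ (j, 0)))"
    by (simp add: sum_distrib_left sum_distrib_right mult.assoc) (rule sum.swap)
  also have "\<dots> = (\<Sum>i<?d. hpoly n b i * (?M * ?A) $$ (i, 0))"
  proof (rule sum.cong[OF refl])
    fix i assume "i \<in> {..<?d}"
    then show "hpoly n b i * (\<Sum>j<?d. ?M $$ (i, j) * ?A $$ (j, 0)) = hpoly n b i * (?M * ?A) $$ (i, 0)"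
      using M adj(1) d0 by (simp only: mat_mult_index[of ?M ?d ?A i 0] lessThan_iff)
  qed
  also have "\<dots> = (\<Sum>i<?d. if i = 0 then det ?M * hpoly n b i else 0)"
    using d0 M by (intro sum.cong) (auto simp: adj(2) smult_mat_def)
  also have "\<dots> = char_poly ?C" using d0 by (simp add: char_poly_def)
  also have "(\<Sum>j<?d. (\<Sum>i<?d. hpoly n b i * ?M $$ (i, j)) * ?A $$ (j, 0)) = (\<Sum>j<?d. if j = ?d - 1 then ?f * ?A $$ (j, 0) else 0)"
    using row by (intro sum.cong) auto
  also have "\<dots> = ?f * ?A $$ (?d - 1, 0)" using d0 by simp
  finally have e: "char_poly ?C = ?f * ?A $$ (?d - 1, 0)" by simp
  have c: "degree (char_poly ?C) = ?d" "lead_coeff (char_poly ?C) = 1"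
    using degree_monic_char_poly[OF companion_carrier[of n b]] by auto
  have f: "degree ?f = ?d" "lead_coeff ?f = 1" using hpoly_monic by blast+
  let ?a = "?A $$ (?d - 1, 0)"
  have n0: "?f \<noteq> 0" "?a \<noteq> 0" using e c by auto
  have "degree ?a = 0" using e c(1) f(1) degree_mult_eq[OF n0] by simp
  moreover have "lead_coeff ?a = 1" using e c(2) f(2) lead_coeff_mult[of ?f ?a] by simp
  ultimately have "?a = 1" by (metis degree_eq_zeroE lead_coeff_pCons(2) one_pCons)
  then show ?thesis using e by simp
qed

lemma coeff_hpoly: assumes n: "n \<ge> 1" and j: "j \<le> n"
  shows "coeff (hpoly n b (n + j)) m = (if m = n + j then 1 else 0) - (if j \<le> m \<and> m < n + j then b (m - j) else 0)
     - (if m < j then b (j - m) else 0)"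
  using j
proof (induction j arbitrary: m)
  case 0
  obtain k where k: "n = Suc k" using n by (cases n) auto
  have r: "hpoly n b n = XX ^ n - (\<Sum>i<n. smult (b i) (XX ^ i))"
    using hpoly_low[of k n b] by (simp add: k)
  have "coeff (\<Sum>i<n. smult (b i) (XX ^ i)) m = (\<Sum>i<n. if i = m then b i else 0)"
    unfolding coeff_sum XX_pow by (intro sum.cong) auto
  also have "\<dots> = (if m < n then b m else 0)" by simp
  finally show ?case unfolding add_0_right r coeff_diff by (simp add: XX_pow)
next
  case (Suc j)
  have r: "hpoly n b (n + Suc j) = XX * hpoly n b (n + j) - [:b (Suc j):]"
    using n by simp
  show ?case
  proof (cases m)
    case 0
    then show ?thesis unfolding r by simp
  next
    case (Suc k)
    then show ?thesis unfolding r using Suc.IH[of k] Suc.prems by auto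
  qed
qed

text \<open>In the form of two images, the terms with \<open>b i\<close> for \<open>0 < i < n\<close> from the first row and from the column \<open>n - 1\<close>
cancel because the unipotent block is symmetric, and \<open>b 0\<close> cancels by skew symmetry.\<close>

lemma companion_Sp: assumes n: "n \<ge> 1" and bn: "b n = -1" shows "companion n b \<in> carrier (Sp n)"
  unfolding Sp_iff
proof (intro conjI allI)
  show "companion n b \<in> carrier_mat (2 * n) (2 * n)" by simp
  fix x y :: "nat \<Rightarrow> int"
  let ?C = "act (2 * n) (companion n b)"
  have Cx: "?C x i = (if i = 0 then 0 else x (i - 1)) + (\<Sum>j<2*n. companion_col n b j i * x j)" if i: "i < 2 * n" for x i
  proof -
    have "?C x i = (\<Sum>j<2*n. (if i \<noteq> 0 \<and> j = i - 1 then x j else 0) + companion_col n b j i * x j)"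
      unfolding act_def if_P[OF i] using i by (intro sum.cong) (auto simp: companion_def companion_col_def)
    also have "\<dots> = (\<Sum>j<2*n. (if i \<noteq> 0 \<and> j = i - 1 then x j else 0)) + (\<Sum>j<2*n. companion_col n b j i * x j)"
      by (rule sum.distrib)
    also have "(\<Sum>j<2*n. (if i \<noteq> 0 \<and> j = i - 1 then x j else 0)) = (if i = 0 then 0 else x (i - 1))"
      using i by (cases "i = 0") auto
    finally show ?thesis .
  qed
  obtain k where k: "n = Suc k" using n by (cases n) auto
  have s0: "(\<Sum>j<2*n. companion_col n b j 0 * x j) = b 0 * x k + (\<Sum>l<n. b (Suc l) * x (n + l))" for x
  proof -
    have "(\<Sum>j<n. companion_col n b j 0 * x j) = (\<Sum>j<n. if j = k then b 0 * x j else 0)"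
      using n by (intro sum.cong) (auto simp: companion_col_def k)
    also have "\<dots> = b 0 * x k" by (simp add: k)
    finally have 1: "(\<Sum>j<n. companion_col n b j 0 * x j) = b 0 * x k" .
    have 2: "(\<Sum>j<n. companion_col n b (n + j) 0 * x (n + j)) = (\<Sum>l<n. b (Suc l) * x (n + l))"
      by (intro sum.cong) (auto simp: companion_col_def)
    show ?thesis unfolding sum_double sum.distrib 1 2 by simp
  qed
  have s1: "(\<Sum>j<2*n. companion_col n b j i * x j) = (if i < n then b i * x k else 0)" if "i \<noteq> 0" for x i
  proof -
    have "(\<Sum>j<2*n. companion_col n b j i * x j) = (\<Sum>j<2*n. if j = k then (if i < n then b i * x j else 0) else 0)"
      using that by (intro sum.cong) (auto simp: companion_col_def k)
    also have "\<dots> = (if i < n then b i * x k else 0)" by (simp add: k)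
    finally show ?thesis .
  qed
  have C0: "?C x 0 = b 0 * x k + (\<Sum>l<n. b (Suc l) * x (n + l))" for x using Cx[of 0 x] s0[of x] n by simp
  have Ci: "?C x (Suc i) = x i + b (Suc i) * x k" if "Suc i < n" for x i using Cx[of "Suc i" x] s1[of "Suc i" x] that by simp
  have Cn: "?C x (n + i) = x (n + i - 1)" if "i < n" for x i using Cx[of "n + i" x] s1[of "n + i" x] that n by simp
  have split: "(\<Sum>i<n. g i) = g 0 + (\<Sum>i<k. g (Suc i))" for g :: "nat \<Rightarrow> int" unfolding k by (rule sum.lessThan_Suc_shift)
  let ?t = "\<lambda>i. x (n + i) * y k - x k * y (n + i)"
  have "omega n (?C x) (?C y) = (?C x 0 * ?C y n - ?C x n * ?C y 0) + (\<Sum>i<k. ?C x (Suc i) * ?C y (n + Suc i) - ?C x (n + Suc i) * ?C y (Suc i))"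
    unfolding omega_def split by simp
  also have "?C x 0 * ?C y n - ?C x n * ?C y 0 = (\<Sum>l<n. b (Suc l) * ?t l)"
    using Cn[of 0 x] Cn[of 0 y] n unfolding C0
    by (simp add: k sum_distrib_left sum_distrib_right algebra_simps sum_subtractf)
  also have "\<dots> = (\<Sum>l<k. b (Suc l) * ?t l) - ?t k" using bn by (simp add: k)
  also have "(\<Sum>i<k. ?C x (Suc i) * ?C y (n + Suc i) - ?C x (n + Suc i) * ?C y (Suc i)) =
     (\<Sum>i<k. (x i + b (Suc i) * x k) * y (n + i) - x (n + i) * (y i + b (Suc i) * y k))"
  proof (rule sum.cong[OF refl])
    fix i assume "i \<in> {..<k}"
    then have i: "Suc i < n" by (simp add: k)
    show "?C x (Suc i) * ?C y (n + Suc i) - ?C x (n + Suc i) * ?C y (Suc i) =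
      (x i + b (Suc i) * x k) * y (n + i) - x (n + i) * (y i + b (Suc i) * y k)"
      unfolding Ci[OF i] Cn[OF i] by simp
  qed
  also have "\<dots> = (\<Sum>i<k. x i * y (n + i) - x (n + i) * y i) - (\<Sum>l<k. b (Suc l) * ?t l)"
    unfolding sum_subtractf[symmetric] by (intro sum.cong) (auto simp: algebra_simps)
  finally have "omega n (?C x) (?C y) = (\<Sum>i<k. x i * y (n + i) - x (n + i) * y i) - ?t k" by simp
  also have "\<dots> = omega n x y" unfolding omega_def by (simp add: k)
  finally show "omega n (?C x) (?C y) = omega n x y" .
qed

section \<open>Centralizers modulo p\<close>

text \<open>Let \<open>x\<close> act on the integer vectors by \<open>companion n b\<close>. Followed by the projection to
\<open>\<int>[x]/(hpoly n b (2 n))\<close>, this map is the isomorphism of modules that sends the first basis vector to \<open>1\<close>.\<close>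

definition hmap :: "nat \<Rightarrow> (nat \<Rightarrow> int) \<Rightarrow> (nat \<Rightarrow> int) \<Rightarrow> int poly" where
  "hmap n b x = (\<Sum>j<2*n. smult (x j) (hpoly n b j))"

lemma congm_add_cancel: assumes "congm p f (a + s) (b + t)" "congm p f s t" shows "congm p f a b"
proof -
  have "dvdm p f ((a + s - (b + t)) - (s - t))" using assms unfolding congm_def by (rule dvdm_diff)
  then show ?thesis by (simp add: congm_def)
qed

lemma smult_conv_const_mult: "smult c u = [:c:] * (u :: int poly)"
  by simp

lemma hmap_add: "hmap n b (\<lambda>i. x i + y i) = hmap n b x + hmap n b y"
  by (simp add: hmap_def smult_add_left sum.distrib)

lemma hmap_smult: "hmap n b (\<lambda>i. c * x i) = [:c:] * hmap n b x"
  by (simp add: hmap_def smult_sum2)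

lemma hmap_ext: "(\<And>i. i < 2 * n \<Longrightarrow> x i = y i) \<Longrightarrow> hmap n b x = hmap n b y"
  by (simp add: hmap_def)

lemma hmap_bvec: "j < 2 * n \<Longrightarrow> hmap n b (bvec j) = hpoly n b j"
proof -
  assume j: "j < 2 * n"
  have "hmap n b (bvec j) = (\<Sum>i<2*n. if i = j then hpoly n b i else 0)"
    unfolding hmap_def by (rule sum.cong) (auto simp: bvec_def)
  then show ?thesis using j by simp
qed

lemma hmap_cong: assumes "vcong (2*n) p x y" shows "congm p f (hmap n b x) (hmap n b y)"
proof -
  have "congm p f (\<Sum>j<2*n. [:x j:] * hpoly n b j) (\<Sum>j<2*n. [:y j:] * hpoly n b j)"
  proof (intro congm_sum congm_mult congm_refl congm_const)
    fix j assume "j \<in> {..<2*n}"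
    then show "[:int p:] dvd [:x j:] - [:y j:]" using assms by (simp add: vcong_def cong_iff_dvd_diff)
  qed
  then show ?thesis by (simp add: hmap_def)
qed

lemma hmap_companion: assumes "n \<ge> 1"
  shows "congm p (hpoly n b (2 * n)) (hmap n b (act (2*n) (companion n b) x)) (XX * hmap n b x)"
proof -
  let ?f = "hpoly n b (2 * n)"
  have "hmap n b (act (2*n) (companion n b) x) = (\<Sum>i<2*n. \<Sum>j<2*n. smult (x j) (smult (companion n b $$ (i, j)) (hpoly n b i)))"
    unfolding hmap_def by (intro sum.cong refl) (simp add: act_def smult_sum mult.commute)
  also have "\<dots> = (\<Sum>j<2*n. smult (x j) (\<Sum>i<2*n. smult (companion n b $$ (i, j)) (hpoly n b i)))"
    by (subst sum.swap) (simp add: smult_sum2)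
  also have "\<dots> = (\<Sum>j<2*n. [:x j:] * (XX * hpoly n b j - (if Suc j = 2 * n then ?f else 0)))"
    using hpoly_relation[OF assms] by simp
  also have "congm p ?f \<dots> (\<Sum>j<2*n. [:x j:] * (XX * hpoly n b j))"
    by (intro congm_sum congm_mult congm_refl) (auto simp: congm_def)
  also have "(\<Sum>j<2*n. [:x j:] * (XX * hpoly n b j)) = XX * hmap n b x"
    unfolding hmap_def sum_distrib_left by (intro sum.cong) (auto simp: mult_ac)
  finally show ?thesis .
qed

text \<open>The polynomials \<open>hpoly n b j\<close> are monic of degree \<open>j\<close>, so the largest index at which \<open>x\<close> is nonzero modulo
\<open>p\<close> gives a coefficient that is nonzero modulo \<open>p\<close>.\<close>

lemma hmap_inj:
  assumes p: "p > 0" and R: "dvdm p (hpoly n b (2 * n)) (hmap n b x)"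
  shows "vcong (2*n) p x (\<lambda>_. 0)"
proof (rule ccontr)
  have f: "degree (hpoly n b (2 * n)) = 2 * n" "lead_coeff (hpoly n b (2 * n)) = 1" using hpoly_monic by blast+
  have "coeff (hmap n b x) i = 0" if "i \<ge> 2 * n" for i
    using that hpoly_monic by (simp add: hmap_def coeff_sum coeff_eq_0)
  then have pd: "int p dvd coeff (hmap n b x) i" for i
    using dvdm_low_degree[OF p f(2) R] f(1) by (simp add: const_dvd_coeff)
  assume "\<not> ?thesis"
  then have ne: "{j. j < 2 * n \<and> \<not> int p dvd x j} \<noteq> {}" (is "?S \<noteq> {}")
    by (auto simp: vcong_def cong_0_iff)
  have fin: "finite ?S" by simp
  define j where "j = Max ?S"
  have j: "j < 2 * n" "\<not> int p dvd x j" using Max_in[OF fin ne] by (auto simp: j_def)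
  have mx: "int p dvd x i" if "i > j" "i < 2 * n" for i
    using that Max_ge[OF fin, of i] unfolding j_def by fastforce
  have "coeff (hmap n b x) j = (\<Sum>i<2*n. x i * coeff (hpoly n b i) j)" by (simp add: hmap_def coeff_sum)
  also have "\<dots> = x j * coeff (hpoly n b j) j + (\<Sum>i\<in>{..<2*n} - {j}. x i * coeff (hpoly n b i) j)"
    using j by (intro sum.remove) auto
  finally have "x j = coeff (hmap n b x) j - (\<Sum>i\<in>{..<2*n} - {j}. x i * coeff (hpoly n b i) j)"
    using hpoly_monic[of n b j] by auto
  moreover have "int p dvd (\<Sum>i\<in>{..<2*n} - {j}. x i * coeff (hpoly n b i) j)"
  proof (rule dvd_sum)
    fix i assume i: "i \<in> {..<2*n} - {j}"
    show "int p dvd x i * coeff (hpoly n b i) j"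
    proof (cases "i > j")
      case True then show ?thesis using mx i by auto
    next
      case False
      then have "coeff (hpoly n b i) j = 0" using i hpoly_monic[of n b i] by (intro coeff_eq_0) auto
      then show ?thesis by simp
    qed
  qed
  ultimately have "int p dvd x j" using pd by (metis dvd_diff)
  then show False using j by simp
qed

lemma hmap_inj': assumes "p > 0" "congm p (hpoly n b (2 * n)) (hmap n b x) (hmap n b y)" shows "vcong (2*n) p x y"
proof -
  have "hmap n b (\<lambda>i. x i + (-1) * y i) = hmap n b x - hmap n b y"
    unfolding hmap_add hmap_smult by (simp add: one_pCons[symmetric])
  then have "vcong (2*n) p (\<lambda>i. x i + (-1) * y i) (\<lambda>_. 0)"
    using assms by (intro hmap_inj[of p n b]) (auto simp: congm_def)
  then show ?thesis by (simp add: vcong_def cong_iff_dvd_diff)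
qed

text \<open>Transported by \<open>hmap\<close>, a matrix that commutes with the companion matrix becomes an endomorphism of the
cyclic module \<open>\<int>[x]/(p, f)\<close>, that is, the multiplication by the image of \<open>1\<close>.\<close>

lemma centralizer_is_multiplication:
  assumes n: "n \<ge> 1" and M: "M \<in> carrier_mat (2*n) (2*n)" and comm: "mcong (2*n) p (M * companion n b) (companion n b * M)"
  shows "congm p (hpoly n b (2*n)) (hmap n b (act (2*n) M x)) (hmap n b (act (2*n) M (bvec 0)) * hmap n b x)"
proof -
  let ?f = "hpoly n b (2*n)" and ?C = "companion n b" and ?d = "2*n"
  let ?m = "\<lambda>j. hmap n b (act ?d M (bvec j))"
  have lin: "hmap n b (act ?d M x) = (\<Sum>j<?d. [:x j:] * ?m j)" for x
  proof -
    have "hmap n b (act ?d M x) = (\<Sum>i<?d. \<Sum>j<?d. smult (x j) (smult (M $$ (i, j)) (hpoly n b i)))"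
      unfolding hmap_def by (intro sum.cong refl) (simp add: act_def smult_sum mult.commute)
    also have "\<dots> = (\<Sum>j<?d. \<Sum>i<?d. smult (x j) (smult (M $$ (i, j)) (hpoly n b i)))" by (rule sum.swap)
    also have "\<dots> = (\<Sum>j<?d. [:x j:] * ?m j)"
      by (intro sum.cong refl) (simp add: hmap_def act_bvec smult_sum2)
    finally show ?thesis .
  qed
  have rec: "congm p ?f (XX * ?m j) (\<Sum>i<?d. [:?C $$ (i, j):] * ?m i)" if j: "j < ?d" for j
  proof -
    have "congm p ?f (XX * ?m j) (hmap n b (act ?d ?C (act ?d M (bvec j))))"
      by (rule congm_sym[OF hmap_companion[OF n]])
    also have "congm p ?f \<dots> (hmap n b (act ?d M (act ?d ?C (bvec j))))"
    proof (rule hmap_cong)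
      have "vcong ?d p (act ?d (?C * M) (bvec j)) (act ?d (M * ?C) (bvec j))"
        by (rule vcong_act[OF mcong_sym[OF comm] vcong_refl])
      then show "vcong ?d p (act ?d ?C (act ?d M (bvec j))) (act ?d M (act ?d ?C (bvec j)))"
        by (simp add: act_mult[OF companion_carrier M] act_mult[OF M companion_carrier])
    qed
    also have "hmap n b (act ?d M (act ?d ?C (bvec j))) = (\<Sum>i<?d. [:?C $$ (i, j):] * ?m i)"
      unfolding lin[of "act ?d ?C (bvec j)"] by (intro sum.cong refl) (simp add: act_bvec j)
    finally show ?thesis .
  qed
  have hpoly_rec: "congm p ?f (XX * hpoly n b j) (\<Sum>i<?d. [:?C $$ (i, j):] * hpoly n b i)" if j: "j < ?d" for j
  proof -
    have "(\<Sum>i<?d. [:?C $$ (i, j):] * hpoly n b i) = XX * hpoly n b j - (if Suc j = ?d then ?f else 0)"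
      using hpoly_relation[OF n j, of b] by (simp only: smult_conv_const_mult)
    then have "XX * hpoly n b j - (\<Sum>i<?d. [:?C $$ (i, j):] * hpoly n b i) = (if Suc j = ?d then ?f else 0)"
      by (simp only: diff_diff_eq2 add_diff_cancel_left')
    then show ?thesis unfolding congm_def by (simp only: split: if_split) simp
  qed
  have key: "j < ?d \<Longrightarrow> congm p ?f (?m j) (?m 0 * hpoly n b j)" for j
  proof (induction j rule: less_induct)
    case (less j)
    show ?case
    proof (cases j)
      case 0 then show ?thesis by simp
    next
      case (Suc k)
      have k: "k < ?d" using less.prems Suc by simp
      have spl: "(\<Sum>i<?d. [:?C $$ (i, k):] * g i) = g j + (\<Sum>i\<le>k. [:?C $$ (i, k):] * g i)" for g :: "nat \<Rightarrow> int poly"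
      proof -
        have "(\<Sum>i<?d. [:?C $$ (i, k):] * g i) = (\<Sum>i\<le>Suc k. [:?C $$ (i, k):] * g i)"
        proof (intro sum.mono_neutral_right ballI)
          show "{..Suc k} \<subseteq> {..<?d}" using less.prems Suc by auto
          fix i assume "i \<in> {..<?d} - {..Suc k}"
          then have "?C $$ (i, k) = 0" using n k by (auto simp: companion_def companion_col_def)
          then show "[:?C $$ (i, k):] * g i = 0" by simp
        qed simp
        also have "\<dots> = [:?C $$ (j, k):] * g j + (\<Sum>i\<le>k. [:?C $$ (i, k):] * g i)" by (simp add: Suc)
        also have "?C $$ (j, k) = 1" using less.prems Suc by (simp add: companion_def)
        finally show ?thesis by simp
      qed
      let ?S = "\<lambda>g. \<Sum>i\<le>k. [:?C $$ (i, k):] * g i"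
      have S: "congm p ?f (?S ?m) (?S (\<lambda>i. ?m 0 * hpoly n b i))"
        using less.IH less.prems Suc by (intro congm_sum congm_mult congm_refl) auto
      have "congm p ?f (?m j + ?S ?m) (XX * ?m k)" using congm_sym[OF rec[OF k]] unfolding spl .
      also have "congm p ?f (XX * ?m k) (XX * (?m 0 * hpoly n b k))"
        using less.IH[of k] k Suc by (intro congm_mult congm_refl) auto
      also have "XX * (?m 0 * hpoly n b k) = ?m 0 * (XX * hpoly n b k)" by (simp only: mult_ac)
      also have "congm p ?f \<dots> (?m 0 * (hpoly n b j + ?S (hpoly n b)))"
        using hpoly_rec[OF k] unfolding spl by (intro congm_mult congm_refl)
      also have "?m 0 * (hpoly n b j + ?S (hpoly n b)) = ?m 0 * hpoly n b j + ?S (\<lambda>i. ?m 0 * hpoly n b i)"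
        by (simp only: distrib_left sum_distrib_left mult_ac)
      finally have "congm p ?f (?m j + ?S ?m) (?m 0 * hpoly n b j + ?S (\<lambda>i. ?m 0 * hpoly n b i))" .
      then show ?thesis using S by (rule congm_add_cancel)
    qed
  qed
  have "congm p ?f (hmap n b (act ?d M x)) (\<Sum>j<?d. [:x j:] * (?m 0 * hpoly n b j))"
    unfolding lin[of x] using key by (intro congm_sum congm_mult congm_refl) auto
  also have "(\<Sum>j<?d. [:x j:] * (?m 0 * hpoly n b j)) = ?m 0 * hmap n b x"
    unfolding hmap_def sum_distrib_left by (intro sum.cong) (auto simp: mult_ac)
  finally show ?thesis .
qed

text \<open>Taking adjoints with respect to the form is a ring homomorphism on the polynomials in the companion
matrix \<open>C\<close>, and it sends \<open>C\<close> to its inverse. In \<open>\<int>[x]/(p, f)\<close> the inverse of \<open>x\<close> is \<open>x\<^bsup>p^k\<^esup>\<close>, and the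
Frobenius power \<open>u \<mapsto> u\<^bsup>p^k\<^esup>\<close> is a ring homomorphism with the same value at \<open>x\<close>, so the two agree.\<close>

lemma mult_operator_with_adjoint:
  assumes n: "n \<ge> 1" and bn: "b n = -1" and p: "prime p"
    and f: "dvdm p (hpoly n b (2*n)) (XX ^ (p ^ k + 1) - 1)"
  shows "\<exists>F F'. (\<forall>x y. omega n (F x) y = omega n x (F' y)) \<and>
    (\<forall>x. congm p (hpoly n b (2*n)) (hmap n b (F x)) (u * hmap n b x)) \<and>
    (\<forall>x. congm p (hpoly n b (2*n)) (hmap n b (F' x)) (u ^ (p ^ k) * hmap n b x))"
proof (induction u)
  let ?f = "hpoly n b (2*n)"
  case 0
  have z: "hmap n b (\<lambda>_. 0) = 0" by (simp add: hmap_def)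
  have "(0::int poly) ^ (p ^ k) = 0" using prime_gt_0_nat[OF p] by (simp add: zero_power)
  then have "congm p ?f (hmap n b (\<lambda>_. 0)) (0 ^ (p ^ k) * hmap n b x)" for x
    by (simp only: z mult_zero_left congm_refl)
  moreover have "congm p ?f (hmap n b (\<lambda>_. 0)) (0 * hmap n b x)" for x
    by (simp only: z mult_zero_left congm_refl)
  ultimately show ?case by (intro exI[of _ "\<lambda>x _. 0"]) (simp add: omega_def)
next
  let ?f = "hpoly n b (2*n)" and ?C = "act (2*n) (companion n b)" and ?D = "act (2*n) (inv\<^bsub>Sp n\<^esub> (companion n b))" and ?q = "p ^ k"
  case (pCons c u)
  note CS = companion_Sp[of n b, OF n bn]
  obtain F F' where F: "\<And>x y. omega n (F x) y = omega n x (F' y)"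
      "\<And>x. congm p ?f (hmap n b (F x)) (u * hmap n b x)" "\<And>x. congm p ?f (hmap n b (F' x)) (u ^ ?q * hmap n b x)"
    using pCons.IH by blast
  have D: "congm p ?f (hmap n b (?D x)) (XX ^ ?q * hmap n b x)" for x
  proof -
    have "hmap n b x = hmap n b (?C (?D x))" by (rule hmap_ext) (simp add: Sp_act_inv(2)[OF CS])
    then have "congm p ?f (XX ^ ?q * hmap n b x) (XX ^ ?q * hmap n b (?C (?D x)))"
      by (simp only: congm_refl)
    also have "congm p ?f \<dots> (XX ^ ?q * (XX * hmap n b (?D x)))"
      by (intro congm_mult congm_refl hmap_companion[OF n])
    also have "XX ^ ?q * (XX * hmap n b (?D x)) = XX ^ (?q + 1) * hmap n b (?D x)"
      by (simp only: power_add power_one_right mult_ac)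
    also have "congm p ?f \<dots> (1 * hmap n b (?D x))"
      using f by (intro congm_mult congm_refl) (simp only: congm_def)
    finally show ?thesis by (metis congm_sym mult_1)
  qed
  let ?G = "\<lambda>x i. c * x i + ?C (F x) i" and ?G' = "\<lambda>x i. c * x i + F' (?D x) i"
  have e: "pCons c u = [:c:] + XX * u" by simp
  have GG': "omega n (?G x) y = omega n x (?G' y)" for x y
    unfolding omega_add_left omega_add_right omega_smult_left omega_smult_right omega_inv[OF CS] F(1) ..
  have G: "congm p ?f (hmap n b (?G x)) (pCons c u * hmap n b x)" for x
  proof -
    have "congm p ?f (hmap n b (?C (F x))) (XX * hmap n b (F x))" by (rule hmap_companion[OF n])
    also have "congm p ?f \<dots> (XX * (u * hmap n b x))" by (intro congm_mult congm_refl F(2))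
    finally have "congm p ?f ([:c:] * hmap n b x + hmap n b (?C (F x))) ([:c:] * hmap n b x + XX * (u * hmap n b x))"
      by (intro congm_add congm_refl)
    then show ?thesis unfolding hmap_add hmap_smult e by (simp only: distrib_right mult.assoc)
  qed
  have G': "congm p ?f (hmap n b (?G' x)) (pCons c u ^ ?q * hmap n b x)" for x
  proof -
    have "congm p ?f (hmap n b (F' (?D x))) (u ^ ?q * hmap n b (?D x))" by (rule F(3))
    also have "congm p ?f \<dots> (u ^ ?q * (XX ^ ?q * hmap n b x))" by (intro congm_mult congm_refl D)
    finally have 1: "congm p ?f ([:c:] * hmap n b x + hmap n b (F' (?D x))) ([:c:] * hmap n b x + u ^ ?q * (XX ^ ?q * hmap n b x))"
      by (intro congm_add congm_refl)
    have "congm p ?f ((pCons c u) ^ ?q) ([:c:] ^ ?q + (XX * u) ^ ?q)"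
      unfolding e by (rule congm_zero_imp[OF frobenius_add_pow[OF p]])
    also have "congm p ?f \<dots> ([:c:] + (XX * u) ^ ?q)"
    proof (intro congm_add congm_refl congm_const)
      show "[:int p:] dvd [:c:] ^ ?q - [:c:]"
        using fermat_int[OF p, of c k] by (simp add: poly_const_pow cong_iff_dvd_diff)
    qed
    finally have "congm p ?f ((pCons c u) ^ ?q * hmap n b x) (([:c:] + (XX * u) ^ ?q) * hmap n b x)"
      by (intro congm_mult congm_refl)
    also have "([:c:] + (XX * u) ^ ?q) * hmap n b x = [:c:] * hmap n b x + u ^ ?q * (XX ^ ?q * hmap n b x)"
      by (simp only: distrib_right power_mult_distrib) (simp only: mult_ac)
    finally show ?thesis unfolding hmap_add hmap_smult using congm_trans[OF 1 congm_sym] by blast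
  qed
  show ?case by (rule exI[of _ ?G], rule exI[of _ ?G']) (intro conjI allI GG' G G')
qed

text \<open>A symplectic matrix in the centralizer is multiplication by some \<open>u\<close>, and its inverse is its adjoint,
which is multiplication by \<open>u\<^bsup>p^k\<^esup>\<close>. Hence \<open>u\<^bsup>p^k + 1\<^esup> = 1\<close> in the residue field.\<close>

lemma card_centralizer_le:
  assumes n: "n \<ge> 1" and bn: "b n = -1" and p: "prime p" and fp: "primem p (hpoly n b (2*n))"
    and f: "dvdm p (hpoly n b (2*n)) (XX ^ (p ^ k + 1) - 1)"
    and S: "\<And>M. M \<in> S \<Longrightarrow> M \<in> carrier (Sp n) \<and> mcong (2*n) p (M * companion n b) (companion n b * M)"
    and inc: "\<And>M M'. M \<in> S \<Longrightarrow> M' \<in> S \<Longrightarrow> mcong (2*n) p M M' \<Longrightarrow> M = M'"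
  shows "finite S" "card S \<le> p ^ k + 1"
proof -
  let ?f = "hpoly n b (2*n)" and ?d = "2*n" and ?q = "p ^ k"
  note p0 = prime_gt_0_nat[OF p]
  define U where "U = (\<lambda>M. hmap n b (act ?d M (bvec 0)))"
  have mult: "congm p ?f (hmap n b (act ?d M x)) (U M * hmap n b x)" if "M \<in> S" for M x
    unfolding U_def using S[OF that] SpD(1) by (intro centralizer_is_multiplication[OF n]) auto
  have root: "congm p ?f (U M ^ (?q + 1)) 1" if MS: "M \<in> S" for M
  proof -
    have M: "M \<in> carrier (Sp n)" using S[OF MS] by simp
    let ?N = "act ?d (inv\<^bsub>Sp n\<^esub> M)"
    obtain F F' where F: "\<And>x y. omega n (F x) y = omega n x (F' y)"
        "\<And>x. congm p ?f (hmap n b (F x)) (U M * hmap n b x)" "\<And>x. congm p ?f (hmap n b (F' x)) (U M ^ ?q * hmap n b x)"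
      using mult_operator_with_adjoint[of n b, OF n bn p f, of "U M"] by blast
    have FM: "vcong ?d p (F x) (act ?d M x)" for x
      using F(2)[of x] congm_sym[OF mult[OF MS, of x]] congm_trans by (intro hmap_inj'[OF p0]) blast
    have "vcong ?d p (F' y) (?N y)" for y
    proof (rule omega_nondegenerate_cong)
      fix x
      have "[omega n (F x) y = omega n (act ?d M x) y] (mod (int p))" by (rule omega_cong[OF FM vcong_refl])
      then show "[omega n x (F' y) = omega n x (?N y)] (mod (int p))" unfolding F(1) omega_inv[OF M] .
    qed
    then have N: "congm p ?f (hmap n b (?N y)) (U M ^ ?q * hmap n b y)" for y
      using congm_trans[OF congm_sym[OF hmap_cong] F(3)] by blast
    have R0: "hmap n b (bvec 0) = 1" using n by (simp add: hmap_bvec)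
    have "hmap n b (bvec 0) = hmap n b (?N (act ?d M (bvec 0)))"
      by (rule hmap_ext) (simp add: Sp_act_inv(1)[OF M])
    then have "congm p ?f (hmap n b (bvec 0)) (hmap n b (?N (act ?d M (bvec 0))))" by (simp only: congm_refl)
    also have "congm p ?f \<dots> (U M ^ ?q * hmap n b (act ?d M (bvec 0)))" by (rule N)
    also have "congm p ?f \<dots> (U M ^ ?q * (U M * hmap n b (bvec 0)))" by (intro congm_mult congm_refl mult[OF MS])
    also have "U M ^ ?q * (U M * hmap n b (bvec 0)) = U M ^ (?q + 1)"
      by (simp only: R0 power_add power_one_right mult_1_right)
    finally show ?thesis unfolding R0 by (rule congm_sym)
  qed
  have injU: "M = M'" if "M \<in> S" "M' \<in> S" "congm p ?f (U M) (U M')" for M M'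
  proof (rule inc[OF that(1,2)], rule mcongI)
    fix j
    have "congm p ?f (hmap n b (act ?d M (bvec j))) (U M * hmap n b (bvec j))" by (rule mult[OF that(1)])
    also have "congm p ?f \<dots> (U M' * hmap n b (bvec j))" by (intro congm_mult congm_refl that(3))
    also have "congm p ?f \<dots> (hmap n b (act ?d M' (bvec j)))" by (rule congm_sym[OF mult[OF that(2)]])
    finally show "vcong ?d p (act ?d M (bvec j)) (act ?d M' (bvec j))" by (rule hmap_inj'[OF p0])
  qed
  have q: "0 < ?q + 1" by simp
  show "finite S"
    by (rule card_roots_of_unity(1)[where U = U and m = "?q + 1" and S = S, OF p fp q])
      (rule root, assumption, rule injU, assumption+)
  show "card S \<le> ?q + 1"
    by (rule card_roots_of_unity(2)[where U = U and m = "?q + 1" and S = S, OF p fp q])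
      (rule root, assumption, rule injU, assumption+)
qed

section \<open>Transvections generate Sp modulo p\<close>

lemma omega_diff_right: "omega n x (\<lambda>i. y i - z i) = omega n x y - omega n x z"
  by (simp add: omega_def sum_subtractf[symmetric] algebra_simps)

lemma omega_expand_left: "omega n x v = (\<Sum>j<2*n. x j * omega n (bvec j) v)"
proof -
  have "omega n x v = omega n (\<lambda>i. \<Sum>j<2*n. x j * bvec j i) v"
  proof (rule omega_ext)
    fix i assume "i < 2 * n"
    then show "x i = (\<Sum>j<2*n. x j * bvec j i)"
      by (simp add: bvec_def if_distrib[of "\<lambda>c. _ * c"] cong: if_cong)
  qed simp
  then show ?thesis by (simp add: omega_sum_left omega_smult_left)
qed

text \<open>The transvection \<open>x \<mapsto> x + a \<omega>(x, v) v\<close>.\<close>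

definition transv :: "nat \<Rightarrow> (nat \<Rightarrow> int) \<Rightarrow> int \<Rightarrow> int mat" where
  "transv n v a = mat (2 * n) (2 * n) (\<lambda>(i, j). (if i = j then 1 else 0) + a * omega n (bvec j) v * v i)"

lemma transv_carrier [simp]: "transv n v a \<in> carrier_mat (2 * n) (2 * n)"
  by (simp add: transv_def)

lemma act_transv: "i < 2 * n \<Longrightarrow> act (2 * n) (transv n v a) x i = x i + a * omega n x v * v i"
proof -
  assume i: "i < 2 * n"
  have "act (2 * n) (transv n v a) x i = (\<Sum>j<2*n. (if i = j then x j else 0) + a * v i * (x j * omega n (bvec j) v))"
    unfolding act_def if_P[OF i] using i by (intro sum.cong) (auto simp: transv_def algebra_simps)
  also have "\<dots> = x i + a * v i * omega n x v"
    using i unfolding sum.distrib sum_distrib_left[symmetric] omega_expand_left[of n x v] by simp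
  finally show ?thesis by simp
qed

lemma transv_Sp: "transv n v a \<in> carrier (Sp n)"
  unfolding Sp_iff
proof (intro conjI allI)
  fix x y
  have "omega n (act (2*n) (transv n v a) x) (act (2*n) (transv n v a) y) =
    omega n (\<lambda>i. x i + (a * omega n x v) * v i) (\<lambda>i. y i + (a * omega n y v) * v i)"
    by (intro omega_ext act_transv)
  also have "\<dots> = omega n x y"
    unfolding omega_add_left omega_add_right omega_smult_left omega_smult_right
    using omega_skew[of n v y] by simp
  finally show "omega n (act (2*n) (transv n v a) x) (act (2*n) (transv n v a) y) = omega n x y" .
qed simp

lemma Sp_assoc:
  assumes "A \<in> carrier (Sp n)" "B \<in> carrier (Sp n)" "C \<in> carrier (Sp n)"
  shows "A * B * C = A * (B * C)"
  using assms SpD(1) assoc_mult_mat by blast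

lemma Sp_one [simp]: "1\<^sub>m (2 * n) \<in> carrier (Sp n)"
  using group.is_monoid[OF group_Sp, of n] monoid.one_closed by fastforce

lemma Sp_mult_one [simp]: "A \<in> carrier (Sp n) \<Longrightarrow> A * 1\<^sub>m (2 * n) = A" "A \<in> carrier (Sp n) \<Longrightarrow> 1\<^sub>m (2 * n) * A = A"
  using SpD(1) by (metis right_mult_one_mat, metis left_mult_one_mat)

lemma mcong_Sp_mult:
  assumes "A \<in> carrier (Sp n)" "B \<in> carrier (Sp n)" "A' \<in> carrier (Sp n)" "B' \<in> carrier (Sp n)"
    and "mcong (2*n) m A A'" "mcong (2*n) m B B'"
  shows "mcong (2*n) m (A * B) (A' * B')"
  using assms SpD(1) by (intro mcong_mult) auto

lemma mcong_Sp_cancel: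
  assumes A: "A \<in> carrier (Sp n)" and B: "B \<in> carrier (Sp n)" and C: "C \<in> carrier (Sp n)"
    and m: "mcong (2*n) m (A * C) (B * C)"
  shows "mcong (2*n) m A B"
proof -
  have "mcong (2*n) m (A * C * inv\<^bsub>Sp n\<^esub> C) (B * C * inv\<^bsub>Sp n\<^esub> C)"
    by (intro mcong_Sp_mult Sp_mult_closed A B C Sp_inv(1) m mcong_refl)
  then show ?thesis using A B C by (simp add: Sp_assoc Sp_inv)
qed

lemma mcong_Sp_inv:
  assumes A: "A \<in> carrier (Sp n)" and B: "B \<in> carrier (Sp n)" and m: "mcong (2*n) m A B"
  shows "mcong (2*n) m (inv\<^bsub>Sp n\<^esub> A) (inv\<^bsub>Sp n\<^esub> B)"
proof (rule mcong_Sp_cancel[OF Sp_inv(1)[OF A] Sp_inv(1)[OF B] A])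
  have "mcong (2*n) m (inv\<^bsub>Sp n\<^esub> B * B) (inv\<^bsub>Sp n\<^esub> B * A)"
    by (intro mcong_Sp_mult Sp_inv(1) A B mcong_refl mcong_sym[OF m])
  then show "mcong (2*n) m (inv\<^bsub>Sp n\<^esub> A * A) (inv\<^bsub>Sp n\<^esub> B * A)" by (simp add: Sp_inv A B)
qed

lemma Sp_inv_one [simp]: "inv\<^bsub>Sp n\<^esub> (1\<^sub>m (2*n)) = 1\<^sub>m (2*n)"
  using monoid.inv_one[OF group.is_monoid[OF group_Sp], of n] by simp

text \<open>The set \<open>S\<close> is the preimage of a group of residues modulo \<open>p\<close> that contains all transvections. It will be
shown to be everything.\<close>

locale transvections =
  fixes n p :: nat and S :: "int mat set"
  assumes p: "prime p" and sub: "subgroup S (Sp n)"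
    and closed: "\<And>A B. A \<in> S \<Longrightarrow> B \<in> carrier (Sp n) \<Longrightarrow> mcong (2*n) p A B \<Longrightarrow> B \<in> S"
    and transv: "\<And>v a. transv n v a \<in> S"
begin

lemma SSp: "A \<in> S \<Longrightarrow> A \<in> carrier (Sp n)" using subgroup.mem_carrier[OF sub] .
lemma S_mult: "A \<in> S \<Longrightarrow> B \<in> S \<Longrightarrow> A * B \<in> S" using subgroup.m_closed[OF sub] by simp
lemma S_inv: "A \<in> S \<Longrightarrow> inv\<^bsub>Sp n\<^esub> A \<in> S" using subgroup.m_inv_closed[OF sub] .

definition moves :: "(nat \<Rightarrow> int) set \<Rightarrow> (nat \<Rightarrow> int) \<Rightarrow> (nat \<Rightarrow> int) \<Rightarrow> bool" where
  "moves F x y \<longleftrightarrow> (\<exists>h\<in>S. vcong (2*n) p (act (2*n) h x) y \<and> (\<forall>w\<in>F. vcong (2*n) p (act (2*n) h w) w))"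

lemma moves_trans: assumes "moves F x y" "moves F y z" shows "moves F x z"
proof -
  from assms obtain h k where h: "h \<in> S" "vcong (2*n) p (act (2*n) h x) y" "\<forall>w\<in>F. vcong (2*n) p (act (2*n) h w) w"
    and k: "k \<in> S" "vcong (2*n) p (act (2*n) k y) z" "\<forall>w\<in>F. vcong (2*n) p (act (2*n) k w) w"
    unfolding moves_def by blast
  have a: "act (2*n) (k * h) w = act (2*n) k (act (2*n) h w)" for w
    using h(1) k(1) SSp SpD(1) by (intro act_mult) auto
  have "vcong (2*n) p (act (2*n) (k * h) x) z"
    unfolding a using vcong_act[OF mcong_refl h(2)] k(2) by (rule vcong_trans)
  moreover have "vcong (2*n) p (act (2*n) (k * h) w) w" if "w \<in> F" for w
  proof -
    have "vcong (2*n) p (act (2*n) k (act (2*n) h w)) (act (2*n) k w)"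
      using that h(3) by (intro vcong_act mcong_refl) blast
    also have "vcong (2*n) p \<dots> w" using that k(3) by blast
    finally show ?thesis unfolding a .
  qed
  ultimately show ?thesis unfolding moves_def using S_mult[OF k(1) h(1)] by blast
qed

text \<open>If \<open>a \<omega>(x, y) = 1\<close>, then the transvection along \<open>y - x\<close> with parameter \<open>a\<close> maps \<open>x\<close> to \<open>y\<close>. It fixes all
vectors that are orthogonal to \<open>y - x\<close>.\<close>

lemma moves_single:
  assumes xy: "\<not> int p dvd omega n x y" and F: "\<And>w. w \<in> F \<Longrightarrow> [omega n w y = omega n w x] (mod (int p))"
  shows "moves F x y"
proof -
  have "coprime (omega n x y) (int p)"
    using xy p by (metis coprime_commute prime_imp_coprime prime_nat_int_transfer)
  then obtain a where a: "[omega n x y * a = 1] (mod (int p))" using cong_solve_coprime_int by blast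
  let ?v = "\<lambda>i. y i - x i"
  let ?T = "transv n ?v a"
  have "vcong (2*n) p (act (2*n) ?T x) y"
    unfolding vcong_def
  proof (intro allI impI)
    fix i assume i: "i < 2 * n"
    have "act (2*n) ?T x i = x i + (omega n x y * a) * (y i - x i)"
      unfolding act_transv[OF i] omega_diff_right by simp
    also have "[\<dots> = x i + 1 * (y i - x i)] (mod (int p))"
      by (intro cong_add cong_mult cong_refl a)
    finally show "[act (2*n) ?T x i = y i] (mod (int p))" by simp
  qed
  moreover have "vcong (2*n) p (act (2*n) ?T w) w" if w: "w \<in> F" for w
    unfolding vcong_def
  proof (intro allI impI)
    fix i assume i: "i < 2 * n"
    have "[omega n w ?v = 0] (mod (int p))"
      unfolding omega_diff_right using F[OF w] by (simp add: cong_iff_dvd_diff)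
    then have "[w i + a * omega n w ?v * ?v i = w i + a * 0 * ?v i] (mod (int p))"
      by (intro cong_add cong_mult cong_refl)
    then show "[act (2*n) ?T w i = w i] (mod (int p))" unfolding act_transv[OF i] by simp
  qed
  ultimately show ?thesis unfolding moves_def using transv by blast
qed

lemma not_dvd_cong_1: "[a = 1] (mod (int p)) \<Longrightarrow> \<not> int p dvd a" "[a = - 1] (mod (int p)) \<Longrightarrow> \<not> int p dvd a"
  using p by (auto simp: cong_dvd_iff)

text \<open>If \<open>x\<close> and \<open>y\<close> are orthogonal, one passes through a vector that is orthogonal to neither of them; one of
\<open>y'\<close>, \<open>x'\<close> and \<open>x' + y'\<close> is of this kind.\<close>

lemma moves_hyperbolic:
  assumes x: "[omega n x x' = 1] (mod (int p))" and y: "[omega n y y' = 1] (mod (int p))"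
    and F: "\<And>w z. w \<in> F \<Longrightarrow> z \<in> {x, x', y, y'} \<Longrightarrow> [omega n w z = 0] (mod (int p))"
  shows "moves F x y"
proof -
  have F2: "[omega n w u = omega n w z] (mod (int p))" if "w \<in> F" "u \<in> {x, x', y, y'}" "z \<in> {x, x', y, y'}" for w u z
    using F[OF that(1,2)] F[OF that(1,3)] cong_sym cong_trans by blast
  have xx': "\<not> int p dvd omega n x x'" and yy': "\<not> int p dvd omega n y' y"
    using not_dvd_cong_1 x y omega_skew[of n y' y] by auto
  consider "\<not> int p dvd omega n x y" | "\<not> int p dvd omega n x y'" | "\<not> int p dvd omega n x' y"
    | "int p dvd omega n x y'" "int p dvd omega n x' y" by blast
  then show ?thesis
  proof cases
    case 1 then show ?thesis using F2 by (intro moves_single) auto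
  next
    case 2
    have "moves F x y'" using F2 2 by (intro moves_single) auto
    moreover have "moves F y' y" using F2 yy' by (intro moves_single) auto
    ultimately show ?thesis by (rule moves_trans)
  next
    case 3
    have "moves F x x'" using F2 xx' by (intro moves_single) auto
    moreover have "moves F x' y" using F2 3 by (intro moves_single) auto
    ultimately show ?thesis by (rule moves_trans)
  next
    case 4
    let ?z = "\<lambda>i. x' i + y' i"
    have Fz: "[omega n w ?z = 0] (mod (int p))" if "w \<in> F" for w
      unfolding omega_add_right using cong_add[OF F[OF that, of x'] F[OF that, of y']] by simp
    have Fx: "[omega n w u = 0] (mod (int p))" if "w \<in> F" "u \<in> {x, y}" for w u
      using F[OF that(1), of u] that(2) by blast
    have "\<not> int p dvd omega n x ?z" unfolding omega_add_right using 4(1) xx' by (simp add: dvd_add_left_iff)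
    then have "moves F x ?z"
      using cong_trans[OF Fz cong_sym[OF Fx]] by (intro moves_single) simp_all
    moreover have "\<not> int p dvd omega n ?z y" unfolding omega_add_left using 4(2) yy' by (simp add: dvd_add_right_iff)
    then have "moves F ?z y"
      using cong_trans[OF Fx cong_sym[OF Fz]] by (intro moves_single) simp_all
    ultimately show ?thesis by (rule moves_trans)
  qed
qed

lemma reduce_by_S:
  assumes "h \<in> S" "A \<in> carrier (Sp n)" "h * A \<in> S" shows "A \<in> S"
proof -
  have "inv\<^bsub>Sp n\<^esub> h * (h * A) \<in> S" by (intro S_mult S_inv assms)
  moreover have "inv\<^bsub>Sp n\<^esub> h * (h * A) = A"
    using Sp_assoc[of "inv\<^bsub>Sp n\<^esub> h" n h A] Sp_inv[OF SSp[OF assms(1)]] SSp[OF assms(1)] assms(2) by simp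
  ultimately show ?thesis by simp
qed

definition pairs :: "nat \<Rightarrow> (nat \<Rightarrow> int) set" where "pairs k = bvec ` {..<k} \<union> (\<lambda>i. bvec (n + i)) ` {..<k}"

lemma omega_bvec_bvec: "i < n \<Longrightarrow> j < n \<Longrightarrow> omega n (bvec i) (bvec j) = 0" "i < n \<Longrightarrow> j < n \<Longrightarrow> omega n (bvec i) (bvec (n + j)) = (if i = j then 1 else 0)"
  "i < n \<Longrightarrow> j < n \<Longrightarrow> omega n (bvec (n + i)) (bvec (n + j)) = 0" "i < n \<Longrightarrow> j < n \<Longrightarrow> omega n (bvec (n + i)) (bvec j) = (if i = j then - 1 else 0)"
  unfolding omega_bvec_right by (auto simp: bvec_def)

text \<open>Descending induction on the number \<open>k\<close> of basis pairs that are fixed. One product of transvections moves the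
image of the next \<open>e\<^sub>k\<close> back to \<open>e\<^sub>k\<close>, a second one does this for \<open>f\<^sub>k\<close> while fixing \<open>e\<^sub>k\<close>, and both fix the
earlier pairs, since all vectors involved are orthogonal to those.\<close>

lemma fixes_pairs_in_S:
  assumes "k \<le> n" "A \<in> carrier (Sp n)" "\<And>w. w \<in> pairs k \<Longrightarrow> vcong (2*n) p (act (2*n) A w) w"
  shows "A \<in> S"
  using assms
proof (induction "n - k" arbitrary: k A)
  case 0
  then have kn: "k = n" by simp
  have "mcong (2*n) p (1\<^sub>m (2*n)) A"
  proof (rule mcongI)
    fix j assume j: "j < 2 * n"
    have "bvec j \<in> pairs k"
    proof (cases "j < n")
      case True then show ?thesis by (auto simp: pairs_def kn)
    next
      case False
      then have "bvec j = bvec (n + (j - n))" "j - n < n" using j by auto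
      then show ?thesis unfolding pairs_def kn by blast
    qed
    then have "vcong (2*n) p (bvec j) (act (2*n) A (bvec j))" using "0.prems"(3) vcong_sym by blast
    moreover have "vcong (2*n) p (act (2*n) (1\<^sub>m (2*n)) (bvec j)) (bvec j)" by (simp add: vcong_def act_one)
    ultimately show "vcong (2*n) p (act (2*n) (1\<^sub>m (2*n)) (bvec j)) (act (2*n) A (bvec j))" using vcong_trans by blast
  qed
  moreover have "1\<^sub>m (2*n) \<in> S" using subgroup.one_closed[OF sub] by simp
  ultimately show ?case using closed "0.prems"(2) by blast
next
  case (Suc l)
  then have k: "k < n" by simp
  let ?e = "bvec k" and ?f = "bvec (n + k)"
  have A: "A \<in> carrier (Sp n)" by fact
  note fixA = Suc.prems(3)
  have orth: "[omega n w (act (2*n) B z) = omega n w z] (mod (int p))"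
    if "B \<in> carrier (Sp n)" "vcong (2*n) p (act (2*n) B w) w" for B w z
  proof -
    have "[omega n w (act (2*n) B z) = omega n (act (2*n) B w) (act (2*n) B z)] (mod (int p))"
      by (rule omega_cong[OF vcong_sym[OF that(2)] vcong_refl])
    then show ?thesis using SpD(2)[OF that(1)] by simp
  qed
  have pz: "omega n w ?e = 0" "omega n w ?f = 0" if "w \<in> pairs k" for w
    using that k by (auto simp: pairs_def omega_bvec_bvec)
  have ef: "omega n ?e ?f = 1" using k by (simp add: omega_bvec_bvec)
  have "moves (pairs k) (act (2*n) A ?e) ?e"
  proof (rule moves_hyperbolic[of _ "act (2*n) A ?f" _ ?f])
    show "[omega n (act (2*n) A ?e) (act (2*n) A ?f) = 1] (mod (int p))" using SpD(2)[OF A] ef by simp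
    show "[omega n ?e ?f = 1] (mod (int p))" using ef by simp
    fix w z assume w: "w \<in> pairs k" and "z \<in> {act (2*n) A ?e, act (2*n) A ?f, ?e, ?f}"
    then show "[omega n w z = 0] (mod (int p))"
      using orth[OF A fixA[OF w], of ?e] orth[OF A fixA[OF w], of ?f] pz[OF w] by auto
  qed
  then obtain h where h: "h \<in> S" "vcong (2*n) p (act (2*n) h (act (2*n) A ?e)) ?e"
    "\<And>w. w \<in> pairs k \<Longrightarrow> vcong (2*n) p (act (2*n) h w) w" unfolding moves_def by blast
  let ?B = "h * A"
  have aB: "act (2*n) ?B w = act (2*n) h (act (2*n) A w)" for w
    using h(1) SSp A SpD(1) by (intro act_mult) auto
  have B: "?B \<in> carrier (Sp n)" using Sp_mult_closed SSp h(1) A by blast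
  have fixB: "vcong (2*n) p (act (2*n) ?B w) w" if w: "w \<in> insert ?e (pairs k)" for w
  proof (cases "w = ?e")
    case True then show ?thesis using h(2) aB by simp
  next
    case False
    then have w: "w \<in> pairs k" using w by simp
    have "vcong (2*n) p (act (2*n) h (act (2*n) A w)) (act (2*n) h w)" using fixA[OF w] by (intro vcong_act mcong_refl)
    also have "vcong (2*n) p \<dots> w" by (rule h(3)[OF w])
    finally show ?thesis using aB by simp
  qed
  let ?y = "act (2*n) ?B ?f" and ?F = "insert ?e (pairs k)"
  have Fy: "[omega n w ?y = omega n w ?f] (mod (int p))" if "w \<in> ?F" for w
    by (rule orth[OF B fixB[OF that]])
  have "moves ?F ?y ?f"
  proof (cases "int p dvd omega n ?y ?f")
    case False
    then show ?thesis using Fy cong_sym by (intro moves_single) blast+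
  next
    case True
    \<comment> \<open>Passing through \<open>y + e\<^sub>k\<close> keeps all differences orthogonal to \<open>e\<^sub>k\<close>.\<close>
    let ?z = "\<lambda>i. ?y i + ?e i"
    have ye: "[omega n ?y ?e = - 1] (mod (int p))"
      using Fy[of ?e] ef omega_skew[of n ?y ?e] by (simp add: cong_minus_minus_iff)
    have Fe: "omega n w ?e = 0" if "w \<in> ?F" for w using that pz by auto
    have "moves ?F ?y ?z"
    proof (rule moves_single)
      show "\<not> int p dvd omega n ?y ?z" unfolding omega_add_right using not_dvd_cong_1(2)[OF ye] by simp
      show "[omega n w ?z = omega n w ?y] (mod (int p))" if "w \<in> ?F" for w
        unfolding omega_add_right using Fe[OF that] by simp
    qed
    moreover have "moves ?F ?z ?f"
    proof (rule moves_single)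
      show "\<not> int p dvd omega n ?z ?f" unfolding omega_add_left ef
        using True prime_gt_1_nat[OF p] by (simp add: dvd_add_right_iff)
      show "[omega n w ?f = omega n w ?z] (mod (int p))" if "w \<in> ?F" for w
        unfolding omega_add_right using Fe[OF that] Fy[OF that] by (simp add: cong_sym)
    qed
    ultimately show ?thesis by (rule moves_trans)
  qed
  then obtain h' where h': "h' \<in> S" "vcong (2*n) p (act (2*n) h' ?y) ?f"
    "\<And>w. w \<in> ?F \<Longrightarrow> vcong (2*n) p (act (2*n) h' w) w" unfolding moves_def by blast
  let ?D = "h' * ?B"
  have aD: "act (2*n) ?D w = act (2*n) h' (act (2*n) ?B w)" for w
    using h'(1) SSp B SpD(1) by (intro act_mult) auto
  have D: "?D \<in> carrier (Sp n)" using Sp_mult_closed SSp h'(1) B by blast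
  have "?D \<in> S"
  proof (rule Suc.hyps(1)[of "Suc k"])
    show "l = n - Suc k" "Suc k \<le> n" using Suc.hyps(2) k by auto
    show "?D \<in> carrier (Sp n)" by (rule D)
    fix w assume "w \<in> pairs (Suc k)"
    then consider "w = ?f" | "w \<in> ?F" by (auto simp: pairs_def lessThan_Suc)
    then show "vcong (2*n) p (act (2*n) ?D w) w"
    proof cases
      case 1 then show ?thesis using h'(2) aD by simp
    next
      case 2
      have "vcong (2*n) p (act (2*n) h' (act (2*n) ?B w)) (act (2*n) h' w)" using fixB[OF 2] by (intro vcong_act mcong_refl)
      also have "vcong (2*n) p \<dots> w" by (rule h'(3)[OF 2])
      finally show ?thesis using aD by simp
    qed
  qed
  then have "?B \<in> S" by (rule reduce_by_S[OF h'(1) B])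
  then show ?case by (rule reduce_by_S[OF h(1) A])
qed

lemma S_all: "S = carrier (Sp n)"
proof
  show "S \<subseteq> carrier (Sp n)" using SSp by blast
  show "carrier (Sp n) \<subseteq> S" by (rule subsetI, rule fixes_pairs_in_S[of 0]) (simp_all add: pairs_def)
qed

end

lemma transvections_full: "prime p \<Longrightarrow> transvections n p (carrier (Sp n))"
  by (rule transvections.intro) (auto simp: group.subgroup_self[OF group_Sp] transv_Sp)

section \<open>Perfectness and the Chinese remainder theorem\<close>

text \<open>The image of \<open>Sp(2n,\<int>)\<close> modulo \<open>m\<close> is a perfect group; subgroups of the image are represented by their
preimages, which are closed under congruence modulo \<open>m\<close>.\<close>

definition perfect_mod :: "nat \<Rightarrow> nat \<Rightarrow> bool" where
  "perfect_mod n m \<longleftrightarrow> (\<forall>H. subgroup H (Sp n) \<longrightarrow>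
     (\<forall>A\<in>H. \<forall>B\<in>carrier (Sp n). mcong (2*n) m A B \<longrightarrow> B \<in> H) \<longrightarrow>
     (\<forall>A\<in>carrier (Sp n). \<forall>B\<in>carrier (Sp n). A * B * inv\<^bsub>Sp n\<^esub> A * inv\<^bsub>Sp n\<^esub> B \<in> H) \<longrightarrow>
     H = carrier (Sp n))"

lemma perfect_mod_1: "perfect_mod n 1"
  unfolding perfect_mod_def
proof (intro allI impI)
  fix H
  assume H: "subgroup H (Sp n)" and c: "\<forall>A\<in>H. \<forall>B\<in>carrier (Sp n). mcong (2*n) 1 A B \<longrightarrow> B \<in> H"
  have "1\<^sub>m (2*n) \<in> H" using subgroup.one_closed[OF H] by simp
  moreover have "mcong (2*n) 1 (1\<^sub>m (2*n)) B" for B by (simp add: mcong_def)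
  ultimately show "H = carrier (Sp n)" using c subgroup.subset[OF H] by blast
qed

lemma mcong_coprime: assumes "coprime p M" "mcong d p A B" "mcong d M A B" shows "mcong d (p * M) A B"
  using assms unfolding mcong_def of_nat_mult
  by (simp add: coprime_cong_mult)

lemma mcong_transv:
  assumes "vcong (2*n) m v w" "[a = b] (mod (int m))"
  shows "mcong (2*n) m (transv n v a) (transv n w b)"
proof (rule mcongI)
  fix j
  show "vcong (2*n) m (act (2*n) (transv n v a) (bvec j)) (act (2*n) (transv n w b) (bvec j))"
    unfolding vcong_def
  proof (intro allI impI)
    fix i assume i: "i < 2*n"
    have "[v i = w i] (mod (int m))" using assms(1) i by (simp add: vcong_def)
    then show "[act (2*n) (transv n v a) (bvec j) i = act (2*n) (transv n w b) (bvec j) i] (mod (int m))"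
      unfolding act_transv[OF i]
      by (intro cong_add cong_mult cong_refl assms(2) omega_cong[OF vcong_refl assms(1)])
  qed
qed

lemma transv_0: "mcong (2*n) m (transv n v 0) (1\<^sub>m (2*n))"
  by (auto simp: mcong_def transv_def)

lemma Sp_cancel_inv:
  assumes "A \<in> carrier (Sp n)" "B \<in> carrier (Sp n)"
  shows "A * (inv\<^bsub>Sp n\<^esub> A * B) = B" "inv\<^bsub>Sp n\<^esub> A * (A * B) = B"
  using assms Sp_assoc[of A n "inv\<^bsub>Sp n\<^esub> A" B] Sp_assoc[of "inv\<^bsub>Sp n\<^esub> A" n A B] Sp_inv[OF assms(1)] by simp_all

lemma act_ext: "(\<And>i. i < d \<Longrightarrow> x i = y i) \<Longrightarrow> act d A x = act d A y"
  unfolding act_def by (intro ext if_cong refl sum.cong) simp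

text \<open>Conjugation by \<open>h\<close> turns the transvection with vector \<open>v\<close> and parameter \<open>a\<close> into the one with vector
\<open>h v = 2 v\<close>, that is, with vector \<open>v\<close> and parameter \<open>4 a\<close>. Parameters of transvections along the same
vector add up.\<close>

lemma commutator_transv:
  assumes h: "h \<in> carrier (Sp n)" and hv: "vcong (2*n) p (act (2*n) h v) (\<lambda>i. 2 * v i)"
  shows "mcong (2*n) p (h * transv n v a * inv\<^bsub>Sp n\<^esub> h * inv\<^bsub>Sp n\<^esub> (transv n v a)) (transv n v (3 * a))"
proof -
  let ?T = "transv n v a"
  note T = transv_Sp[of n v]
  have hT: "?T \<in> carrier (Sp n)" by (rule T)
  have C: "?T * h \<in> carrier (Sp n)" by (rule Sp_mult_closed[OF T h])
  have L: "h * ?T * inv\<^bsub>Sp n\<^esub> h * inv\<^bsub>Sp n\<^esub> ?T \<in> carrier (Sp n)"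
    by (intro Sp_mult_closed Sp_inv(1) h T)
  show ?thesis
  proof (rule mcong_Sp_cancel[OF L T C])
    have "h * ?T * inv\<^bsub>Sp n\<^esub> h * inv\<^bsub>Sp n\<^esub> ?T * (?T * h) = h * ?T"
      using h hT by (simp add: Sp_assoc[where n = n] Sp_mult_closed[where n = n] Sp_inv Sp_cancel_inv)
    moreover have "mcong (2*n) p (h * ?T) (transv n v (3 * a) * (?T * h))"
    proof (rule mcongI)
      fix j
      let ?x = "bvec j"
      show "vcong (2*n) p (act (2*n) (h * ?T) ?x) (act (2*n) (transv n v (3 * a) * (?T * h)) ?x)"
        unfolding vcong_def
      proof (intro allI impI)
        fix i assume i: "i < 2*n"
        let ?h = "act (2*n) h"
        have "act (2*n) (h * ?T) ?x = ?h (act (2*n) ?T ?x)"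
          using SpD(1)[OF h] by (intro act_mult) auto
        also have "\<dots> = ?h (\<lambda>i. ?x i + (a * omega n ?x v) * v i)"
          by (rule act_ext) (simp add: act_transv)
        finally have l: "act (2*n) (h * ?T) ?x i = ?h ?x i + a * omega n ?x v * ?h v i"
          by (simp only: act_add act_smult)
        have hvi: "[?h v i = 2 * v i] (mod (int p))" using hv i by (simp add: vcong_def)
        have "omega n ?x v = omega n (?h ?x) (?h v)" using SpD(2)[OF h] by simp
        also have "[omega n (?h ?x) (?h v) = omega n (?h ?x) (\<lambda>i. 2 * v i)] (mod (int p))" by (rule omega_cong[OF vcong_refl hv])
        finally have o: "[omega n ?x v = 2 * omega n (?h ?x) v] (mod (int p))" unfolding omega_smult_right .
        have r: "act (2*n) (transv n v (3 * a) * (?T * h)) ?x i = ?h ?x i + 4 * a * omega n (?h ?x) v * v i"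
        proof -
          have "act (2*n) (transv n v (3 * a) * (?T * h)) ?x = act (2*n) (transv n v (3 * a)) (act (2*n) ?T (?h ?x))"
            using SpD(1)[OF h] SpD(1)[OF C] by (simp add: act_mult[of _ "2*n"])
          moreover have "omega n (act (2*n) ?T (?h ?x)) v = omega n (?h ?x) v"
          proof -
            have "omega n (act (2*n) ?T (?h ?x)) v = omega n (\<lambda>i. ?h ?x i + (a * omega n (?h ?x) v) * v i) v"
              by (intro omega_ext) (simp_all add: act_transv)
            then show ?thesis unfolding omega_add_left omega_smult_left by simp
          qed
          ultimately have "act (2*n) (transv n v (3 * a) * (?T * h)) ?x i
              = ?h ?x i + a * omega n (?h ?x) v * v i + 3 * a * omega n (?h ?x) v * v i"
            by (simp only: act_transv[OF i])
          then show ?thesis by (simp add: algebra_simps)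
        qed
        have "[?h ?x i + a * omega n ?x v * ?h v i = ?h ?x i + a * (2 * omega n (?h ?x) v) * (2 * v i)] (mod (int p))"
          by (intro cong_add cong_mult cong_refl o hvi)
        then show "[act (2*n) (h * ?T) ?x i = act (2*n) (transv n v (3 * a) * (?T * h)) ?x i] (mod (int p))"
          unfolding l r by (simp add: algebra_simps)
      qed
    qed
    ultimately show "mcong (2*n) p (h * ?T * inv\<^bsub>Sp n\<^esub> h * inv\<^bsub>Sp n\<^esub> ?T * (?T * h)) (transv n v (3 * a) * (?T * h))" by simp
  qed
qed

text \<open>If \<open>w\<close> is a hyperbolic partner of \<open>v\<close>, then \<open>w / 2\<close> is one of \<open>2 v\<close>, and any two hyperbolic pairs are related
by a symplectic matrix.\<close>

lemma doubling_element:
  assumes pp: "prime p" "p \<noteq> 2" and v: "\<not> vcong (2*n) p v (\<lambda>_. 0)"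
  shows "\<exists>h\<in>carrier (Sp n). vcong (2*n) p (act (2*n) h v) (\<lambda>i. 2 * v i)"
proof -
  interpret transvections n p "carrier (Sp n)" by (rule transvections_full[OF pp(1)])
  have "\<exists>w. \<not> int p dvd omega n v w"
  proof (rule ccontr)
    assume "\<not> ?thesis"
    then have "[omega n w v = omega n w (\<lambda>_. 0)] (mod (int p))" for w
      using omega_skew[of n w v] by (simp add: cong_0_iff omega_def[of n w "\<lambda>_. 0"])
    then have "vcong (2*n) p v (\<lambda>_. 0)" by (rule omega_nondegenerate_cong)
    then show False using v by simp
  qed
  then obtain w where "\<not> int p dvd omega n v w" by blast
  then have "coprime (omega n v w) (int p)"
    using pp(1) by (metis coprime_commute prime_imp_coprime prime_nat_int_transfer)
  then obtain c where c: "[omega n v w * c = 1] (mod (int p))" using cong_solve_coprime_int by blast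
  have "coprime (2::int) (int p)"
  proof -
    have "p > 2" using pp prime_ge_2_nat[of p] by linarith
    then have "odd p" using pp(1) prime_odd_nat by blast
    then show ?thesis by simp
  qed
  then obtain e where e: "[2 * e = 1] (mod (int p))" using cong_solve_coprime_int by blast
  let ?w = "\<lambda>i. c * w i" and ?w' = "\<lambda>i. e * (c * w i)"
  have 1: "[omega n v ?w = 1] (mod (int p))" using c by (simp add: omega_smult_right mult.commute)
  have "[(2 * e) * omega n v ?w = 1 * 1] (mod (int p))" by (rule cong_mult[OF e 1])
  then have 2: "[omega n (\<lambda>i. 2 * v i) ?w' = 1] (mod (int p))"
    unfolding omega_smult_right omega_smult_left by (simp add: mult_ac)
  have "moves {} v (\<lambda>i. 2 * v i)" by (rule moves_hyperbolic[OF 1 2]) simp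
  then show ?thesis unfolding moves_def by blast
qed

lemma subgroup_of_residues:
  assumes H: "subgroup H (Sp n)"
  shows "subgroup {A \<in> carrier (Sp n). \<exists>B\<in>H. mcong (2*n) p A B \<and> mcong (2*n) M (1\<^sub>m (2*n)) B} (Sp n)"
    (is "subgroup ?S _")
proof (rule group.subgroupI[OF group_Sp])
  let ?I = "1\<^sub>m (2*n) :: int mat"
  note HSp = subgroup.mem_carrier[OF H]
  show "?S \<subseteq> carrier (Sp n)" by blast
  have "?I \<in> ?S" using subgroup.one_closed[OF H] mcong_refl by fastforce
  then show "?S \<noteq> {}" by blast
  fix X assume "X \<in> ?S"
  then obtain B where X: "X \<in> carrier (Sp n)" and B: "B \<in> H" "mcong (2*n) p X B" "mcong (2*n) M ?I B" by blast
  have "mcong (2*n) p (inv\<^bsub>Sp n\<^esub> X) (inv\<^bsub>Sp n\<^esub> B)" by (rule mcong_Sp_inv[OF X HSp[OF B(1)] B(2)])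
  moreover have "mcong (2*n) M (inv\<^bsub>Sp n\<^esub> ?I) (inv\<^bsub>Sp n\<^esub> B)" by (rule mcong_Sp_inv[OF Sp_one HSp[OF B(1)] B(3)])
  ultimately show "inv\<^bsub>Sp n\<^esub> X \<in> ?S" using Sp_inv(1)[OF X] subgroup.m_inv_closed[OF H B(1)] by auto
  fix Y assume "Y \<in> ?S"
  then obtain C where Y: "Y \<in> carrier (Sp n)" and C: "C \<in> H" "mcong (2*n) p Y C" "mcong (2*n) M ?I C" by blast
  have "mcong (2*n) p (X * Y) (B * C)" by (rule mcong_Sp_mult[OF X Y HSp[OF B(1)] HSp[OF C(1)] B(2) C(2)])
  moreover have "mcong (2*n) M (?I * ?I) (B * C)" by (rule mcong_Sp_mult[OF Sp_one Sp_one HSp[OF B(1)] HSp[OF C(1)] B(3) C(3)])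
  ultimately show "X \<otimes>\<^bsub>Sp n\<^esub> Y \<in> ?S" using subgroup.m_closed[OF H B(1) C(1)] Sp_mult_closed[OF X Y] by auto
qed

text \<open>The matrices that have such a \<open>B\<close> form a group of residues modulo \<open>p\<close>, so it is enough to treat a
transvection with parameter \<open>a\<close>. A commutator as in \<open>commutator_transv\<close>, with a parameter that is
\<open>a / 3\<close> modulo \<open>p\<close> and \<open>0\<close> modulo \<open>M\<close>, does it; the division explains why \<open>p\<close> is not \<open>3\<close>.\<close>

lemma lift_into_subgroup:
  assumes p: "prime p" "p > 3" and cop: "coprime p M"
    and H: "subgroup H (Sp n)"
    and closedH: "\<And>A B. A \<in> H \<Longrightarrow> B \<in> carrier (Sp n) \<Longrightarrow> mcong (2*n) (p * M) A B \<Longrightarrow> B \<in> H"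
    and comm: "\<And>A B. A \<in> carrier (Sp n) \<Longrightarrow> B \<in> carrier (Sp n) \<Longrightarrow> A * B * inv\<^bsub>Sp n\<^esub> A * inv\<^bsub>Sp n\<^esub> B \<in> H"
    and A: "A \<in> carrier (Sp n)"
  shows "\<exists>B\<in>H. mcong (2*n) p A B \<and> mcong (2*n) M (1\<^sub>m (2*n)) B"
proof -
  let ?I = "1\<^sub>m (2*n) :: int mat"
  have H1: "?I \<in> H" using subgroup.one_closed[OF H] by simp
  define S where "S = {A \<in> carrier (Sp n). \<exists>B\<in>H. mcong (2*n) p A B \<and> mcong (2*n) M ?I B}"
  have "transvections n p S"
  proof (rule transvections.intro)
    show "prime p" by fact
    show "subgroup S (Sp n)" unfolding S_def by (rule subgroup_of_residues[OF H])
  next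
    fix X Y assume X: "X \<in> S" "Y \<in> carrier (Sp n)" and XY: "mcong (2*n) p X Y"
    then obtain B where B: "B \<in> H" "mcong (2*n) p X B" "mcong (2*n) M ?I B" by (auto simp: S_def)
    have "mcong (2*n) p Y B" using mcong_sym[OF XY] B(2) by (rule mcong_trans)
    then show "Y \<in> S" using X(2) B by (auto simp: S_def)
  next
    fix v a
    show "transv n v a \<in> S"
    proof (cases "vcong (2*n) p v (\<lambda>_. 0)")
      case True
      have "mcong (2*n) p (transv n v a) (transv n (\<lambda>_. 0) a)" by (rule mcong_transv[OF True cong_refl])
      also have "mcong (2*n) p (transv n (\<lambda>_. 0) a) ?I" by (auto simp: mcong_def transv_def)
      finally have "mcong (2*n) p (transv n v a) ?I" .
      then show ?thesis using H1 transv_Sp by (auto simp: S_def)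
    next
      case False
      have p2: "p \<noteq> 2" using p by simp
      obtain h where h: "h \<in> carrier (Sp n)" "vcong (2*n) p (act (2*n) h v) (\<lambda>i. 2 * v i)"
        using doubling_element[OF p(1) p2 False] by blast
      have "\<not> p dvd 3" using p(2) by (auto dest: dvd_imp_le)
      then have "coprime p 3" using p(1) prime_imp_coprime by blast
      then have "coprime (3 * int M) (int p)"
        using cop by (metis coprime_commute coprime_int_iff coprime_mult_right_iff of_nat_mult of_nat_numeral)
      then obtain e where e: "[3 * int M * e = 1] (mod (int p))" using cong_solve_coprime_int by blast
      \<comment> \<open>This parameter vanishes modulo \<open>M\<close> and is \<open>a / 3\<close> modulo \<open>p\<close>.\<close>
      let ?a = "int M * (e * a)"
      have a: "[3 * ?a = a] (mod (int p))" using cong_mult[OF e cong_refl[of a]] by (simp add: mult_ac)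
      let ?T = "transv n v ?a"
      let ?B = "h * ?T * inv\<^bsub>Sp n\<^esub> h * inv\<^bsub>Sp n\<^esub> ?T"
      have "?B \<in> H" by (rule comm[OF h(1) transv_Sp])
      moreover have "mcong (2*n) p (transv n v a) ?B"
      proof -
        have "mcong (2*n) p ?B (transv n v (3 * ?a))" by (rule commutator_transv[OF h])
        also have "mcong (2*n) p (transv n v (3 * ?a)) (transv n v a)" by (rule mcong_transv[OF vcong_refl a])
        finally show ?thesis by (rule mcong_sym)
      qed
      moreover have "mcong (2*n) M ?I ?B"
      proof -
        have "[?a = 0] (mod (int M))" by (simp add: cong_0_iff)
        then have T1: "mcong (2*n) M ?T ?I" using mcong_trans[OF mcong_transv[OF vcong_refl] transv_0] by blast
        have iT: "mcong (2*n) M (inv\<^bsub>Sp n\<^esub> ?T) (inv\<^bsub>Sp n\<^esub> ?I)" by (rule mcong_Sp_inv[OF transv_Sp Sp_one T1])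
        have "mcong (2*n) M ?B (h * ?I * inv\<^bsub>Sp n\<^esub> h * inv\<^bsub>Sp n\<^esub> ?I)"
          by (intro mcong_Sp_mult Sp_mult_closed Sp_inv(1) h(1) transv_Sp Sp_one mcong_refl T1 iT)
        then have "mcong (2*n) M ?B ?I" using h(1) by (simp add: Sp_inv)
        then show ?thesis by (rule mcong_sym)
      qed
      ultimately show ?thesis using transv_Sp by (auto simp: S_def)
    qed
  qed
  then have "S = carrier (Sp n)" by (rule transvections.S_all)
  then show ?thesis using A by (auto simp: S_def)
qed

text \<open>Given \<open>A\<close>, perfectness modulo \<open>M\<close> yields an element \<open>B\<close> of \<open>H\<close> that is congruent to \<open>A\<close> modulo \<open>M\<close>, and
\<open>lift_into_subgroup\<close> corrects it modulo \<open>p\<close>.\<close>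

lemma perfect_mod_step:
  assumes p: "prime p" "p > 3" and cop: "coprime p M" and M: "perfect_mod n M"
  shows "perfect_mod n (p * M)"
  unfolding perfect_mod_def
proof (intro allI impI)
  fix H
  assume H: "subgroup H (Sp n)"
    and c: "\<forall>A\<in>H. \<forall>B\<in>carrier (Sp n). mcong (2*n) (p * M) A B \<longrightarrow> B \<in> H"
    and k: "\<forall>A\<in>carrier (Sp n). \<forall>B\<in>carrier (Sp n). A * B * inv\<^bsub>Sp n\<^esub> A * inv\<^bsub>Sp n\<^esub> B \<in> H"
  have HSp: "B \<in> carrier (Sp n)" if "B \<in> H" for B using subgroup.mem_carrier[OF H that] .
  have Hm: "B * C \<in> H" if "B \<in> H" "C \<in> H" for B C using subgroup.m_closed[OF H that] by simp
  define K where "K = {A \<in> carrier (Sp n). \<exists>B\<in>H. mcong (2*n) M A B}"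
  have "K = {A \<in> carrier (Sp n). \<exists>B\<in>H. mcong (2*n) M A B \<and> mcong (2*n) 1 (1\<^sub>m (2*n)) B}"
    by (simp add: K_def mcong_def)
  then have "subgroup K (Sp n)" using subgroup_of_residues[OF H, of M 1] by simp
  moreover have "\<forall>A\<in>K. \<forall>B\<in>carrier (Sp n). mcong (2*n) M A B \<longrightarrow> B \<in> K"
  proof (intro ballI impI)
    fix A B assume "A \<in> K" "B \<in> carrier (Sp n)" and AB: "mcong (2*n) M A B"
    then obtain C where C: "C \<in> H" "mcong (2*n) M A C" by (auto simp: K_def)
    have "mcong (2*n) M B C" using mcong_sym[OF AB] C(2) by (rule mcong_trans)
    then show "B \<in> K" using C(1) \<open>B \<in> carrier (Sp n)\<close> by (auto simp: K_def)
  qed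
  moreover have "\<forall>A\<in>carrier (Sp n). \<forall>B\<in>carrier (Sp n). A * B * inv\<^bsub>Sp n\<^esub> A * inv\<^bsub>Sp n\<^esub> B \<in> K"
  proof (intro ballI)
    fix A B assume "A \<in> carrier (Sp n)" "B \<in> carrier (Sp n)"
    then have "A * B * inv\<^bsub>Sp n\<^esub> A * inv\<^bsub>Sp n\<^esub> B \<in> H" using k by blast
    then show "A * B * inv\<^bsub>Sp n\<^esub> A * inv\<^bsub>Sp n\<^esub> B \<in> K" unfolding K_def using HSp mcong_refl by blast
  qed
  ultimately have KK: "K = carrier (Sp n)" using M unfolding perfect_mod_def by blast
  show "H = carrier (Sp n)"
  proof
    show "H \<subseteq> carrier (Sp n)" using HSp by blast
    show "carrier (Sp n) \<subseteq> H"
    proof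
      fix A assume A: "A \<in> carrier (Sp n)"
      then obtain B where B: "B \<in> H" "mcong (2*n) M A B" using KK by (auto simp: K_def)
      have BS: "B \<in> carrier (Sp n)" by (rule HSp[OF B(1)])
      let ?X = "A * inv\<^bsub>Sp n\<^esub> B"
      have X: "?X \<in> carrier (Sp n)" by (intro Sp_mult_closed A Sp_inv(1) BS)
      have XB: "?X * B = A" using A BS by (simp add: Sp_assoc Sp_inv)
      obtain C where C: "C \<in> H" "mcong (2*n) p ?X C" "mcong (2*n) M (1\<^sub>m (2*n)) C"
        using lift_into_subgroup[OF p cop H _ _ X] c k by blast
      have CS: "C \<in> carrier (Sp n)" by (rule HSp[OF C(1)])
      have "mcong (2*n) p (?X * B) (C * B)" by (rule mcong_Sp_mult[OF X BS CS BS C(2) mcong_refl])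
      then have 1: "mcong (2*n) p (C * B) A" unfolding XB by (rule mcong_sym)
      have "mcong (2*n) M (1\<^sub>m (2*n) * B) (C * B)" by (rule mcong_Sp_mult[OF Sp_one BS CS BS C(3) mcong_refl])
      then have "mcong (2*n) M B (C * B)" using BS by simp
      then have "mcong (2*n) M (C * B) B" by (rule mcong_sym)
      then have 2: "mcong (2*n) M (C * B) A" using mcong_trans[OF _ mcong_sym[OF B(2)]] by blast
      have "mcong (2*n) (p * M) (C * B) A" by (rule mcong_coprime[OF cop 1 2])
      then show "A \<in> H" using c Hm[OF C(1) B(1)] A by blast
    qed
  qed
qed

text \<open>Lift \<open>A\<close> times the inverse of \<open>B\<close> to a matrix that is the identity modulo \<open>M\<close>, and multiply by \<open>B\<close>.\<close>

lemma Sp_crt: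
  assumes p: "prime p" "p > 3" and cop: "coprime p M" and A: "A \<in> carrier (Sp n)" and B: "B \<in> carrier (Sp n)"
  shows "\<exists>C\<in>carrier (Sp n). mcong (2*n) p A C \<and> mcong (2*n) M B C"
proof -
  let ?X = "A * inv\<^bsub>Sp n\<^esub> B"
  have X: "?X \<in> carrier (Sp n)" by (intro Sp_mult_closed A Sp_inv(1) B)
  have XB: "?X * B = A" using A B by (simp add: Sp_assoc Sp_inv)
  obtain C where C: "C \<in> carrier (Sp n)" "mcong (2*n) p ?X C" "mcong (2*n) M (1\<^sub>m (2*n)) C"
  proof -
    have "\<exists>C\<in>carrier (Sp n). mcong (2*n) p ?X C \<and> mcong (2*n) M (1\<^sub>m (2*n)) C"
    proof (rule lift_into_subgroup[OF p cop group.subgroup_self[OF group_Sp] _ _ X])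
      show "U * V * inv\<^bsub>Sp n\<^esub> U * inv\<^bsub>Sp n\<^esub> V \<in> carrier (Sp n)"
        if "U \<in> carrier (Sp n)" "V \<in> carrier (Sp n)" for U V
        using that by (intro Sp_mult_closed Sp_inv(1))
    qed
    then show thesis using that by blast
  qed
  have "mcong (2*n) p (?X * B) (C * B)" by (rule mcong_Sp_mult[OF X B C(1) B C(2) mcong_refl])
  moreover have "mcong (2*n) M (1\<^sub>m (2*n) * B) (C * B)" by (rule mcong_Sp_mult[OF Sp_one B C(1) B C(3) mcong_refl])
  ultimately show ?thesis using XB B Sp_mult_closed[OF C(1) B] by auto
qed

section \<open>Random walks on finite perfect groups\<close>

text \<open>The last assumption says that the group is perfect. It excludes the only obstruction to
equidistribution, which is that all steps lie in one coset of a proper normal subgroup with cyclic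
quotient.\<close>

locale finite_group_walk = group G for G (structure) +
  fixes s :: "nat \<Rightarrow> 'a" and k :: nat
  assumes fin: "finite (carrier G)" and k: "k \<ge> 1"
    and s: "s ` {1..k} \<subseteq> carrier G" and gen: "generate G (s ` {1..k}) = carrier G"
    and perfect: "\<And>H. subgroup H G \<Longrightarrow>
      (\<And>a b. a \<in> carrier G \<Longrightarrow> b \<in> carrier G \<Longrightarrow> a \<otimes> b \<otimes> inv a \<otimes> inv b \<in> H) \<Longrightarrow> H = carrier G"
begin

fun wprod :: "nat list \<Rightarrow> 'a" where
  "wprod [] = \<one>" | "wprod (i # is) = s i \<otimes> wprod is"

definition reach :: "nat \<Rightarrow> 'a set" where
  "reach N = wprod ` {is. length is = N \<and> set is \<subseteq> {1..k}}"

definition walk :: "nat \<Rightarrow> 'a pmf" where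
  "walk N = map_pmf wprod (replicate_pmf N (pmf_of_set {1..k}))"

lemma s_closed: "i \<in> {1..k} \<Longrightarrow> s i \<in> carrier G" using s by blast

lemma wprod_closed: "set is \<subseteq> {1..k} \<Longrightarrow> wprod is \<in> carrier G"
  by (induction "is") (auto simp: s_closed)

lemma wprod_append: "set is \<subseteq> {1..k} \<Longrightarrow> set js \<subseteq> {1..k} \<Longrightarrow> wprod (is @ js) = wprod is \<otimes> wprod js"
  by (induction "is") (auto simp: s_closed wprod_closed m_assoc)

lemma reach_closed: "reach N \<subseteq> carrier G" by (auto simp: reach_def wprod_closed)

lemma reach_mult: "a \<in> reach N \<Longrightarrow> b \<in> reach M \<Longrightarrow> a \<otimes> b \<in> reach (N + M)"
proof -
  assume "a \<in> reach N" "b \<in> reach M"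
  then obtain "is" js where "length is = N" "set is \<subseteq> {1..k}" "a = wprod is" "length js = M" "set js \<subseteq> {1..k}" "b = wprod js"
    by (auto simp: reach_def)
  then show ?thesis unfolding reach_def by (intro image_eqI[of _ _ "is @ js"]) (auto simp: wprod_append)
qed

lemma reach_0: "reach 0 = {\<one>}" by (auto simp: reach_def)

lemma reach_s: "i \<in> {1..k} \<Longrightarrow> s i \<in> reach 1"
  unfolding reach_def by (rule image_eqI[of _ _ "[i]"]) (auto simp: s_closed)

lemma reach_pow: "a \<in> reach N \<Longrightarrow> a [^] (j::nat) \<in> reach (N * j)"
proof (induction j)
  case 0 then show ?case by (simp add: reach_0)
next
  case (Suc j)
  then have "a [^] j \<otimes> a \<in> reach (N * j + N)" by (intro reach_mult) auto
  then show ?case by (simp add: add.commute)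
qed

lemma inv_eq_pow: assumes "a \<in> carrier G" shows "inv a = a [^] (order G - 1)"
proof -
  have "order G > 0" using fin one_closed by (simp add: order_def card_gt_0_iff) blast
  then have "a [^] (order G - 1) \<otimes> a = a [^] order G" using assms by (metis Suc_diff_1 nat_pow_Suc)
  then have "a [^] (order G - 1) \<otimes> a = \<one>" using pow_order_eq_1[OF assms] by simp
  then show ?thesis using assms inv_equality by simp
qed

lemma reach_inv: assumes "a \<in> reach N" shows "inv a \<in> reach (N * (order G - 1))"
  using reach_pow[OF assms] inv_eq_pow assms reach_closed by (metis subsetD)

lemma order_pos: "order G > 0"
  using fin one_closed by (simp add: order_def card_gt_0_iff) blast

lemma reachable: "a \<in> carrier G \<Longrightarrow> \<exists>N. a \<in> reach N"
proof -
  assume a: "a \<in> carrier G"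
  have "a \<in> generate G (s ` {1..k})" using gen a by simp
  then show ?thesis
  proof (induction rule: generate.induct)
    case one then show ?case using reach_0 by blast
  next
    case (incl h) then show ?case using reach_s by blast
  next
    case (inv h) then show ?case using reach_s reach_inv by blast
  next
    case (eng a b) then show ?case using reach_mult by blast
  qed
qed

text \<open>Let \<open>e\<close> be the order of the group. Since \<open>s\<^sup>e = 1\<close>, the sets of values of words of length \<open>e j\<close> increase with
\<open>j\<close>, and their union \<open>H\<close> is a subgroup. Writing inverses as powers with exponent \<open>e - 1\<close>, a commutator of
values of words of lengths \<open>i\<close> and \<open>j\<close> is the value of a word of length \<open>e (i + j)\<close>. So \<open>H\<close> contains
all commutators and is the whole group.\<close>

lemma full_support: "\<exists>N. reach N = carrier G"
proof -
  let ?e = "order G"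
  have e1: "1 + (?e - 1) = ?e" using order_pos by simp
  have one: "\<one> \<in> reach (?e * j)" for j
  proof -
    have "s 1 [^] (?e * j) \<in> reach (1 * (?e * j))" using k by (intro reach_pow reach_s) simp
    moreover have "s 1 [^] (?e * j) = \<one>"
      using pow_order_eq_1[of "s 1"] s_closed[of 1] k by (simp add: nat_pow_pow[symmetric])
    ultimately show ?thesis by simp
  qed
  have mono: "a \<in> reach (?e * i) \<Longrightarrow> i \<le> j \<Longrightarrow> a \<in> reach (?e * j)" for a i j
  proof -
    assume a: "a \<in> reach (?e * i)" and ij: "i \<le> j"
    have "a \<otimes> \<one> \<in> reach (?e * i + ?e * (j - i))" by (rule reach_mult[OF a one])
    moreover have "?e * i + ?e * (j - i) = ?e * j" using ij by (simp add: distrib_left[symmetric])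
    ultimately show ?thesis using a reach_closed by (auto simp: subset_iff)
  qed
  define H where "H = (\<Union>j. reach (?e * j))"
  have "H = carrier G"
  proof (rule perfect)
    show "subgroup H G"
    proof (rule subgroupI)
      show "H \<subseteq> carrier G" using reach_closed by (auto simp: H_def)
      show "H \<noteq> {}" using one by (auto simp: H_def)
    next
      fix a assume "a \<in> H"
      then obtain j where "a \<in> reach (?e * j)" by (auto simp: H_def)
      then have "inv a \<in> reach (?e * j * (?e - 1))" by (rule reach_inv)
      then show "inv a \<in> H" unfolding H_def by (metis UN_I UNIV_I mult.assoc)
    next
      fix a b assume "a \<in> H" "b \<in> H"
      then obtain i j where "a \<in> reach (?e * i)" "b \<in> reach (?e * j)" by (auto simp: H_def)
      then have "a \<otimes> b \<in> reach (?e * i + ?e * j)" by (rule reach_mult)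
      then show "a \<otimes> b \<in> H" unfolding H_def by (metis UN_I UNIV_I distrib_left)
    qed
    fix a b assume "a \<in> carrier G" "b \<in> carrier G"
    then obtain i j where ij: "a \<in> reach i" "b \<in> reach j" using reachable by blast
    have "a \<otimes> b \<otimes> inv a \<otimes> inv b \<in> reach (i + j + i * (?e - 1) + j * (?e - 1))"
      by (intro reach_mult reach_inv ij)
    moreover have "i + j + i * (?e - 1) + j * (?e - 1) = i * (1 + (?e - 1)) + j * (1 + (?e - 1))"
      by (simp only: distrib_left mult_1_right)
    then have "i + j + i * (?e - 1) + j * (?e - 1) = ?e * (i + j)"
      unfolding e1 by (simp add: distrib_left mult.commute)
    ultimately show "a \<otimes> b \<otimes> inv a \<otimes> inv b \<in> H" unfolding H_def by (metis UN_I UNIV_I)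
  qed
  then have "\<forall>a\<in>carrier G. \<exists>j. a \<in> reach (?e * j)" by (auto simp: H_def)
  then obtain f where f: "\<And>a. a \<in> carrier G \<Longrightarrow> a \<in> reach (?e * f a)" by metis
  \<comment> \<open>One length serves all elements, since the sets of values increase.\<close>
  define J where "J = Max (f ` carrier G)"
  have "a \<in> reach (?e * J)" if "a \<in> carrier G" for a
  proof (rule mono[OF f[OF that]])
    show "f a \<le> J" unfolding J_def using fin that by (intro Max_ge) auto
  qed
  then have "reach (?e * J) = carrier G" using reach_closed by blast
  then show ?thesis by blast
qed

lemma set_walk: "set_pmf (walk N) = reach N"
proof -
  have "{1..k} \<noteq> {}" using k by simp
  then show ?thesis unfolding walk_def reach_def by (auto simp: set_replicate_pmf)
qed

lemma walk_carrier: "set_pmf (walk N) \<subseteq> carrier G" using set_walk reach_closed by simp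

lemma walk_add: "walk (N + M) = bind_pmf (walk N) (\<lambda>y. map_pmf (\<lambda>a. y \<otimes> a) (walk M))"
proof -
  let ?p = "pmf_of_set {1..k}"
  have ne: "{1..k} \<noteq> {}" using k by simp
  have "walk (N + M) = bind_pmf (replicate_pmf N ?p) (\<lambda>xs. map_pmf (\<lambda>ys. wprod (xs @ ys)) (replicate_pmf M ?p))"
    unfolding walk_def replicate_pmf_distrib by (simp add: map_bind_pmf map_pmf_def bind_assoc_pmf bind_return_pmf)
  also have "\<dots> = bind_pmf (replicate_pmf N ?p) (\<lambda>xs. map_pmf (\<lambda>ys. wprod xs \<otimes> wprod ys) (replicate_pmf M ?p))"
    using ne by (intro bind_pmf_cong map_pmf_cong refl wprod_append) (auto simp: set_replicate_pmf)
  also have "\<dots> = bind_pmf (walk N) (\<lambda>y. map_pmf (\<lambda>a. y \<otimes> a) (walk M))"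
    unfolding walk_def by (simp add: bind_map_pmf map_pmf_comp)
  finally show ?thesis .
qed

lemma pmf_translate: assumes "y \<in> carrier G" "x \<in> carrier G"
  shows "pmf (map_pmf (\<lambda>a. y \<otimes> a) (walk M)) x = pmf (walk M) (inv y \<otimes> x)"
proof -
  have "pmf (map_pmf (\<lambda>a. y \<otimes> a) (walk M)) x = measure (walk M) ((\<lambda>a. y \<otimes> a) -` {x})" by (rule pmf_map)
  also have "\<dots> = measure (walk M) {inv y \<otimes> x}"
  proof (rule measure_pmf.finite_measure_eq_AE)
    show "AE a in measure_pmf (walk M). (a \<in> (\<lambda>a. y \<otimes> a) -` {x}) = (a \<in> {inv y \<otimes> x})"
    proof (rule AE_pmfI)
      fix a assume "a \<in> set_pmf (walk M)"
      then have "a \<in> carrier G" using walk_carrier by blast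
      then show "(a \<in> (\<lambda>a. y \<otimes> a) -` {x}) = (a \<in> {inv y \<otimes> x})"
        using assms inv_solve_left[of a y x] by auto
    qed
  qed auto
  also have "\<dots> = pmf (walk M) (inv y \<otimes> x)" by (simp add: measure_pmf_single)
  finally show ?thesis .
qed

lemma pmf_walk_add: assumes "x \<in> carrier G"
  shows "pmf (walk (N + M)) x = (\<Sum>y\<in>carrier G. pmf (walk N) y * pmf (walk M) (inv y \<otimes> x))"
proof -
  have "pmf (walk (N + M)) x = measure_pmf.expectation (walk N) (\<lambda>y. pmf (map_pmf (\<lambda>a. y \<otimes> a) (walk M)) x)"
    unfolding walk_add by (rule pmf_bind)
  also have "\<dots> = (\<Sum>y\<in>carrier G. pmf (walk N) y *\<^sub>R pmf (map_pmf (\<lambda>a. y \<otimes> a) (walk M)) x)"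
    using walk_carrier by (intro integral_measure_pmf[OF fin]) auto
  also have "\<dots> = (\<Sum>y\<in>carrier G. pmf (walk N) y * pmf (walk M) (inv y \<otimes> x))"
    using assms by (intro sum.cong) (auto simp: pmf_translate)
  finally show ?thesis .
qed

lemma sum_walk: "(\<Sum>y\<in>carrier G. pmf (walk N) y) = 1"
  using walk_carrier fin by (intro sum_pmf_eq_1)

lemma sum_walk_translate: assumes "x \<in> carrier G" shows "(\<Sum>y\<in>carrier G. pmf (walk N) (inv y \<otimes> x)) = 1"
proof -
  have "(\<Sum>y\<in>carrier G. pmf (walk N) (inv y \<otimes> x)) = (\<Sum>z\<in>carrier G. pmf (walk N) z)"
    by (rule sum.reindex_bij_witness[of _ "\<lambda>z. x \<otimes> inv z" "\<lambda>y. inv y \<otimes> x"])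
      (use assms in \<open>auto simp: inv_mult_group m_assoc[symmetric]\<close>, simp_all add: m_assoc)
  then show ?thesis using sum_walk by simp
qed

text \<open>Doeblin's estimate: the part of the distribution at time \<open>N\<close> that is uniform with density \<open>d\<close> spreads
whatever follows evenly over the group.\<close>

lemma walk_bound_step:
  assumes c: "\<And>x. x \<in> carrier G \<Longrightarrow> pmf (walk M) x \<le> c"
    and d: "\<And>x. x \<in> carrier G \<Longrightarrow> pmf (walk N) x \<ge> d" and d0: "d \<ge> 0" and x: "x \<in> carrier G"
  shows "pmf (walk (N + M)) x \<le> (1 - d * order G) * c + d"
proof -
  have "pmf (walk (N + M)) x = (\<Sum>y\<in>carrier G. (pmf (walk N) y - d) * pmf (walk M) (inv y \<otimes> x)) + d * (\<Sum>y\<in>carrier G. pmf (walk M) (inv y \<otimes> x))"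
    unfolding pmf_walk_add[OF x] sum_distrib_left sum.distrib[symmetric] by (intro sum.cong) (auto simp: algebra_simps)
  also have "\<dots> \<le> (\<Sum>y\<in>carrier G. (pmf (walk N) y - d) * c) + d * 1"
    unfolding sum_walk_translate[OF x] using c d d0 x by (intro add_mono sum_mono mult_left_mono) auto
  also have "(\<Sum>y\<in>carrier G. (pmf (walk N) y - d) * c) = (1 - d * order G) * c"
    unfolding sum_distrib_right[symmetric] sum_subtractf sum_walk by (simp add: order_def)
  finally show ?thesis by simp
qed

text \<open>With \<open>N1\<close> such that every element is reached with a probability of at least \<open>d > 0\<close>, each block of \<open>N1\<close>
steps shrinks the excess of the largest probability over \<open>1 / order G\<close> by the factor
\<open>1 - d * order G\<close>.\<close>

theorem walk_equidistributes:
  assumes e: "e > 0"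
  shows "\<exists>N0. \<forall>N\<ge>N0. \<forall>x\<in>carrier G. pmf (walk N) x \<le> 1 / order G + e"
proof -
  obtain N1 where N1: "reach N1 = carrier G" using full_support by blast
  define d where "d = Min (pmf (walk N1) ` carrier G)"
  have cne: "carrier G \<noteq> {}" using one_closed by blast
  have dle: "d \<le> pmf (walk N1) x" if "x \<in> carrier G" for x
    unfolding d_def using fin that by (intro Min_le) auto
  have "d \<in> pmf (walk N1) ` carrier G" unfolding d_def using fin cne by (intro Min_in) auto
  then have d0: "d > 0" using set_walk[of N1] N1 by (auto simp: pmf_positive_iff)
  let ?g = "real (order G)"
  have g0: "?g > 0" using order_pos by simp
  have "?g * d = (\<Sum>x\<in>carrier G. d)" by (simp add: order_def)
  also have "\<dots> \<le> (\<Sum>x\<in>carrier G. pmf (walk N1) x)" using dle by (intro sum_mono)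
  finally have gd: "?g * d \<le> 1" using sum_walk by simp
  let ?r = "1 - d * ?g"
  have r: "0 \<le> ?r" "?r < 1" using gd d0 g0 by (auto simp: mult.commute)
  have bound: "pmf (walk (N1 * j + M)) x \<le> 1 / ?g + ?r ^ j" if "x \<in> carrier G" for j M x
    using that
  proof (induction j arbitrary: x)
    case 0
    have "pmf (walk M) x \<le> 1" by (rule pmf_le_1)
    moreover have "1 / ?g \<ge> 0" by simp
    ultimately show ?case unfolding mult_0_right add_0 power_0 by linarith
  next
    case (Suc j)
    have "pmf (walk (N1 + (N1 * j + M))) x \<le> ?r * (1 / ?g + ?r ^ j) + d"
      using d0 by (intro walk_bound_step Suc.IH dle Suc.prems) auto
    also have "?r * (1 / ?g + ?r ^ j) + d = 1 / ?g + ?r ^ Suc j" using g0 by (simp add: field_simps)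
    finally show ?case by (simp add: add_ac)
  qed
  obtain j where j: "?r ^ j < e" using real_arch_pow_inv[OF e r(2)] by blast
  show ?thesis
  proof (intro exI[of _ "N1 * j"] allI impI ballI)
    fix N x assume "N \<ge> N1 * j" "x \<in> carrier G"
    then have "pmf (walk (N1 * j + (N - N1 * j))) x \<le> 1 / ?g + ?r ^ j" by (intro bound)
    then show "pmf (walk N) x \<le> 1 / order G + e" using j \<open>N \<ge> N1 * j\<close> by simp
  qed
qed

end

section \<open>The proportion of good residues\<close>

lemma congm_prod: "(\<And>i. i \<in> A \<Longrightarrow> congm p f (g i) (h i)) \<Longrightarrow> congm p f (prod g A) (prod h A)"
  by (induction A rule: infinite_finite_induct) (auto intro: congm_mult)

lemma char_poly_mcong:
  assumes A: "A \<in> carrier_mat d d" and B: "B \<in> carrier_mat d d" and AB: "mcong d m A B"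
  shows "reduce_poly m (char_poly A) = reduce_poly m (char_poly B)"
proof -
  have e: "congm m 0 (char_poly_matrix A $$ (i, j)) (char_poly_matrix B $$ (i, j))" if "i < d" "j < d" for i j
  proof -
    have "int m dvd A $$ (i, j) - B $$ (i, j)" using AB that by (simp add: mcong_def cong_iff_dvd_diff)
    then have "int m dvd - (A $$ (i, j) - B $$ (i, j))" using dvd_minus_iff by blast
    then show ?thesis using A B that by (simp add: char_poly_matrix_def congm_def)
  qed
  have "congm m 0 (char_poly A) (char_poly B)"
    unfolding char_poly_def det_def'[OF char_poly_matrix_closed[OF A]] det_def'[OF char_poly_matrix_closed[OF B]]
    by (intro congm_sum congm_mult congm_refl congm_prod e) (auto simp: permutes_in_image)
  then show ?thesis by (simp add: reduce_poly_eq_iff congm_def)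
qed

definition reduce_mat :: "nat \<Rightarrow> int mat \<Rightarrow> int mat" where "reduce_mat m A = map_mat (\<lambda>x. x mod int m) A"

definition Sp_residues :: "nat \<Rightarrow> nat \<Rightarrow> int mat set" where "Sp_residues n m = reduce_mat m ` carrier (Sp n)"

lemma reduce_mat_carrier [simp]: "reduce_mat m A \<in> carrier_mat d d \<longleftrightarrow> A \<in> carrier_mat d d"
  by (simp add: reduce_mat_def)

lemma reduce_mat_index: "A \<in> carrier_mat d d \<Longrightarrow> i < d \<Longrightarrow> j < d \<Longrightarrow> reduce_mat m A $$ (i, j) = A $$ (i, j) mod int m"
  by (simp add: reduce_mat_def)

lemma reduce_mat_eq_iff: assumes "A \<in> carrier_mat d d" "B \<in> carrier_mat d d"
  shows "reduce_mat m A = reduce_mat m B \<longleftrightarrow> mcong d m A B"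
proof
  assume "reduce_mat m A = reduce_mat m B"
  then show "mcong d m A B" unfolding mcong_def cong_def using reduce_mat_index[OF assms(1)] reduce_mat_index[OF assms(2)] by metis
next
  assume "mcong d m A B"
  then show "reduce_mat m A = reduce_mat m B" using assms by (intro eq_matI) (auto simp: reduce_mat_def mcong_def cong_def)
qed

lemma mcong_reduce_mat: "A \<in> carrier_mat d d \<Longrightarrow> m' dvd m \<Longrightarrow> mcong d m' (reduce_mat m A) A"
  by (auto simp: mcong_def reduce_mat_def cong_def mod_mod_cancel)

lemma reduce_mat_reduce_mat: assumes "A \<in> carrier_mat d d" "m' dvd m" shows "reduce_mat m' (reduce_mat m A) = reduce_mat m' A"
  using assms mcong_reduce_mat[OF assms] by (subst reduce_mat_eq_iff[of _ d]) auto

lemma finite_Sp_residues: assumes "m > 0" shows "finite (Sp_residues n m)"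
proof -
  let ?F = "{A \<in> carrier_mat (2*n) (2*n). \<forall>i<2*n. \<forall>j<2*n. A $$ (i, j) \<in> {0..<int m}}"
  let ?E = "({..<2*n} \<times> {..<2*n}) \<rightarrow>\<^sub>E {0..<int m}"
  have "?F \<subseteq> (\<lambda>g. mat (2*n) (2*n) g) ` ?E"
  proof
    fix A assume A: "A \<in> ?F"
    show "A \<in> (\<lambda>g. mat (2*n) (2*n) g) ` ?E"
    proof (rule image_eqI)
      show "A = mat (2*n) (2*n) (restrict (\<lambda>ij. A $$ ij) ({..<2*n} \<times> {..<2*n}))"
        using A by (intro eq_matI) auto
      show "restrict (\<lambda>ij. A $$ ij) ({..<2*n} \<times> {..<2*n}) \<in> ?E" using A by auto
    qed
  qed
  moreover have "finite ?E" by (intro finite_PiE) auto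
  ultimately have "finite ?F" using finite_surj by blast
  moreover have "Sp_residues n m \<subseteq> ?F" using assms SpD(1) by (fastforce simp: Sp_residues_def reduce_mat_def)
  ultimately show ?thesis using finite_subset by blast
qed

definition Sp_mod :: "nat \<Rightarrow> nat \<Rightarrow> int mat monoid" where
  "Sp_mod n m = \<lparr>carrier = Sp_residues n m, mult = (\<lambda>A B. reduce_mat m (A * B)), one = reduce_mat m (1\<^sub>m (2*n))\<rparr>"

lemma Sp_mod_simps [simp]: "carrier (Sp_mod n m) = Sp_residues n m" "mult (Sp_mod n m) A B = reduce_mat m (A * B)" "one (Sp_mod n m) = reduce_mat m (1\<^sub>m (2*n))"
  by (simp_all add: Sp_mod_def)

lemma reduce_mat_mult: assumes "A \<in> carrier_mat d d" "B \<in> carrier_mat d d"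
  shows "reduce_mat m (reduce_mat m A * reduce_mat m B) = reduce_mat m (A * B)" "reduce_mat m (A * reduce_mat m B) = reduce_mat m (A * B)" "reduce_mat m (reduce_mat m A * B) = reduce_mat m (A * B)"
proof -
  note A = assms(1) and B = assms(2)
  have rA: "reduce_mat m A \<in> carrier_mat d d" and rB: "reduce_mat m B \<in> carrier_mat d d" using assms by simp_all
  note cA = mcong_reduce_mat[OF A dvd_refl[of m]] and cB = mcong_reduce_mat[OF B dvd_refl[of m]]
  note c = mult_carrier_mat[of _ d d _ d]
  show "reduce_mat m (reduce_mat m A * reduce_mat m B) = reduce_mat m (A * B)"
    using mcong_mult[OF rA rB A B cA cB] reduce_mat_eq_iff[OF c[OF rA rB] c[OF A B]] by simp
  show "reduce_mat m (A * reduce_mat m B) = reduce_mat m (A * B)"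
    using mcong_mult[OF A rB A B mcong_refl cB] reduce_mat_eq_iff[OF c[OF A rB] c[OF A B]] by simp
  show "reduce_mat m (reduce_mat m A * B) = reduce_mat m (A * B)"
    using mcong_mult[OF rA B A B cA mcong_refl] reduce_mat_eq_iff[OF c[OF rA B] c[OF A B]] by simp
qed

lemma group_Sp_mod: "group (Sp_mod n m)"
proof (rule groupI)
  note c = SpD(1)[of _ n]
  show "\<one>\<^bsub>Sp_mod n m\<^esub> \<in> carrier (Sp_mod n m)" by (simp add: Sp_residues_def)
  show "x \<otimes>\<^bsub>Sp_mod n m\<^esub> y \<in> carrier (Sp_mod n m)" if "x \<in> carrier (Sp_mod n m)" "y \<in> carrier (Sp_mod n m)" for x y
    using that by (auto simp: Sp_residues_def reduce_mat_mult[OF c c] Sp_mult_closed)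
  show "x \<otimes>\<^bsub>Sp_mod n m\<^esub> y \<otimes>\<^bsub>Sp_mod n m\<^esub> z = x \<otimes>\<^bsub>Sp_mod n m\<^esub> (y \<otimes>\<^bsub>Sp_mod n m\<^esub> z)"
    if "x \<in> carrier (Sp_mod n m)" "y \<in> carrier (Sp_mod n m)" "z \<in> carrier (Sp_mod n m)" for x y z
  proof -
    from that obtain A B C where A: "A \<in> carrier (Sp n)" "x = reduce_mat m A" and B: "B \<in> carrier (Sp n)" "y = reduce_mat m B"
      and C: "C \<in> carrier (Sp n)" "z = reduce_mat m C" by (auto simp: Sp_residues_def)
    note AB = Sp_mult_closed[OF A(1) B(1)] and BC = Sp_mult_closed[OF B(1) C(1)]
    show ?thesis unfolding A(2) B(2) C(2)
      by (simp add: reduce_mat_mult(1)[OF c[OF A(1)] c[OF B(1)]] reduce_mat_mult(1)[OF c[OF B(1)] c[OF C(1)]]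
          reduce_mat_mult(1)[OF c[OF AB] c[OF C(1)]] reduce_mat_mult(1)[OF c[OF A(1)] c[OF BC]] Sp_assoc[OF A(1) B(1) C(1)])
  qed
  show "\<one>\<^bsub>Sp_mod n m\<^esub> \<otimes>\<^bsub>Sp_mod n m\<^esub> x = x" if "x \<in> carrier (Sp_mod n m)" for x
    using that by (auto simp: Sp_residues_def reduce_mat_mult[OF c c])
  show "\<exists>y\<in>carrier (Sp_mod n m). y \<otimes>\<^bsub>Sp_mod n m\<^esub> x = \<one>\<^bsub>Sp_mod n m\<^esub>" if "x \<in> carrier (Sp_mod n m)" for x
  proof -
    from that obtain A where A: "A \<in> carrier (Sp n)" "x = reduce_mat m A" by (auto simp: Sp_residues_def)
    note iA = Sp_inv(1)[OF A(1)]
    have "reduce_mat m (reduce_mat m (inv\<^bsub>Sp n\<^esub> A) * reduce_mat m A) = reduce_mat m (1\<^sub>m (2*n))"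
      unfolding reduce_mat_mult(1)[OF c[OF iA] c[OF A(1)]] Sp_inv(2)[OF A(1)] ..
    then show ?thesis using iA A by (intro bexI[of _ "reduce_mat m (inv\<^bsub>Sp n\<^esub> A)"]) (auto simp: Sp_residues_def)
  qed
qed

lemma reduce_mat_hom: "group_hom (Sp n) (Sp_mod n m) (reduce_mat m)"
proof -
  have "reduce_mat m \<in> hom (Sp n) (Sp_mod n m)"
    by (rule homI) (auto simp: Sp_residues_def reduce_mat_mult(1)[OF SpD(1) SpD(1)])
  then show ?thesis using group_Sp group_Sp_mod by (simp add: group_hom_def group_hom_axioms_def)
qed

text \<open>The excluded residues of the coefficient of \<open>x\<close> to the power \<open>2 n - 1\<close>, which is minus the trace, serve the
conditions on cyclotomic polynomials and on polynomials in \<open>x\<^sup>m\<close>.\<close>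

definition good_polys :: "nat \<Rightarrow> nat \<Rightarrow> int poly set" where
  "good_polys p n = {f \<in> cyc_primes p n. \<forall>t\<in>{- (2 * int n)..2 * int n}. \<not> [coeff f (2*n - 1) = t] (mod (int p))}"

lemma cyc_primesD: assumes "f \<in> cyc_primes p n" shows "degree f = 2 * n" "lead_coeff f = 1"
  using assms primem_monic(1)[of p f] by (auto simp: cyc_primes_def)

text \<open>The entries \<open>b i\<close> are taken from the upper half of the coefficients; by palindromicity the lower half then
agrees as well, including the constant coefficient, which \<open>b n = -1\<close> makes equal to \<open>1\<close>.\<close>

lemma cyc_prime_is_companion:
  assumes p: "prime p" and n: "n \<ge> 1" and f: "f \<in> cyc_primes p n"
  shows "\<exists>b. b n = -1 \<and> hpoly n b (2 * n) = f"
proof -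
  define b where "b = (\<lambda>i. if i = n then -1 else - coeff f (n + i))"
  have df: "degree f = 2 * n" "lead_coeff f = 1" by (rule cyc_primesD[OF f])+
  note pal = cyc_primes_palindromic[OF p f n]
  have "hpoly n b (2 * n) = f"
  proof (rule poly_eqI)
    fix m
    have c: "coeff (hpoly n b (2*n)) m = (if m = 2 * n then 1 else 0) - (if n \<le> m \<and> m < 2 * n then b (m - n) else 0)
       - (if m < n then b (n - m) else 0)" using coeff_hpoly[OF n order_refl, of b m] by (simp add: mult_2)
    consider "m = 0" | "0 < m" "m < n" | "n \<le> m" "m < 2 * n" | "m = 2 * n" | "m > 2 * n" by linarith
    then show "coeff (hpoly n b (2*n)) m = coeff f m"
    proof cases
      case 1 then show ?thesis using c n pal(2)[of 0] by (simp add: b_def)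
    next
      case 2
      then have "coeff f (n + (n - m)) = coeff f m" using pal(1)[of m] by (simp add: mult_2)
      then show ?thesis using c 2 by (simp add: b_def)
    next
      case 3 then show ?thesis using c by (simp add: b_def)
    next
      case 4 then show ?thesis using c df n by simp
    next
      case 5 then show ?thesis using c df by (simp add: coeff_eq_0)
    qed
  qed
  then show ?thesis by (intro exI[of _ b]) (simp add: b_def)
qed

text \<open>A palindromic polynomial is determined by \<open>n\<close> coefficients, so fixing the second coefficient to one of
\<open>4 n + 1\<close> residues leaves at most \<open>(4 n + 1) p\<^bsup>n - 1\<^esup>\<close> polynomials. For \<open>p \<ge> 22 n\<^sup>2\<close> this and the error term
of \<open>card_cyc_primes\<close> together are dominated by half of the main term.\<close>

lemma card_good_polys:
  assumes p: "prime p" and n: "n \<ge> 1" and big: "p \<ge> 22 * n ^ 2"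
  shows "p ^ n + 1 \<le> 8 * n * card (good_polys p n)"
proof -
  note p0 = prime_gt_0_nat[OF p]
  let ?C = "cyc_primes p n"
  let ?B = "?C - good_polys p n"
  let ?T = "(\<lambda>t. t mod int p) ` {- (2 * int n)..2 * int n}"
  let ?L = "{xs. set xs \<subseteq> {0..<int p} \<and> length xs = n - 1}"
  let ?h = "\<lambda>f. (coeff f (2*n - 1), map (\<lambda>i. coeff f (n + i)) [0..<n-1])"
  have rng: "0 \<le> coeff f i \<and> coeff f i < int p" if "f \<in> ?C" for f i
  proof -
    have "reduce_poly p f = f" using that by (simp add: cyc_primes_def)
    then show ?thesis using p0 coeff_reduce_poly[of p f i] by (metis of_nat_0_less_iff pos_mod_bound pos_mod_sign)
  qed
  have "inj_on ?h ?C"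
  proof (rule inj_onI)
    fix f g assume f: "f \<in> ?C" and g: "g \<in> ?C" and h: "?h f = ?h g"
    have df: "degree f = 2 * n" "lead_coeff f = 1" "degree g = 2 * n" "lead_coeff g = 1"
      by (rule cyc_primesD[OF f] cyc_primesD[OF g])+
    have l: "coeff f (n + i) = coeff g (n + i)" if "i < n - 1" for i
      using h that by (metis (no_types, lifting) Pair_inject add_0 atLeastLessThan_upt diff_zero length_upt map_eq_conv nth_upt set_upt atLeastLessThan_iff le0)
    have hi: "coeff f m = coeff g m" if "m \<ge> n" for m
    proof -
      consider "m < 2*n - 1" | "m = 2*n - 1" | "m = 2 * n" | "m > 2 * n" using n by linarith
      then show ?thesis
      proof cases
        case 1 then show ?thesis using l[of "m - n"] that by (auto simp: mult_2)
      next
        case 2 then show ?thesis using h by simp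
      next
        case 3 then show ?thesis using df by simp
      next
        case 4 then show ?thesis using df by (simp add: coeff_eq_0)
      qed
    qed
    show "f = g"
    proof (rule poly_eqI)
      fix m
      show "coeff f m = coeff g m"
      proof (cases "m \<ge> n")
        case False
        then have "coeff f (2*n - m) = coeff g (2*n - m)" by (intro hi) simp
        then show ?thesis using False cyc_primes_palindromic(1)[OF p f n, of m] cyc_primes_palindromic(1)[OF p g n, of m] by simp
      qed (rule hi)
    qed
  qed
  then have inj: "inj_on ?h ?B" by (rule inj_on_subset) auto
  have "?h ` ?B \<subseteq> ?T \<times> ?L"
  proof (rule image_subsetI)
    fix f assume f: "f \<in> ?B"
    then obtain t where t: "t \<in> {- (2 * int n)..2 * int n}" "[coeff f (2*n - 1) = t] (mod (int p))"
      by (auto simp: good_polys_def)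
    have "coeff f (2*n - 1) = t mod int p" using t(2) rng[of f "2*n - 1"] f by (simp add: cong_def)
    then have "coeff f (2*n - 1) \<in> ?T" using t(1) by blast
    then show "?h f \<in> ?T \<times> ?L" using rng f by auto
  qed
  moreover have finL: "finite ?L" "card ?L = p ^ (n - 1)"
    using finite_lists_length_eq[of "{0..<int p}" "n - 1"] card_lists_length_eq[of "{0..<int p}" "n - 1"] by auto
  ultimately have "card ?B \<le> card (?T \<times> ?L)" using inj by (intro card_inj_on_le) auto
  also have "\<dots> = card ?T * p ^ (n - 1)" using finL by (simp add: card_cartesian_product)
  also have "card ?T \<le> 4 * n + 1"
    using card_image_le[of "{- (2 * int n)..2 * int n}" "\<lambda>t. t mod int p"] by simp
  finally have B: "card ?B \<le> (4 * n + 1) * p ^ (n - 1)" by simp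
  have "good_polys p n \<subseteq> ?C" by (auto simp: good_polys_def)
  then have "card ?C = card (good_polys p n) + card ?B"
    using finite_cyc_primes[OF p0, of n] by (simp add: card_Diff_subset finite_subset card_mono)
  then have "2 * n * card ?C \<le> 2 * n * card (good_polys p n) + 2 * n * ((4 * n + 1) * p ^ (n - 1))"
    using mult_le_mono2[OF B, of "2 * n"] by (simp add: distrib_left)
  then have 1: "p ^ n + 1 \<le> 2 * n * card (good_polys p n) + (2 + (n - 1 + 2 * n * (4 * n + 1)) * p ^ (n - 1))"
    using card_cyc_primes[OF p n] by (simp add: algebra_simps)
  have pn: "p ^ n = p * p ^ (n - 1)" using n by (cases n) simp_all
  have q0: "p ^ (n - 1) \<ge> 1" using p0 by simp
  have "n - 1 + 2 * n * (4 * n + 1) + 1 \<le> 11 * n ^ 2"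
  proof -
    have "n \<le> n ^ 2" using n by (simp add: power2_eq_square)
    then show ?thesis using n by (simp add: power2_eq_square algebra_simps)
  qed
  then have "2 * ((n - 1 + 2 * n * (4 * n + 1)) * p ^ (n - 1) + p ^ (n - 1)) \<le> 2 * (11 * n ^ 2 * p ^ (n - 1))"
    using mult_le_mono1[of "n - 1 + 2 * n * (4 * n + 1) + 1" "11 * n ^ 2" "p ^ (n - 1)"] by (simp add: distrib_right)
  also have "\<dots> = 22 * n ^ 2 * p ^ (n - 1)" by simp
  also have "\<dots> \<le> p ^ n" unfolding pn using big by (rule mult_le_mono1)
  finally have 2: "2 * ((n - 1 + 2 * n * (4 * n + 1)) * p ^ (n - 1) + p ^ (n - 1)) \<le> p ^ n" .
  define x where "x = (n - 1 + 2 * n * (4 * n + 1)) * p ^ (n - 1)"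
  define y where "y = n * card (good_polys p n)"
  have 1: "p ^ n + 1 \<le> 2 * y + (2 + x)" unfolding x_def y_def mult.assoc[symmetric] by (rule 1)
  have 2: "2 * (x + p ^ (n - 1)) \<le> p ^ n" unfolding x_def by (rule 2)
  have "N + 1 \<le> 8 * y" if "N + 1 \<le> 2 * y + (2 + x)" "2 * (x + q) \<le> N" "1 \<le> q" for N q :: nat
    using that by arith
  from this[OF 1 2 q0] have "p ^ n + 1 \<le> 8 * y" .
  then show ?thesis by (simp add: y_def mult.assoc)
qed

lemma mcong_conj_commute:
  assumes A: "A \<in> carrier (Sp n)" and B: "B \<in> carrier (Sp n)" and C: "C \<in> carrier (Sp n)"
    and AB: "mcong (2*n) p (A * C * inv\<^bsub>Sp n\<^esub> A) (B * C * inv\<^bsub>Sp n\<^esub> B)"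
  shows "mcong (2*n) p (inv\<^bsub>Sp n\<^esub> B * A * C) (C * (inv\<^bsub>Sp n\<^esub> B * A))"
proof -
  note cl = Sp_mult_closed[where n = n] Sp_inv(1)[where n = n] and as = Sp_assoc[where n = n]
  note iA = Sp_inv(1)[OF A] and iB = Sp_inv(1)[OF B]
  have "mcong (2*n) p (inv\<^bsub>Sp n\<^esub> B * (A * C * inv\<^bsub>Sp n\<^esub> A) * A) (inv\<^bsub>Sp n\<^esub> B * (B * C * inv\<^bsub>Sp n\<^esub> B) * A)"
    by (intro mcong_Sp_mult cl A B C mcong_refl AB)
  moreover have "inv\<^bsub>Sp n\<^esub> B * (A * C * inv\<^bsub>Sp n\<^esub> A) * A = inv\<^bsub>Sp n\<^esub> B * A * C"
    using A iA iB C by (simp add: as cl Sp_inv)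
  moreover have "inv\<^bsub>Sp n\<^esub> B * (B * C * inv\<^bsub>Sp n\<^esub> B) * A = C * (inv\<^bsub>Sp n\<^esub> B * A)"
    using A B iB C by (simp add: as cl Sp_cancel_inv)
  ultimately show ?thesis by simp
qed

definition good_char :: "nat \<Rightarrow> nat \<Rightarrow> int mat \<Rightarrow> bool" where
  "good_char n p A \<longleftrightarrow> reduce_poly p (char_poly A) \<in> good_polys p n"

text \<open>Conjugating the companion matrix by all residues gives a map into the set on the right whose fibres
are cosets of the centralizer.\<close>

lemma card_char_class:
  assumes p: "prime p" and n: "n \<ge> 1" and f: "f \<in> cyc_primes p n"
  shows "card (Sp_residues n p) \<le> card {X \<in> Sp_residues n p. reduce_poly p (char_poly X) = f} * (p ^ n + 1)"
proof -
  let ?I = "{X \<in> Sp_residues n p. reduce_poly p (char_poly X) = f}"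
  obtain b where b: "b n = -1" "hpoly n b (2*n) = f" using cyc_prime_is_companion[OF p n f] by blast
  let ?C = "companion n b"
  have fp: "primem p f" and fr: "reduce_poly p f = f" and fd: "dvdm p f (XX ^ (p ^ n + 1) - 1)" using f by (auto simp: cyc_primes_def)
  have C: "?C \<in> carrier (Sp n)" by (rule companion_Sp[of n b, OF n b(1)])
  have "\<forall>X\<in>Sp_residues n p. \<exists>A\<in>carrier (Sp n). reduce_mat p A = X" by (auto simp: Sp_residues_def)
  then obtain L where L: "\<And>X. X \<in> Sp_residues n p \<Longrightarrow> L X \<in> carrier (Sp n)" "\<And>X. X \<in> Sp_residues n p \<Longrightarrow> reduce_mat p (L X) = X" by metis
  define h where "h = (\<lambda>X. reduce_mat p (L X * ?C * inv\<^bsub>Sp n\<^esub> (L X)))"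
  have K: "L X * ?C * inv\<^bsub>Sp n\<^esub> (L X) \<in> carrier (Sp n)" if "X \<in> Sp_residues n p" for X
    by (intro Sp_mult_closed Sp_inv(1) C L(1) that)
  have finQ: "finite (Sp_residues n p)" by (rule finite_Sp_residues[OF prime_gt_0_nat[OF p]])
  have hI: "h X \<in> ?I" if X: "X \<in> Sp_residues n p" for X
  proof -
    let ?K = "L X * ?C * inv\<^bsub>Sp n\<^esub> (L X)"
    have "similar_mat ?K ?C"
      using SpD(1)[OF L(1)[OF X]] SpD(1)[OF Sp_inv(1)[OF L(1)[OF X]]] Sp_inv(2,3)[OF L(1)[OF X]]
        SpD(1)[OF C] SpD(1)[OF K[OF X]]
      by (intro similar_matI[of _ _ "L X" "inv\<^bsub>Sp n\<^esub> (L X)" "2*n"]) auto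
    then have "char_poly ?K = f" using char_poly_similar char_poly_companion[OF n, of b] b(2) by metis
    moreover have "reduce_poly p (char_poly (h X)) = reduce_poly p (char_poly ?K)"
      unfolding h_def using SpD(1)[OF K[OF X]] by (intro char_poly_mcong[of _ "2*n"] mcong_reduce_mat) auto
    ultimately show ?thesis using fr K[OF X] by (auto simp: Sp_residues_def h_def)
  qed
  have fibre: "card {X \<in> Sp_residues n p. h X = Y} \<le> p ^ n + 1" for Y
  proof (cases "{X \<in> Sp_residues n p. h X = Y} = {}")
    case False
    then obtain X0 where X0: "X0 \<in> Sp_residues n p" "h X0 = Y" by blast
    let ?B = "inv\<^bsub>Sp n\<^esub> (L X0)"
    have B: "?B \<in> carrier (Sp n)" by (rule Sp_inv(1)[OF L(1)[OF X0(1)]])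
    let ?F = "{X \<in> Sp_residues n p. h X = Y}"
    let ?S = "(\<lambda>X. ?B * L X) ` ?F"
    have key: "X = X'" if X: "X \<in> Sp_residues n p" "X' \<in> Sp_residues n p" and m: "mcong (2*n) p (?B * L X) (?B * L X')" for X X'
    proof -
      have "mcong (2*n) p (L X0 * (?B * L X)) (L X0 * (?B * L X'))"
        by (intro mcong_Sp_mult Sp_mult_closed B L(1) X X0(1) mcong_refl m)
      then have "mcong (2*n) p (L X) (L X')"
        using Sp_cancel_inv(1)[OF L(1)[OF X0(1)]] L(1)[OF X(1)] L(1)[OF X(2)] by simp
      then have "reduce_mat p (L X) = reduce_mat p (L X')"
        using reduce_mat_eq_iff[OF SpD(1)[OF L(1)[OF X(1)]] SpD(1)[OF L(1)[OF X(2)]]] by simp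
      then show ?thesis using L(2) X by simp
    qed
    have "card ?S \<le> p ^ n + 1"
    proof (rule card_centralizer_le(2)[of n b, OF n b(1) p])
      show "primem p (hpoly n b (2*n))" "dvdm p (hpoly n b (2*n)) (XX ^ (p ^ n + 1) - 1)" using b(2) fp fd by simp_all
      fix M assume "M \<in> ?S"
      then obtain X where X: "X \<in> Sp_residues n p" "h X = Y" "M = ?B * L X" by blast
      have "h X = h X0" using X X0 by simp
      then have "mcong (2*n) p (L X * ?C * inv\<^bsub>Sp n\<^esub> (L X)) (L X0 * ?C * inv\<^bsub>Sp n\<^esub> (L X0))"
        unfolding h_def using reduce_mat_eq_iff[OF SpD(1)[OF K[OF X(1)]] SpD(1)[OF K[OF X0(1)]]] by simp
      from mcong_conj_commute[OF L(1)[OF X(1)] L(1)[OF X0(1)] C this]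
      show "M \<in> carrier (Sp n) \<and> mcong (2*n) p (M * ?C) (?C * M)"
        using X(3) Sp_mult_closed[OF B L(1)[OF X(1)]] by simp
    next
      fix M M' assume "M \<in> ?S" "M' \<in> ?S" and m: "mcong (2*n) p M M'"
      then obtain X X' where X: "X \<in> Sp_residues n p" "M = ?B * L X" "X' \<in> Sp_residues n p" "M' = ?B * L X'" by blast
      have "X = X'" by (rule key[OF X(1,3)]) (use m X in simp)
      then show "M = M'" using X by simp
    qed
    moreover have "inj_on (\<lambda>X. ?B * L X) ?F"
    proof (rule inj_onI)
      fix X X' assume "X \<in> ?F" "X' \<in> ?F" "?B * L X = ?B * L X'"
      then show "X = X'" by (intro key) simp_all
    qed
    ultimately show ?thesis by (simp add: card_image)
  qed (simp only: card.empty)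
  have "Sp_residues n p = (\<Union>Y\<in>?I. {X \<in> Sp_residues n p. h X = Y})" using hI by blast
  then have "card (Sp_residues n p) = card (\<Union>Y\<in>?I. {X \<in> Sp_residues n p. h X = Y})" by simp
  also have "\<dots> \<le> (\<Sum>Y\<in>?I. card {X \<in> Sp_residues n p. h X = Y})" using finQ by (intro card_UN_le) simp
  also have "\<dots> \<le> (\<Sum>Y\<in>?I. p ^ n + 1)" by (intro sum_mono fibre)
  also have "\<dots> = card ?I * (p ^ n + 1)" by simp
  finally show ?thesis .
qed

text \<open>There are at least \<open>(p\<^sup>n + 1) / (8 n)\<close> good polynomials, and each of them accounts for a fraction of at least
\<open>1 / (p\<^sup>n + 1)\<close> of all residues.\<close>

lemma card_good_residues:
  assumes p: "prime p" and n: "n \<ge> 1" and big: "p \<ge> 22 * n ^ 2"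
  shows "card (Sp_residues n p) \<le> 8 * n * card {X \<in> Sp_residues n p. good_char n p X}"
proof -
  let ?G = "good_polys p n" and ?q = "p ^ n + 1"
  have sub: "?G \<subseteq> cyc_primes p n" by (auto simp: good_polys_def)
  then have finG: "finite ?G" using finite_cyc_primes[OF prime_gt_0_nat[OF p]] finite_subset by blast
  have finQ: "finite (Sp_residues n p)" by (rule finite_Sp_residues[OF prime_gt_0_nat[OF p]])
  let ?K = "\<lambda>f. {X \<in> Sp_residues n p. reduce_poly p (char_poly X) = f}"
  have "{X \<in> Sp_residues n p. good_char n p X} = (\<Union>f\<in>?G. ?K f)" by (auto simp: good_char_def)
  then have "card {X \<in> Sp_residues n p. good_char n p X} = (\<Sum>f\<in>?G. card (?K f))"
    using finG finQ by (simp only:) (intro card_UN_disjoint, auto)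
  then have "card {X \<in> Sp_residues n p. good_char n p X} * ?q = (\<Sum>f\<in>?G. card (?K f) * ?q)"
    by (simp only: sum_distrib_right)
  also have "\<dots> \<ge> (\<Sum>f\<in>?G. card (Sp_residues n p))"
    using sub by (intro sum_mono card_char_class[OF p n]) blast
  finally have 1: "card ?G * card (Sp_residues n p) \<le> card {X \<in> Sp_residues n p. good_char n p X} * ?q" by simp
  have "?q * card (Sp_residues n p) \<le> 8 * n * card ?G * card (Sp_residues n p)"
    by (intro mult_le_mono1 card_good_polys[OF p n big])
  also have "\<dots> = 8 * n * (card ?G * card (Sp_residues n p))" by simp
  also have "\<dots> \<le> 8 * n * (card {X \<in> Sp_residues n p. good_char n p X} * ?q)" by (intro mult_le_mono2 1)
  also have "\<dots> = ?q * (8 * n * card {X \<in> Sp_residues n p. good_char n p X})" by (simp only: mult_ac)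
  finally show ?thesis by (simp only: mult_le_cancel1)
qed

lemma good_char_mcong:
  assumes "A \<in> carrier_mat d d" "B \<in> carrier_mat d d" "mcong d p A B"
  shows "good_char n p A \<longleftrightarrow> good_char n p B"
  using char_poly_mcong[OF assms] by (simp add: good_char_def)

definition bad_residues :: "nat \<Rightarrow> nat \<Rightarrow> nat set \<Rightarrow> int mat set" where
  "bad_residues n m P = {X \<in> Sp_residues n m. \<forall>p\<in>P. \<not> good_char n p X}"

text \<open>Reduction modulo \<open>p\<close> and modulo the product of the other primes is a bijection onto pairs of residues,
so the conditions at different primes are independent.\<close>

lemma card_bad_residues:
  assumes n: "n \<ge> 1" and fin: "finite P" and P: "\<And>p. p \<in> P \<Longrightarrow> prime p \<and> p > 3 \<and> p \<ge> 22 * n ^ 2"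
  shows "perfect_mod n (\<Prod>P) \<and> real (card (bad_residues n (\<Prod>P) P)) \<le> (1 - 1 / (8 * real n)) ^ card P * card (Sp_residues n (\<Prod>P))"
  using fin P
proof (induction P rule: finite_induct)
  case empty
  have "card (bad_residues n 1 {}) = card (Sp_residues n 1)" by (simp add: bad_residues_def)
  then show ?case using perfect_mod_1 by simp
next
  case (insert p P)
  let ?M = "\<Prod>P"
  have p: "prime p" "p > 3" "p \<ge> 22 * n ^ 2" using insert.prems by blast+
  have IH: "perfect_mod n ?M" "real (card (bad_residues n ?M P)) \<le> (1 - 1 / (8 * real n)) ^ card P * card (Sp_residues n ?M)"
    using insert.IH insert.prems by simp_all
  have pP: "prime q" if "q \<in> P" for q using insert.prems[of q] that by simp
  have cop: "coprime p ?M"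
  proof (rule prod_coprime_right)
    fix q assume q: "q \<in> P"
    then have "p \<noteq> q" using insert.hyps(2) by blast
    then show "coprime p q" by (rule primes_coprime[OF p(1) pP[OF q]])
  qed
  have M0: "?M > 0" by (rule prod_pos) (rule prime_gt_0_nat[OF pP])
  have prodE: "\<Prod>(insert p P) = p * ?M" using insert.hyps by simp
  let ?h = "\<lambda>X. (reduce_mat p X, reduce_mat ?M X)"
  have QC: "X \<in> carrier_mat (2*n) (2*n)" if "X \<in> Sp_residues n m" for X m using that SpD(1) by (auto simp: Sp_residues_def)
  have lift: "reduce_mat m' X \<in> Sp_residues n m'" if "X \<in> Sp_residues n m" "m' dvd m" for X m m'
    using that reduce_mat_reduce_mat[OF SpD(1) that(2)] by (auto simp: Sp_residues_def)
  have d: "p dvd p * ?M" "?M dvd p * ?M" by simp_all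
  have inj: "inj_on ?h (Sp_residues n (p * ?M))"
  proof (rule inj_onI)
    fix X Y assume X: "X \<in> Sp_residues n (p * ?M)" and Y: "Y \<in> Sp_residues n (p * ?M)" and h: "?h X = ?h Y"
    then have "mcong (2*n) p X Y" "mcong (2*n) ?M X Y" using reduce_mat_eq_iff[OF QC[OF X] QC[OF Y]] by auto
    then have "mcong (2*n) (p * ?M) X Y" by (intro mcong_coprime[OF cop])
    then have "reduce_mat (p * ?M) X = reduce_mat (p * ?M) Y" using reduce_mat_eq_iff[OF QC[OF X] QC[OF Y]] by simp
    moreover have "reduce_mat (p * ?M) X = X" "reduce_mat (p * ?M) Y = Y" using X Y reduce_mat_reduce_mat[OF SpD(1) dvd_refl] by (auto simp: Sp_residues_def)
    ultimately show "X = Y" by simp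
  qed
  have surj: "?h ` Sp_residues n (p * ?M) = Sp_residues n p \<times> Sp_residues n ?M"
  proof
    show "?h ` Sp_residues n (p * ?M) \<subseteq> Sp_residues n p \<times> Sp_residues n ?M" using lift[OF _ d(1)] lift[OF _ d(2)] by blast
    show "Sp_residues n p \<times> Sp_residues n ?M \<subseteq> ?h ` Sp_residues n (p * ?M)"
    proof
      fix z assume "z \<in> Sp_residues n p \<times> Sp_residues n ?M"
      then obtain A B where A: "A \<in> carrier (Sp n)" and B: "B \<in> carrier (Sp n)" and z: "z = (reduce_mat p A, reduce_mat ?M B)"
        by (auto simp: Sp_residues_def)
      obtain C where C: "C \<in> carrier (Sp n)" "mcong (2*n) p A C" "mcong (2*n) ?M B C"
        using Sp_crt[OF p(1,2) cop A B] by blast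
      have "?h (reduce_mat (p * ?M) C) = (reduce_mat p C, reduce_mat ?M C)"
        using reduce_mat_reduce_mat[OF SpD(1)[OF C(1)] d(1)] reduce_mat_reduce_mat[OF SpD(1)[OF C(1)] d(2)] by simp
      also have "reduce_mat p C = reduce_mat p A" using C(2) reduce_mat_eq_iff[OF SpD(1)[OF A] SpD(1)[OF C(1)], of p] by simp
      also have "reduce_mat ?M C = reduce_mat ?M B" using C(3) reduce_mat_eq_iff[OF SpD(1)[OF B] SpD(1)[OF C(1)], of ?M] by simp
      also have "(reduce_mat p A, reduce_mat ?M B) = z" by (rule z[symmetric])
      finally show "z \<in> ?h ` Sp_residues n (p * ?M)" using C(1) by (force simp: Sp_residues_def)
    qed
  qed
  have cQ: "card (Sp_residues n (p * ?M)) = card (Sp_residues n p) * card (Sp_residues n ?M)"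
    using card_image[OF inj] unfolding surj by (simp add: card_cartesian_product)
  have "?h ` bad_residues n (p * ?M) (insert p P) \<subseteq> bad_residues n p {p} \<times> bad_residues n ?M P"
  proof (rule image_subsetI)
    fix X assume X: "X \<in> bad_residues n (p * ?M) (insert p P)"
    then have XQ: "X \<in> Sp_residues n (p * ?M)" and b: "\<And>q. q \<in> insert p P \<Longrightarrow> \<not> good_char n q X" by (auto simp: bad_residues_def)
    have XC: "X \<in> carrier_mat (2*n) (2*n)" by (rule QC[OF XQ])
    have "\<not> good_char n q (reduce_mat m X)" if "q \<in> insert p P" "q dvd m" for q m
    proof -
      have "mcong (2*n) q (reduce_mat m X) X" by (rule mcong_reduce_mat[OF XC that(2)])
      then show ?thesis using good_char_mcong[of "reduce_mat m X" "2*n" X q n] XC b[OF that(1)] by simp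
    qed
    moreover have "q dvd ?M" if "q \<in> P" for q using dvd_prodI[OF insert.hyps(1) that, of "\<lambda>x. x"] by simp
    ultimately show "?h X \<in> bad_residues n p {p} \<times> bad_residues n ?M P"
      using lift[OF XQ d(1)] lift[OF XQ d(2)] by (auto simp: bad_residues_def)
  qed
  moreover have finB: "finite (bad_residues n p {p})" "finite (bad_residues n ?M P)"
    using finite_Sp_residues[OF prime_gt_0_nat[OF p(1)]] finite_Sp_residues[OF M0] by (auto simp: bad_residues_def)
  moreover have "inj_on ?h (bad_residues n (p * ?M) (insert p P))" using inj by (rule inj_on_subset) (auto simp: bad_residues_def)
  ultimately have "card (bad_residues n (p * ?M) (insert p P)) \<le> card (bad_residues n p {p} \<times> bad_residues n ?M P)"
    by (intro card_inj_on_le[of ?h]) auto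
  then have c1: "real (card (bad_residues n (p * ?M) (insert p P))) \<le> real (card (bad_residues n p {p})) * real (card (bad_residues n ?M P))"
    unfolding card_cartesian_product using of_nat_mono[where 'a = real] by fastforce
  let ?c = "1 - 1 / (8 * real n)"
  have c0: "0 \<le> ?c" using n by (simp add: field_simps)
  have "real (card (bad_residues n p {p})) \<le> ?c * card (Sp_residues n p)"
  proof -
    have finQ: "finite (Sp_residues n p)" by (rule finite_Sp_residues[OF prime_gt_0_nat[OF p(1)]])
    let ?G = "{X \<in> Sp_residues n p. good_char n p X}"
    have "bad_residues n p {p} = Sp_residues n p - ?G" by (auto simp: bad_residues_def)
    then have "card (bad_residues n p {p}) = card (Sp_residues n p) - card ?G" using finQ by (simp add: card_Diff_subset)
    moreover have "card ?G \<le> card (Sp_residues n p)" using finQ by (intro card_mono) auto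
    ultimately have cB: "real (card (bad_residues n p {p})) = real (card (Sp_residues n p)) - real (card ?G)" by simp
    have "real (card (Sp_residues n p)) \<le> 8 * real n * real (card ?G)"
      using of_nat_mono[OF card_good_residues[OF p(1) n p(3)], where 'a = real] by simp
    then have "real (card (Sp_residues n p)) / (8 * real n) \<le> real (card ?G)" using n by (simp add: field_simps)
    moreover have "?c * card (Sp_residues n p) = card (Sp_residues n p) - real (card (Sp_residues n p)) / (8 * real n)"
      by (simp add: left_diff_distrib)
    ultimately show ?thesis using cB by linarith
  qed
  then have "real (card (bad_residues n (p * ?M) (insert p P))) \<le> (?c * card (Sp_residues n p)) * (?c ^ card P * card (Sp_residues n ?M))"
    using c0 by (intro order_trans[OF c1] mult_mono IH(2)) simp_all
  also have "\<dots> = ?c ^ card (insert p P) * card (Sp_residues n (p * ?M))"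
    using insert.hyps by (simp add: cQ)
  finally show ?case unfolding prodE using perfect_mod_step[OF p(1,2) cop IH(1)] by simp
qed

section \<open>From good residues to the theorem\<close>

lemma primem_cong: assumes "prime p" "lead_coeff F = 1" "primem p (reduce_poly p F)" shows "primem p F"
  using assms reduce_poly_monic[OF assms(1,2)] unfolding primem_def by auto

text \<open>If \<open>F = a * b\<close>, then \<open>F\<close> divides \<open>a\<close> or \<open>b\<close> modulo \<open>p\<close>. The leading coefficients of \<open>a\<close> and \<open>b\<close> are units, so
that factor has full degree.\<close>

lemma primem_imp_irreducible:
  assumes p: "prime p" and F: "primem p F" shows "irreducible F"
proof (rule irreducibleI)
  note m = primem_monic[OF F]
  show F0: "F \<noteq> 0" using m by auto
  show "\<not> is_unit F" using m by (auto simp: is_unit_poly_iff)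
  fix a b assume ab: "F = a * b"
  have n0: "a \<noteq> 0" "b \<noteq> 0" using F0 ab by auto
  have lc: "lead_coeff a * lead_coeff b = 1" using m(1) unfolding ab lead_coeff_mult .
  have unit: "is_unit c" if "is_unit (lead_coeff c)" "degree c = 0" for c :: "int poly"
    using that by (metis degree_eq_zeroE is_unit_const_poly_iff lead_coeff_pCons(2) pCons_0_0 coeff_pCons_0)
  have low: "degree a = 0" if d: "dvdm p F b" and ab: "F = a * b" and n0: "a \<noteq> 0" "b \<noteq> 0"
    and lc: "lead_coeff a * lead_coeff b = 1" for a b
  proof (rule ccontr)
    assume "degree a \<noteq> 0"
    then have "degree b < degree F" using degree_mult_eq[OF n0] ab by simp
    then have "[:int p:] dvd b" using dvdm_low_degree'[OF prime_gt_0_nat[OF p] m(1) d] by simp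
    then have "int p dvd lead_coeff b" using const_dvd_coeff by blast
    then have "int p dvd lead_coeff a * lead_coeff b" by (rule dvd_mult)
    then have "int p dvd 1" unfolding lc .
    then show False using p by auto
  qed
  have lcu: "is_unit (lead_coeff a)" "is_unit (lead_coeff b)" using lc by (metis dvd_triv_left, metis dvd_triv_right)
  have "dvdm p F (a * b)" using ab by (metis dvdm_self)
  then have "dvdm p F a \<or> dvdm p F b" by (rule primem_prodD[OF F])
  then show "is_unit a \<or> is_unit b"
  proof
    assume "dvdm p F b"
    then have "degree a = 0" by (rule low[OF _ ab n0 lc])
    then show ?thesis using unit[OF lcu(1)] by blast
  next
    assume "dvdm p F a"
    moreover have "F = b * a" "lead_coeff b * lead_coeff a = 1" using ab lc by (simp_all only: mult.commute)
    ultimately have "degree b = 0" using low[of a b] n0 by blast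
    then show ?thesis using unit[OF lcu(2)] by blast
  qed
qed

lemma coeff_prod_linear_factors:
  fixes z :: "'i \<Rightarrow> complex"
  assumes "finite S" "\<And>j. j \<in> S \<Longrightarrow> norm (z j) \<le> 1"
  shows "degree (\<Prod>j\<in>S. [:- z j, 1:]) = card S \<and> lead_coeff (\<Prod>j\<in>S. [:- z j, 1:]) = 1 \<and>
    (\<forall>k. Suc k = card S \<longrightarrow> norm (coeff (\<Prod>j\<in>S. [:- z j, 1:]) k) \<le> card S)"
  using assms
proof (induction S rule: finite_induct)
  case empty then show ?case by simp
next
  case (insert j S)
  let ?P = "\<Prod>j\<in>S. [:- z j, 1:]" and ?l = "[:- z j, 1:]"
  have IH: "degree ?P = card S" "lead_coeff ?P = 1" "\<And>k. Suc k = card S \<Longrightarrow> norm (coeff ?P k) \<le> card S"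
    using insert by auto
  have P0: "?P \<noteq> 0" using IH(2) by auto
  have e: "(\<Prod>j\<in>insert j S. [:- z j, 1:]) = ?l * ?P" using insert.hyps by simp
  have c: "card (insert j S) = Suc (card S)" using insert.hyps by simp
  have "degree (?l * ?P) = Suc (card S)" using degree_mult_eq[of ?l ?P] P0 IH(1) by simp
  moreover have "lead_coeff (?l * ?P) = 1" unfolding lead_coeff_mult using IH(2) by simp
  moreover have "norm (coeff (?l * ?P) (card S)) \<le> Suc (card S)"
  proof -
    have "coeff (?l * ?P) (card S) = - z j * coeff ?P (card S) + (case card S of 0 \<Rightarrow> 0 | Suc k \<Rightarrow> coeff ?P k)"
      by (simp add: coeff_pCons split: nat.split)
    also have "norm \<dots> \<le> norm (- z j * coeff ?P (card S)) + norm (case card S of 0 \<Rightarrow> 0 | Suc k \<Rightarrow> coeff ?P k)"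
      by (rule norm_triangle_ineq)
    also have "norm (- z j * coeff ?P (card S)) \<le> 1" using insert.prems[of j] IH(1,2) by (simp add: norm_mult)
    also have "norm (case card S of 0 \<Rightarrow> 0 | Suc k \<Rightarrow> coeff ?P k) \<le> card S" using IH(3) by (auto split: nat.split)
    finally show ?thesis by simp
  qed
  ultimately show ?case unfolding e c by auto
qed

lemma cyclotomic_coeff_bound:
  assumes F: "lead_coeff F = 1" "degree F = Suc k" and cy: "is_cyclotomic F"
  shows "\<bar>coeff F k\<bar> \<le> int (Suc k)"
proof -
  obtain d where d: "map_poly of_int F = cyclotomic_poly d" using cy by (auto simp: is_cyclotomic_def)
  let ?S = "{j. j \<in> {1..d} \<and> coprime j d}"
  have c: "degree (cyclotomic_poly d) = card ?S \<and> lead_coeff (cyclotomic_poly d) = 1 \<and>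
    (\<forall>k. Suc k = card ?S \<longrightarrow> norm (coeff (cyclotomic_poly d) k) \<le> card ?S)"
    unfolding cyclotomic_poly_def by (rule coeff_prod_linear_factors) auto
  have "degree (map_poly of_int F :: complex poly) = degree F"
    by (rule degree_map_poly) auto
  then have "card ?S = Suc k" using c d F by simp
  then have "norm (coeff (cyclotomic_poly d) k) \<le> Suc k" using c by simp
  then have "norm (of_int (coeff F k) :: complex) \<le> Suc k"
    unfolding d[symmetric] by (simp add: coeff_map_poly)
  then have "real_of_int \<bar>coeff F k\<bar> \<le> real_of_int (int (Suc k))" by simp
  then show ?thesis by linarith
qed

text \<open>All exponents of a polynomial in \<open>x\<^sup>m\<close> are multiples of \<open>m\<close>, and two consecutive numbers
are not both multiples of \<open>m\<close>.\<close>

lemma pcompose_monom_coeff_zero: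
  fixes h :: "int poly"
  assumes m: "m > 1" and d: "degree (pcompose h (monom 1 m)) = Suc k"
  shows "coeff (pcompose h (monom 1 m)) k = 0"
proof -
  have c: "coeff (pcompose h (monom 1 m)) i = 0" if "\<not> m dvd i" for i
    using that
  proof (induction h arbitrary: i)
    case (pCons a h)
    have "coeff (monom 1 m * pcompose h (monom 1 m)) i = 0"
    proof (cases "i < m")
      case False
      then have "\<not> m dvd (i - m)" using pCons.prems by (simp add: dvd_minus_self)
      then show ?thesis using pCons.IH[of "i - m"] False by (simp add: coeff_monom_mult)
    qed (simp add: coeff_monom_mult)
    moreover have "i \<noteq> 0" using pCons.prems by (intro notI) simp
    ultimately show ?case by (simp add: pcompose_pCons coeff_pCons split: nat.split)
  qed simp
  have "m dvd Suc k"
  proof (rule ccontr)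
    assume "\<not> m dvd Suc k"
    then have "lead_coeff (pcompose h (monom 1 m)) = 0" unfolding d by (rule c)
    then have "pcompose h (monom 1 m) = 0" by (simp only: leading_coeff_0_iff)
    then show False using d by (simp only: degree_0)
  qed
  then have "\<not> m dvd k" using m by (metis dvd_add_right_iff nat_dvd_1_iff_1 plus_1_eq_Suc add.commute less_irrefl)
  then show ?thesis by (rule c)
qed

definition nice :: "int mat \<Rightarrow> bool" where
  "nice A \<longleftrightarrow> irreducible (char_poly A) \<and> \<not> is_cyclotomic (char_poly A)
     \<and> \<not> (\<exists>(h :: int poly) (m :: nat). m > 1 \<and> char_poly A = pcompose h (monom 1 m))"

lemma good_char_imp_nice:
  assumes p: "prime p" and n: "n \<ge> 1" and A: "A \<in> carrier_mat (2*n) (2*n)" and g: "good_char n p A"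
  shows "nice A"
proof -
  let ?F = "char_poly A"
  have F: "degree ?F = 2 * n" "lead_coeff ?F = 1" using degree_monic_char_poly[OF A] by auto
  have gF: "reduce_poly p ?F \<in> good_polys p n" using g by (simp add: good_char_def)
  then have "primem p (reduce_poly p ?F)" by (auto simp: good_polys_def cyc_primes_def)
  then have "irreducible ?F" using primem_imp_irreducible[OF p primem_cong[OF p F(2)]] by simp
  obtain k where k: "2 * n = Suc k" using n by (cases "2 * n") auto
  have tr: "t \<noteq> coeff ?F k" if "t \<in> {- (2 * int n)..2 * int n}" for t
  proof
    assume "t = coeff ?F k"
    then have "[coeff (reduce_poly p ?F) (2*n - 1) = t] (mod (int p))" by (simp add: k cong_def)
    then show False using gF that by (auto simp: good_polys_def)
  qed
  have "\<not> is_cyclotomic ?F"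
  proof
    assume "is_cyclotomic ?F"
    then have "\<bar>coeff ?F k\<bar> \<le> int (Suc k)" using cyclotomic_coeff_bound[OF F(2)] F(1) k by simp
    then have "coeff ?F k \<in> {- (2 * int n)..2 * int n}" using arg_cong[OF k, of int] by auto
    then show False using tr by blast
  qed
  moreover have "\<not> (m > 1 \<and> ?F = pcompose h (monom 1 m))" for h :: "int poly" and m :: nat
  proof
    assume h: "m > 1 \<and> ?F = pcompose h (monom 1 m)"
    then have "coeff ?F k = 0" using pcompose_monom_coeff_zero[of m h k] F(1) k by simp
    then show False using tr[of 0] by simp
  qed
  ultimately show ?thesis using \<open>irreducible ?F\<close> by (auto simp: nice_def)
qed

text \<open>Perfectness modulo \<open>m\<close>, stated for preimages, is carried over to the finite group itself.\<close>

lemma walk_Sp_mod: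
  assumes gS: "g ` {1..k} \<subseteq> carrier (Sp n)" and gen: "generate (Sp n) (g ` {1..k}) = carrier (Sp n)"
    and k: "k \<ge> 1" and m: "m > 0" and perf: "perfect_mod n m"
  shows "finite_group_walk (Sp_mod n m) (\<lambda>i. reduce_mat m (g i)) k"
proof -
  interpret h: group_hom "Sp n" "Sp_mod n m" "reduce_mat m" by (rule reduce_mat_hom)
  have im: "(\<lambda>i. reduce_mat m (g i)) ` {1..k} = reduce_mat m ` (g ` {1..k})" by (simp add: image_image)
  have cQ: "carrier (Sp_mod n m) = reduce_mat m ` carrier (Sp n)" by (simp add: Sp_residues_def)
  show ?thesis
  proof (intro finite_group_walk.intro finite_group_walk_axioms.intro)
    show "group (Sp_mod n m)" by (rule group_Sp_mod)
    show "finite (carrier (Sp_mod n m))" using finite_Sp_residues[OF m] by simp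
    show "1 \<le> k" by (rule k)
    show "(\<lambda>i. reduce_mat m (g i)) ` {1..k} \<subseteq> carrier (Sp_mod n m)" unfolding im cQ using gS by blast
    show "generate (Sp_mod n m) ((\<lambda>i. reduce_mat m (g i)) ` {1..k}) = carrier (Sp_mod n m)"
      using h.generate_img[OF gS] unfolding im cQ gen by simp
    fix H assume H: "subgroup H (Sp_mod n m)"
      and comm: "\<And>a b. a \<in> carrier (Sp_mod n m) \<Longrightarrow> b \<in> carrier (Sp_mod n m) \<Longrightarrow>
        a \<otimes>\<^bsub>Sp_mod n m\<^esub> b \<otimes>\<^bsub>Sp_mod n m\<^esub> inv\<^bsub>Sp_mod n m\<^esub> a \<otimes>\<^bsub>Sp_mod n m\<^esub> inv\<^bsub>Sp_mod n m\<^esub> b \<in> H"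
    let ?K = "{A \<in> carrier (Sp n). reduce_mat m A \<in> H}"
    have "subgroup ?K (Sp n)"
    proof (rule group.subgroupI[OF group_Sp])
      show "?K \<subseteq> carrier (Sp n)" by blast
      have "\<one>\<^bsub>Sp n\<^esub> \<in> ?K" using subgroup.one_closed[OF H] by simp
      then show "?K \<noteq> {}" by blast
    next
      fix A assume "A \<in> ?K"
      then show "inv\<^bsub>Sp n\<^esub> A \<in> ?K" using Sp_inv(1) h.hom_inv subgroup.m_inv_closed[OF H] by auto
    next
      fix A B assume "A \<in> ?K" "B \<in> ?K"
      then show "A \<otimes>\<^bsub>Sp n\<^esub> B \<in> ?K" using Sp_mult_closed h.hom_mult[of A B] subgroup.m_closed[OF H] by auto
    qed
    moreover have "\<forall>A\<in>?K. \<forall>B\<in>carrier (Sp n). mcong (2*n) m A B \<longrightarrow> B \<in> ?K"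
      using reduce_mat_eq_iff[OF SpD(1) SpD(1)] by (metis (no_types, lifting) mem_Collect_eq)
    moreover have "\<forall>A\<in>carrier (Sp n). \<forall>B\<in>carrier (Sp n). A * B * inv\<^bsub>Sp n\<^esub> A * inv\<^bsub>Sp n\<^esub> B \<in> ?K"
    proof (intro ballI)
      fix A B assume A: "A \<in> carrier (Sp n)" and B: "B \<in> carrier (Sp n)"
      note iA = Sp_inv(1)[OF A] and iB = Sp_inv(1)[OF B]
      have c: "A * B * inv\<^bsub>Sp n\<^esub> A * inv\<^bsub>Sp n\<^esub> B \<in> carrier (Sp n)" by (intro Sp_mult_closed A B iA iB)
      have "reduce_mat m (A * B * inv\<^bsub>Sp n\<^esub> A * inv\<^bsub>Sp n\<^esub> B) = reduce_mat m A \<otimes>\<^bsub>Sp_mod n m\<^esub> reduce_mat m B \<otimes>\<^bsub>Sp_mod n m\<^esub> inv\<^bsub>Sp_mod n m\<^esub> (reduce_mat m A) \<otimes>\<^bsub>Sp_mod n m\<^esub> inv\<^bsub>Sp_mod n m\<^esub> (reduce_mat m B)"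
        using h.hom_mult[of A B] h.hom_mult[of "A * B" "inv\<^bsub>Sp n\<^esub> A"] h.hom_mult[of "A * B * inv\<^bsub>Sp n\<^esub> A" "inv\<^bsub>Sp n\<^esub> B"]
          h.hom_inv[OF A] h.hom_inv[OF B] A B iA iB Sp_mult_closed[OF A B] Sp_mult_closed[OF Sp_mult_closed[OF A B] iA]
        by simp
      moreover have "\<dots> \<in> H" by (rule comm) (use A B in \<open>simp_all add: Sp_residues_def\<close>)
      ultimately show "A * B * inv\<^bsub>Sp n\<^esub> A * inv\<^bsub>Sp n\<^esub> B \<in> ?K" using c by simp
    qed
    ultimately have "?K = carrier (Sp n)" using perf unfolding perfect_mod_def by blast
    then have "reduce_mat m ` carrier (Sp n) \<subseteq> H" by blast
    then show "H = carrier (Sp_mod n m)" using subgroup.subset[OF H] unfolding cQ by blast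
  qed
qed

lemma reduce_mat_random_product:
  assumes gS: "g ` {1..k} \<subseteq> carrier (Sp n)" and k: "k \<ge> 1"
    and w: "finite_group_walk (Sp_mod n m) (\<lambda>i. reduce_mat m (g i)) k"
  shows "map_pmf (reduce_mat m) (random_product n g k N) = finite_group_walk.walk (Sp_mod n m) (\<lambda>i. reduce_mat m (g i)) k N"
    and "set_pmf (random_product n g k N) \<subseteq> carrier (Sp n)"
proof -
  interpret w: finite_group_walk "Sp_mod n m" "\<lambda>i. reduce_mat m (g i)" k by (rule w)
  have *: "foldr (\<lambda>i A. g i * A) is (1\<^sub>m (2 * n)) \<in> carrier (Sp n) \<and>
      reduce_mat m (foldr (\<lambda>i A. g i * A) is (1\<^sub>m (2 * n))) = w.wprod is" if "set is \<subseteq> {1..k}" for "is"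
    using that
  proof (induction "is")
    case Nil then show ?case by simp
  next
    case (Cons i "is")
    let ?A = "foldr (\<lambda>i A. g i * A) is (1\<^sub>m (2 * n))"
    have gi: "g i \<in> carrier (Sp n)" using Cons.prems gS by auto
    have A: "?A \<in> carrier (Sp n)" "reduce_mat m ?A = w.wprod is" using Cons by auto
    have "reduce_mat m (g i * ?A) = w.wprod (i # is)"
      using reduce_mat_mult(1)[OF SpD(1)[OF gi] SpD(1)[OF A(1)], of m] A(2) by simp
    then show ?case using Sp_mult_closed[OF gi A(1)] by simp
  qed
  have ne: "{1..k} \<noteq> {}" using k by simp
  show "map_pmf (reduce_mat m) (random_product n g k N) = w.walk N"
    unfolding random_product_def w.walk_def map_pmf_comp
    using * ne by (intro map_pmf_cong refl) (auto simp: set_replicate_pmf)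
  show "set_pmf (random_product n g k N) \<subseteq> carrier (Sp n)"
    unfolding random_product_def using * ne by (auto simp: set_replicate_pmf)
qed

lemma Sp_nontrivial: assumes "n \<ge> 1" shows "carrier (Sp n) \<noteq> {1\<^sub>m (2*n)}"
proof
  assume *: "carrier (Sp n) = {1\<^sub>m (2*n)}"
  have "transv n (bvec 0) 1 \<in> carrier (Sp n)" by (rule transv_Sp)
  then have t: "transv n (bvec 0) 1 = 1\<^sub>m (2*n)" using * by simp
  have "transv n (bvec 0) 1 $$ (0, n) = 0" unfolding t using assms by simp
  moreover have "transv n (bvec 0) 1 $$ (0, n) = omega n (bvec n) (bvec 0)"
    using assms by (simp add: transv_def bvec_def)
  moreover have "omega n (bvec n) (bvec 0) = -1" unfolding omega_bvec_right using assms by (simp add: bvec_def)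
  ultimately show False by simp
qed

theorem theorem8p2:
  fixes n k :: nat and g :: "nat \<Rightarrow> int mat"
  assumes "n \<ge> 1"
    and "g ` {1..k} \<subseteq> carrier (Sp n)"
    and "generate (Sp n) (g ` {1..k}) = carrier (Sp n)"
  shows "(\<lambda>N. measure_pmf.prob (random_product n g k N)
            {A. irreducible (char_poly A)
              \<and> \<not> is_cyclotomic (char_poly A)
              \<and> \<not> (\<exists>(h :: int poly) (m :: nat). m > 1 \<and> char_poly A = pcompose h (monom 1 m))})
          \<longlonglongrightarrow> 1"
proof -
  note n = assms(1) and gS = assms(2) and gen = assms(3)
  have k: "k \<ge> 1"
  proof (rule ccontr)
    assume "\<not> k \<ge> 1"
    then have "generate (Sp n) {} = carrier (Sp n)" using gen by simp
    then show False using Sp_nontrivial[OF n] group.generate_empty[OF group_Sp, of n] by simp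
  qed
  let ?R = "\<lambda>N. random_product n g k N"
  let ?E = "{A. irreducible (char_poly A) \<and> \<not> is_cyclotomic (char_poly A)
              \<and> \<not> (\<exists>(h :: int poly) (m :: nat). m > 1 \<and> char_poly A = pcompose h (monom 1 m))}"
  have E: "?E = {A. nice A}" by (simp add: nice_def)
  have main: "\<exists>N0. \<forall>N\<ge>N0. measure_pmf.prob (?R N) {A. \<not> nice A} < e" if e: "e > 0" for e :: real
  proof -
    let ?c = "1 - 1 / (8 * real n)"
    have c: "0 \<le> ?c" "?c < 1" using n by (simp_all add: field_simps)
    \<comment> \<open>Half of \<open>e\<close> bounds the limiting probability, the other half the deviation from equidistribution.\<close>
    obtain r where r: "?c ^ r < e / 2" using real_arch_pow_inv[of "e / 2" ?c] e c by auto
    have inf: "infinite {p::nat. prime p \<and> p > max 3 (22 * n ^ 2)}"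
    proof
      assume "finite {p::nat. prime p \<and> p > max 3 (22 * n ^ 2)}"
      moreover have "{p::nat. prime p} \<subseteq> {p. prime p \<and> p > max 3 (22 * n ^ 2)} \<union> {..max 3 (22 * n ^ 2)}" by auto
      ultimately have "finite {p::nat. prime p}" by (meson finite_Un finite_atMost finite_subset)
      then show False using primes_infinite by blast
    qed
    obtain P where P: "finite P" "card P = r" "P \<subseteq> {p::nat. prime p \<and> p > max 3 (22 * n ^ 2)}"
      using infinite_arbitrarily_large[OF inf, of r] by blast
    let ?m = "\<Prod>P"
    have Pp: "prime p \<and> p > 3 \<and> p \<ge> 22 * n ^ 2" if "p \<in> P" for p using P(3) that by auto
    have m0: "?m > 0" by (rule prod_pos) (use Pp prime_gt_0_nat in blast)
    have perf: "perfect_mod n ?m" and bad: "real (card (bad_residues n ?m P)) \<le> ?c ^ r * card (Sp_residues n ?m)"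
      using card_bad_residues[OF n P(1) Pp] P(2) by auto
    have w: "finite_group_walk (Sp_mod n ?m) (\<lambda>i. reduce_mat ?m (g i)) k"
      by (rule walk_Sp_mod[OF gS gen k m0 perf])
    interpret w: finite_group_walk "Sp_mod n ?m" "\<lambda>i. reduce_mat ?m (g i)" k by (rule w)
    let ?q = "real (card (Sp_residues n ?m))"
    have oq: "real (Coset.order (Sp_mod n ?m)) = ?q" by (simp add: Coset.order_def)
    have q0: "?q > 0" using w.order_pos oq by linarith
    have "e / (2 * ?q) > 0" using e q0 by simp
    then obtain N0 where N0: "\<And>N x. N \<ge> N0 \<Longrightarrow> x \<in> Sp_residues n ?m \<Longrightarrow> pmf (w.walk N) x \<le> 1 / ?q + e / (2 * ?q)"
      using w.walk_equidistributes[of "e / (2 * ?q)"] unfolding oq Sp_mod_simps by blast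
    have finB: "finite (bad_residues n ?m P)" using finite_Sp_residues[OF m0] by (auto simp: bad_residues_def)
    have "measure_pmf.prob (?R N) {A. \<not> nice A} < e" if N: "N \<ge> N0" for N
    proof -
      have "measure_pmf.prob (?R N) {A. \<not> nice A} \<le> measure_pmf.prob (?R N) (reduce_mat ?m -` bad_residues n ?m P)"
      proof (rule measure_pmf.finite_measure_mono_AE)
        show "AE A in measure_pmf (?R N). A \<in> {A. \<not> nice A} \<longrightarrow> A \<in> reduce_mat ?m -` bad_residues n ?m P"
        proof (rule AE_pmfI, rule impI)
          fix A assume "A \<in> set_pmf (?R N)" and b: "A \<in> {A. \<not> nice A}"
          then have A: "A \<in> carrier (Sp n)" using reduce_mat_random_product(2)[OF gS k w] by blast
          have AC: "A \<in> carrier_mat (2*n) (2*n)" by (rule SpD(1)[OF A])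
          have "\<not> good_char n p (reduce_mat ?m A)" if p: "p \<in> P" for p
          proof
            assume g: "good_char n p (reduce_mat ?m A)"
            have "p dvd ?m" using dvd_prodI[OF P(1) p, of "\<lambda>x. x"] by simp
            then have "mcong (2*n) p (reduce_mat ?m A) A" by (rule mcong_reduce_mat[OF AC])
            then have "good_char n p A" using g good_char_mcong[of "reduce_mat ?m A" "2*n" A p n] AC by simp
            then have "nice A" using good_char_imp_nice[OF _ n AC] Pp[OF p] by blast
            then show False using b by simp
          qed
          then show "A \<in> reduce_mat ?m -` bad_residues n ?m P" using A by (auto simp: bad_residues_def Sp_residues_def)
        qed
      qed auto
      also have "\<dots> = measure_pmf.prob (w.walk N) (bad_residues n ?m P)"
        using reduce_mat_random_product(1)[OF gS k w, of N] by (metis measure_map_pmf)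
      also have "\<dots> = (\<Sum>x\<in>bad_residues n ?m P. pmf (w.walk N) x)" using finB by (rule measure_measure_pmf_finite)
      also have "\<dots> \<le> (\<Sum>x\<in>bad_residues n ?m P. 1 / ?q + e / (2 * ?q))"
        by (intro sum_mono N0 N) (auto simp: bad_residues_def)
      also have "\<dots> = card (bad_residues n ?m P) * (1 / ?q + e / (2 * ?q))" by simp
      also have "\<dots> = card (bad_residues n ?m P) / ?q + card (bad_residues n ?m P) / ?q * (e / 2)"
        by (simp add: algebra_simps)
      also have "\<dots> \<le> ?c ^ r + 1 * (e / 2)"
      proof (rule add_mono)
        show "card (bad_residues n ?m P) / ?q \<le> ?c ^ r" using bad q0 by (simp add: field_simps)
        have "card (bad_residues n ?m P) \<le> card (Sp_residues n ?m)" using finite_Sp_residues[OF m0] by (intro card_mono) (auto simp: bad_residues_def)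
        then have "card (bad_residues n ?m P) / ?q \<le> 1" using q0 by simp
        then show "card (bad_residues n ?m P) / ?q * (e / 2) \<le> 1 * (e / 2)" using e by (intro mult_right_mono) auto
      qed
      also have "\<dots> < e" using r by simp
      finally show ?thesis .
    qed
    then show ?thesis by blast
  qed
  have compl: "measure_pmf.prob (?R N) {A. nice A} = 1 - measure_pmf.prob (?R N) {A. \<not> nice A}" for N
    using measure_pmf.prob_compl[of "{A. \<not> nice A}" "?R N"] by (simp add: Compl_eq_Diff_UNIV[symmetric] Collect_neg_eq[symmetric])
  show ?thesis unfolding E
  proof (rule LIMSEQ_I)
    fix e :: real assume "0 < e"
    from main[OF this] obtain N0 where N0: "\<And>N. N \<ge> N0 \<Longrightarrow> measure_pmf.prob (?R N) {A. \<not> nice A} < e" by blast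
    show "\<exists>N0. \<forall>N\<ge>N0. norm (measure_pmf.prob (?R N) {A. nice A} - 1) < e"
      unfolding compl using N0 by (intro exI[of _ N0]) auto
  qed
qed

end
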